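(* Let $E\subset\mathbb R^2$ be a polygon that is star-shaped with respect to a ball $B_1$ of radius $\rho_1$ and contained in a ball $B_2$ of radius $\rho_2$. Then there exists a constant $C$, depending only on the ratio $\rho_2/\rho_1$, such that $$\|v\|_{L^\infty(E)}\le C\,\|v\|_{L^\infty(\partial E)}\qquad\forall v\in V_E.$$
   Context: $V_E$ is the enhanced virtual element space of order one on $E$: $V_E=\{v\in H^1(E):v_{|\partial E}\in B_{\partial E},\ \Delta v\in\mathbb P_1(E),\ \int_E(v-\Pi^\nabla_Ev)q_1=0\ \forall q_1\in\mathbb P_1(E)\}$, where $B_{\partial E}$ is the space of continuous functions on $\partial E$ affine on each edge of $E$, and $\Pi^\nabla_E:H^1(E)\to\mathbb P_1(E)$ is defined by $(\nabla(v-\Pi^\nabla_Ev),\nabla q)_{L^2(E)}=0$ for all $q\in\mathbb P_1(E)$ and $\int_{\partial E}(v-\Pi^\nabla_Ev)=0$. *)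

theory Defs
  imports "HOL-Analysis.Analysis" "HOL-Probability.Essential_Supremum"
begin

text \<open>
  A polygon is given by the cyclic list of its vertices. Interior angles equal to \<open>\<pi>\<close>
  (hanging nodes) are allowed, so that the list also fixes what the edges are.
\<close>

definition next_vertex :: "(real^2) list \<Rightarrow> nat \<Rightarrow> real^2" where
  "next_vertex vs i = vs ! (Suc i mod length vs)"

definition edge :: "(real^2) list \<Rightarrow> nat \<Rightarrow> (real^2) set" where
  "edge vs i = closed_segment (vs ! i) (next_vertex vs i)"

definition simple_polygon :: "(real^2) list \<Rightarrow> bool" where
  "simple_polygon vs \<longleftrightarrow> 3 \<le> length vs \<and> distinct vs \<and>
     (\<forall>i<length vs. \<forall>j<length vs. i \<noteq> j \<longrightarrow>
        edge vs i \<inter> edge vs j = {vs ! i, next_vertex vs i} \<inter> {vs ! j, next_vertex vs j})"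

definition polygon_boundary :: "(real^2) list \<Rightarrow> (real^2) set" where
  "polygon_boundary vs = (\<Union>i<length vs. edge vs i)"

text \<open>The polygon as an open set: the bounded Jordan domain enclosed by the edges.\<close>

definition polygon_domain :: "(real^2) list \<Rightarrow> (real^2) set" where
  "polygon_domain vs = inside (polygon_boundary vs)"

definition star_shaped_wrt :: "'a::real_vector set \<Rightarrow> 'a set \<Rightarrow> bool" where
  "star_shaped_wrt S B \<longleftrightarrow> (\<forall>x\<in>S. convex hull (insert x B) \<subseteq> S)"

text \<open>
  Arc length on the boundary: the image of Lebesgue measure on \<open>n\<close> copies of \<open>[0,1]\<close>, the
  \<open>i\<close>-th one weighted by the length of the \<open>i\<close>-th edge, under the affine parametrisations
  of the edges.
\<close>

definition edge_param :: "(real^2) list \<Rightarrow> nat \<times> real \<Rightarrow> real^2" where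
  "edge_param vs = (\<lambda>(i, t). (1 - t) *\<^sub>R (vs ! i) + t *\<^sub>R next_vertex vs i)"

definition edge_weight :: "(real^2) list \<Rightarrow> nat \<times> real \<Rightarrow> ennreal" where
  "edge_weight vs = (\<lambda>(i, t). ennreal (dist (vs ! i) (next_vertex vs i)))"

definition boundary_measure :: "(real^2) list \<Rightarrow> (real^2) measure" where
  "boundary_measure vs =
     distr (density (count_space {..<length vs} \<Otimes>\<^sub>M restrict_space lborel {0..1}) (edge_weight vs))
       (restrict_space borel (polygon_boundary vs)) (edge_param vs)"

lemma edge_param_measurable:
  "edge_param vs \<in> (count_space {..<length vs} \<Otimes>\<^sub>M restrict_space lborel {0..1})
     \<rightarrow>\<^sub>M restrict_space borel (polygon_boundary vs)"
proof (rule measurable_restrict_space2)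
  show "edge_param vs \<in> space (count_space {..<length vs} \<Otimes>\<^sub>M restrict_space lborel {0..1})
      \<rightarrow> polygon_boundary vs"
    by (fastforce simp: space_pair_measure space_restrict_space edge_param_def polygon_boundary_def
        edge_def in_segment)
  show "edge_param vs \<in> (count_space {..<length vs} \<Otimes>\<^sub>M restrict_space lborel {0..1}) \<rightarrow>\<^sub>M borel"
  proof (rule measurable_pair_measure_countable1)
    fix i assume "i \<in> {..<length vs}"
    have "(\<lambda>t. (1 - t) *\<^sub>R (vs ! i) + t *\<^sub>R next_vertex vs i) \<in> borel_measurable lborel"
      by measurable
    then show "(\<lambda>t. edge_param vs (i, t)) \<in> restrict_space lborel {0..1} \<rightarrow>\<^sub>M borel"
      by (auto simp: edge_param_def intro: measurable_restrict_space1)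
  qed auto
qed

lemma edge_weight_measurable:
  "edge_weight vs \<in> borel_measurable (count_space {..<length vs} \<Otimes>\<^sub>M restrict_space lborel {0..1})"
  by (rule measurable_pair_measure_countable1) (auto simp: edge_weight_def)

lemma nn_integral_boundary_measure:
  assumes f: "f \<in> borel_measurable (restrict_space borel (polygon_boundary vs))"
  shows "(\<integral>\<^sup>+x. f x \<partial>boundary_measure vs) =
    (\<Sum>i<length vs. ennreal (dist (vs ! i) (next_vertex vs i)) *
       (\<integral>\<^sup>+t\<in>{0..1}. f ((1 - t) *\<^sub>R (vs ! i) + t *\<^sub>R next_vertex vs i) \<partial>lborel))"
proof -
  let ?I = "restrict_space lborel {0..1::real}"
  let ?M = "count_space {..<length vs} \<Otimes>\<^sub>M ?I"
  have fin: "sigma_finite_measure ?I"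
    by (intro sigma_finite_measure_restrict_space lborel.sigma_finite_measure_axioms) auto
  have fp: "(\<lambda>z. f (edge_param vs z)) \<in> borel_measurable ?M"
    using measurable_compose[OF edge_param_measurable f] .
  have w: "edge_weight vs \<in> borel_measurable ?M"
    by (rule edge_weight_measurable)
  have fpi: "(\<lambda>t. f (edge_param vs (i, t))) \<in> borel_measurable ?I" if "i < length vs" for i
    using measurable_compose[OF measurable_Pair1' fp, of i] that by simp
  have "(\<integral>\<^sup>+x. f x \<partial>boundary_measure vs) = (\<integral>\<^sup>+z. edge_weight vs z * f (edge_param vs z) \<partial>?M)"
    unfolding boundary_measure_def
    using edge_param_measurable f fp w
    by (subst nn_integral_distr) (auto simp: nn_integral_density)
  also have "\<dots> = (\<integral>\<^sup>+i. \<integral>\<^sup>+t. edge_weight vs (i, t) * f (edge_param vs (i, t)) \<partial>?I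
      \<partial>count_space {..<length vs})"
    by (rule sigma_finite_measure.nn_integral_fst[OF fin, symmetric])
      (use fp w in measurable)
  also have "\<dots> = (\<Sum>i<length vs. \<integral>\<^sup>+t. edge_weight vs (i, t) * f (edge_param vs (i, t)) \<partial>?I)"
    by (simp add: nn_integral_count_space_finite)
  also have "\<dots> = (\<Sum>i<length vs. ennreal (dist (vs ! i) (next_vertex vs i)) *
       (\<integral>\<^sup>+t. f (edge_param vs (i, t)) \<partial>?I))"
    using fpi by (intro sum.cong refl) (auto simp: edge_weight_def nn_integral_cmult)
  finally show ?thesis
    by (simp add: nn_integral_restrict_space edge_param_def)
qed

text \<open>
  Elements of $L^2$, $H^1$ and the virtual element space are represented by functions on the
  whole plane; only their values almost everywhere on the domain matter.
\<close>

definition square_integrable :: "'a measure \<Rightarrow> ('a \<Rightarrow> 'b::euclidean_space) \<Rightarrow> bool" where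
  "square_integrable M f \<longleftrightarrow> f \<in> borel_measurable M \<and> integrable M (\<lambda>x. (norm (f x))\<^sup>2)"

definition Linf_norm :: "'a measure \<Rightarrow> ('a \<Rightarrow> real) \<Rightarrow> ennreal" where
  "Linf_norm M f = esssup M (\<lambda>x. ennreal \<bar>f x\<bar>)"

definition pd :: "2 \<Rightarrow> (real^2 \<Rightarrow> real) \<Rightarrow> real^2 \<Rightarrow> real" where
  "pd i f x = frechet_derivative f (at x) (axis i 1)"

definition grad :: "(real^2 \<Rightarrow> real) \<Rightarrow> real^2 \<Rightarrow> real^2" where
  "grad f x = (\<chi> i. pd i f x)"

definition laplacian :: "(real^2 \<Rightarrow> real) \<Rightarrow> real^2 \<Rightarrow> real" where
  "laplacian f x = (\<Sum>i\<in>UNIV. pd i (pd i f) x)"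

fun Ck :: "nat \<Rightarrow> (real^2 \<Rightarrow> real) \<Rightarrow> bool" where
  "Ck 0 f \<longleftrightarrow> continuous_on UNIV f"
| "Ck (Suc k) f \<longleftrightarrow> (\<forall>x. f differentiable at x) \<and> (\<forall>i. Ck k (pd i f))"

definition smooth :: "(real^2 \<Rightarrow> real) \<Rightarrow> bool" where
  "smooth f \<longleftrightarrow> (\<forall>k. Ck k f)"

definition test_function :: "(real^2) set \<Rightarrow> (real^2 \<Rightarrow> real) \<Rightarrow> bool" where
  "test_function E \<phi> \<longleftrightarrow> smooth \<phi> \<and>
     compact (closure {x. \<phi> x \<noteq> 0}) \<and> closure {x. \<phi> x \<noteq> 0} \<subseteq> E"

definition is_weak_gradient :: "(real^2) set \<Rightarrow> (real^2 \<Rightarrow> real) \<Rightarrow> (real^2 \<Rightarrow> real^2) \<Rightarrow> bool" where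
  "is_weak_gradient E v g \<longleftrightarrow> square_integrable (lebesgue_on E) g \<and>
     (\<forall>\<phi> i. test_function E \<phi> \<longrightarrow>
        (LINT x|lebesgue_on E. v x * pd i \<phi> x) = - (LINT x|lebesgue_on E. g x $ i * \<phi> x))"

definition H1 :: "(real^2) set \<Rightarrow> (real^2 \<Rightarrow> real) set" where
  "H1 E = {v. square_integrable (lebesgue_on E) v \<and> (\<exists>g. is_weak_gradient E v g)}"

text \<open>For \<open>v \<in> H1 E\<close> the weak gradient is unique up to null sets.\<close>

definition weak_grad :: "(real^2) set \<Rightarrow> (real^2 \<Rightarrow> real) \<Rightarrow> real^2 \<Rightarrow> real^2" where
  "weak_grad E v = (SOME g. is_weak_gradient E v g)"

definition P1 :: "(real^2 \<Rightarrow> real) set" where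
  "P1 = {p. \<exists>a b. p = (\<lambda>x. a + b \<bullet> x)}"

definition has_distributional_laplacian ::
  "(real^2) set \<Rightarrow> (real^2 \<Rightarrow> real) \<Rightarrow> (real^2 \<Rightarrow> real) \<Rightarrow> bool" where
  "has_distributional_laplacian E v f \<longleftrightarrow>
     (\<forall>\<phi>. test_function E \<phi> \<longrightarrow>
        (LINT x|lebesgue_on E. v x * laplacian \<phi> x) = (LINT x|lebesgue_on E. f x * \<phi> x))"

text \<open>
  The trace operator $H^1(E) \to L^2(\partial E)$ is the continuous extension of the restriction
  of smooth functions, which are dense in $H^1(E)$. Its graph is therefore the closure of the
  graph of the restriction; traces are unique up to null sets of the boundary.
\<close>

definition is_boundary_trace :: "(real^2) list \<Rightarrow> (real^2 \<Rightarrow> real) \<Rightarrow> (real^2 \<Rightarrow> real) \<Rightarrow> bool" where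
  "is_boundary_trace vs v g \<longleftrightarrow> square_integrable (boundary_measure vs) g \<and>
     (\<exists>\<phi> :: nat \<Rightarrow> real^2 \<Rightarrow> real. (\<forall>n. smooth (\<phi> n)) \<and>
        (\<lambda>n. LINT x|lebesgue_on (polygon_domain vs). (\<phi> n x - v x)\<^sup>2) \<longlonglongrightarrow> 0 \<and>
        (\<lambda>n. LINT x|lebesgue_on (polygon_domain vs).
               (norm (grad (\<phi> n) x - weak_grad (polygon_domain vs) v x))\<^sup>2) \<longlonglongrightarrow> 0 \<and>
        (\<lambda>n. LINT x|boundary_measure vs. (\<phi> n x - g x)\<^sup>2) \<longlonglongrightarrow> 0)"

definition boundary_trace :: "(real^2) list \<Rightarrow> (real^2 \<Rightarrow> real) \<Rightarrow> real^2 \<Rightarrow> real" where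
  "boundary_trace vs v = (SOME g. is_boundary_trace vs v g)"

definition boundary_space :: "(real^2) list \<Rightarrow> (real^2 \<Rightarrow> real) set" where
  "boundary_space vs = {g. continuous_on (polygon_boundary vs) g \<and>
     (\<forall>i<length vs. \<exists>p\<in>P1. \<forall>x\<in>edge vs i. g x = p x)}"

definition Pi_nabla :: "(real^2) list \<Rightarrow> (real^2 \<Rightarrow> real) \<Rightarrow> real^2 \<Rightarrow> real" where
  "Pi_nabla vs v = (THE p. p \<in> P1 \<and>
     (\<forall>q\<in>P1. (LINT x|lebesgue_on (polygon_domain vs).
        (weak_grad (polygon_domain vs) v x - grad p x) \<bullet> grad q x) = 0) \<and>
     (LINT x|boundary_measure vs. boundary_trace vs v x - p x) = 0)"

definition VE :: "(real^2) list \<Rightarrow> (real^2 \<Rightarrow> real) set" where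
  "VE vs = {v \<in> H1 (polygon_domain vs).
     (\<exists>g\<in>boundary_space vs. is_boundary_trace vs v g) \<and>
     (\<exists>p\<in>P1. has_distributional_laplacian (polygon_domain vs) v p) \<and>
     (\<forall>q\<in>P1. (LINT x|lebesgue_on (polygon_domain vs). (v x - Pi_nabla vs v x) * q x) = 0)}"

end

theory Submission
  imports Defs
begin

text \<open>
  Let \<open>T\<close> be the trace of \<open>v\<close>, \<open>\<bar>T\<bar> \<le> K\<close>, and let \<open>p = \<Delta> v\<close>, an affine function. A weak maximum principle
  with a quadratic barrier gives \<open>\<bar>v\<bar> \<le> K + sup \<bar>p\<bar> \<rho>'\<^sup>2\<close>, so \<open>p\<close> has to be bounded by \<open>K / \<rho>\<^sup>2\<close>. Instead of
  subtracting the harmonic extension of \<open>T\<close>, truncate: for \<open>F\<close> smooth, vanishing on \<open>[- K, K]\<close>, with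
  \<open>0 \<le> F' \<le> 1\<close> and \<open>F t - t\<close> of order \<open>K\<close>, the function \<open>F (v)\<close> has zero trace, and testing the equation with it gives
  \<open>\<parallel>F (v)\<parallel>\<^sup>2 \<le> C \<rho>'\<^sup>2 (- \<integral> p F (v))\<close>. Up to an error \<open>C K \<integral> \<bar>p\<bar>\<close> the right-hand side is \<open>- \<integral> p v\<close>, which the
  enhancement condition turns into an integral of \<open>p\<close> times the projection of \<open>v\<close>; the latter is bounded by \<open>C K\<close>. Conversely,
  testing \<open>\<Delta> v = p\<close> with bump functions on the inner ball bounds \<open>p\<close> by \<open>\<parallel>v\<parallel>\<close>, hence by \<open>\<parallel>F (v)\<parallel>\<close> and \<open>K\<close>. The two
  estimates close because the first one is quadratic in \<open>\<parallel>F (v)\<parallel>\<close>.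

  No trace or density theorem is needed: near the boundary everything is controlled on the strip
  \<open>E - a E\<close>, where polar coordinates centred in the inner ball and integration along rays compare
  the integral of \<open>u\<^sup>2\<close> with its boundary values and with the gradient of \<open>u\<close>.
\<close>

section \<open>Smooth functions\<close>

text \<open>The trace is given only through smooth functions converging in L2 on the domain, in the
  gradient and on the boundary. So each estimate is proved for a smooth \<open>u\<close>, with its
  distances to the limit as explicit error terms, and must survive L2 limits; this is why
  truncations are 1-Lipschitz. The obstacle is that test functions need compact support, while F(v)
  merely has zero trace: a cutoff over a strip of relative width \<delta> costs a gradient of order
  1/(\<delta> \<rho>). The strip inequality pays for it. For zero boundary data the integral of
  F(u)^2 over the strip is of order \<delta>^2 times the energy there, so the cutoff error is
  bounded by the energy in the strip, which vanishes with \<delta>. Hence the approximants go to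
  their limit first, at fixed \<delta>. The same inequality on the full domain is a Poincare
  inequality. Star-shapedness with respect to a ball, and not only a point, is what separates E from
  its contractions by a distance of order \<delta> \<rho>. Cutoffs are mollified indicators with a
  universal constant, and all lengths then combine to the ratio of the radii.\<close>

lemma pd_eqI: "(f has_derivative f') (at x) \<Longrightarrow> pd i f x = f' (axis i 1)"
  unfolding pd_def by (metis frechet_derivative_at)

lemma inner_grad: "grad f x \<bullet> h = (\<Sum>i\<in>UNIV. pd i f x * h $ i)"
  by (simp add: grad_def inner_vec_def)

lemma has_derivative_grad:
  assumes "f differentiable (at x)"
  shows "(f has_derivative (\<lambda>h. grad f x \<bullet> h)) (at x)"
proof -
  have d: "(f has_derivative frechet_derivative f (at x)) (at x)"
    using assms frechet_derivative_works by blast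
  then interpret bounded_linear "frechet_derivative f (at x)" by (rule has_derivative_bounded_linear)
  have "frechet_derivative f (at x) h = grad f x \<bullet> h" for h
  proof -
    have "frechet_derivative f (at x) h = frechet_derivative f (at x) (\<Sum>i\<in>UNIV. h $ i *\<^sub>R axis i 1)"
      by (simp add: basis_expansion[of h, unfolded scalar_mult_eq_scaleR])
    also have "\<dots> = grad f x \<bullet> h"
      by (simp add: sum scale inner_grad pd_def mult.commute)
    finally show ?thesis .
  qed
  then show ?thesis using d by presburger
qed

lemma grad_eqI:
  assumes "(f has_derivative (\<lambda>h. g \<bullet> h)) (at x)"
  shows "grad f x = g"
  using pd_eqI[OF assms] by (simp add: grad_def vec_eq_iff inner_axis)

text \<open>\<open>Ck (Suc k)\<close> does not repeat the continuity of the lower derivatives;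
  differentiability supplies it in the base case, and the induction then runs on the partial
  derivatives.\<close>

lemma Ck_SucD: "Ck (Suc k) f \<Longrightarrow> Ck k f"
proof (induction k arbitrary: f)
  case 0
  then show ?case
    by (auto intro!: continuous_at_imp_continuous_on differentiable_imp_continuous_within)
next
  case (Suc k)
  from Suc.prems have 1: "\<forall>x. f differentiable at x" and 2: "\<And>i. Ck (Suc k) (pd i f)"
    by (simp_all only: Ck.simps(2)[of "Suc k"]) auto
  show ?case using 1 Suc.IH[OF 2] by (simp add: Ck.simps(2)[of k])
qed

lemma Ck_const: "Ck k (\<lambda>x. c)"
proof (induction k arbitrary: c)
  case (Suc k)
  have "pd i (\<lambda>x. c) = (\<lambda>x. 0)" for i by (rule ext, rule pd_eqI[where f'="\<lambda>_. 0", simplified]) simp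
  then show ?case using Suc by simp
qed simp

lemma pd_add:
  assumes "f differentiable at x" "g differentiable at x"
  shows "pd i (\<lambda>x. f x + g x) x = pd i f x + pd i g x"
  using has_derivative_add[OF has_derivative_grad[OF assms(1)] has_derivative_grad[OF assms(2)]]
  by (auto simp: pd_eqI grad_def inner_axis)

lemma Ck_add: "Ck k f \<Longrightarrow> Ck k g \<Longrightarrow> Ck k (\<lambda>x. f x + g x)"
proof (induction k arbitrary: f g)
  case (Suc k)
  then have d: "\<And>x. f differentiable at x" "\<And>x. g differentiable at x" by auto
  have "pd i (\<lambda>x. f x + g x) = (\<lambda>x. pd i f x + pd i g x)" for i
    using pd_add d by blast
  with Suc d show ?case by simp
qed (auto intro: continuous_intros)

lemma pd_mult:
  assumes "f differentiable at x" "g differentiable at x"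
  shows "pd i (\<lambda>x. f x * g x) x = f x * pd i g x + pd i f x * g x"
  using has_derivative_mult[OF has_derivative_grad[OF assms(1)] has_derivative_grad[OF assms(2)]]
  by (auto simp: pd_eqI grad_def inner_axis)

lemma Ck_mult: "Ck k f \<Longrightarrow> Ck k g \<Longrightarrow> Ck k (\<lambda>x. f x * g x)"
proof (induction k arbitrary: f g)
  case (Suc k)
  then have d: "\<And>x. f differentiable at x" "\<And>x. g differentiable at x" by auto
  have "pd i (\<lambda>x. f x * g x) = (\<lambda>x. f x * pd i g x + pd i f x * g x)" for i
    using pd_mult d by blast
  moreover have "Ck k f" "Ck k g" using Suc.prems Ck_SucD by blast+
  moreover have "Ck k (pd i f)" "Ck k (pd i g)" for i using Suc.prems by auto
  ultimately show ?case using d Suc.IH by (simp add: Ck_add)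
qed (auto intro: continuous_intros)

lemma Ck_inner: "Ck k (\<lambda>x. b \<bullet> x)"
proof (cases k)
  case (Suc n)
  have "((\<lambda>x. b \<bullet> x) has_derivative (\<lambda>h. b \<bullet> h)) (at x)" for x
    by (auto intro!: derivative_eq_intros)
  then have "pd i (\<lambda>x. b \<bullet> x) = (\<lambda>x. b \<bullet> axis i 1)" for i
    by (auto simp: pd_eqI fun_eq_iff)
  then show ?thesis using Suc by (simp add: Ck_const differentiable_inner)
qed (auto intro: continuous_intros)

lemma Ck_affine: "Ck k f \<Longrightarrow> Ck k (\<lambda>x. f (s *\<^sub>R x + c))"
proof (induction k arbitrary: f)
  case 0
  then show ?case by (auto intro!: continuous_intros intro: continuous_on_compose2)
next
  case (Suc k)
  have "((\<lambda>x. f (s *\<^sub>R x + c)) has_derivative (\<lambda>h. grad f (s *\<^sub>R x + c) \<bullet> (s *\<^sub>R h))) (at x)" for x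
    using Suc.prems
    by (intro has_derivative_compose[of "\<lambda>x. s *\<^sub>R x + c", OF _ has_derivative_grad])
      (auto intro!: derivative_eq_intros)
  note d = this
  have "pd i (\<lambda>x. f (s *\<^sub>R x + c)) = (\<lambda>x. s * pd i f (s *\<^sub>R x + c))" for i
    by (auto simp: pd_eqI[OF d] fun_eq_iff grad_def inner_axis)
  moreover have "(\<lambda>x. f (s *\<^sub>R x + c)) differentiable (at x)" for x
    using d differentiable_def by blast
  moreover have "Ck k (\<lambda>x. pd i f (s *\<^sub>R x + c))" for i
    using Suc by simp
  ultimately show ?case by (simp add: Ck_mult Ck_const)
qed

lemma smooth_differentiable: "smooth f \<Longrightarrow> f differentiable at x"
  using Ck.simps(2)[of 0 f] unfolding smooth_def by blast

lemma smooth_continuous: "smooth f \<Longrightarrow> continuous_on S f"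
  using Ck.simps(1)[of f] continuous_on_subset[of UNIV f S] unfolding smooth_def by blast

lemma smooth_pd: "smooth f \<Longrightarrow> smooth (pd i f)"
  unfolding smooth_def using Ck.simps(2) by blast

lemma smooth_const: "smooth (\<lambda>x. c)" by (simp add: smooth_def Ck_const)
lemma smooth_inner: "smooth (\<lambda>x. b \<bullet> x)" by (simp add: smooth_def Ck_inner)
lemma smooth_add: "smooth f \<Longrightarrow> smooth g \<Longrightarrow> smooth (\<lambda>x. f x + g x)" by (simp add: smooth_def Ck_add)
lemma smooth_mult: "smooth f \<Longrightarrow> smooth g \<Longrightarrow> smooth (\<lambda>x. f x * g x)" by (simp add: smooth_def Ck_mult)
lemma smooth_affine: "smooth f \<Longrightarrow> smooth (\<lambda>x. f (s *\<^sub>R x + c))" by (simp add: smooth_def Ck_affine)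

lemma smooth_cmult: "smooth f \<Longrightarrow> smooth (\<lambda>x. c * f x)" by (simp add: smooth_mult smooth_const)

lemma smooth_uminus: "smooth f \<Longrightarrow> smooth (\<lambda>x. - f x)" using smooth_cmult[of f "-1"] by simp

lemma smooth_P1: "p \<in> P1 \<Longrightarrow> smooth p"
  by (auto simp: P1_def intro!: smooth_add smooth_const smooth_inner)

lemma continuous_grad: "smooth f \<Longrightarrow> continuous_on S (grad f)"
  unfolding grad_def by (intro continuous_on_vec_lambda smooth_continuous smooth_pd)

lemma pd_affine:
  assumes "f differentiable at (s *\<^sub>R x + c)"
  shows "pd i (\<lambda>x. f (s *\<^sub>R x + c)) x = s * pd i f (s *\<^sub>R x + c)"
proof -
  have "((\<lambda>x. f (s *\<^sub>R x + c)) has_derivative (\<lambda>h. grad f (s *\<^sub>R x + c) \<bullet> (s *\<^sub>R h))) (at x)"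
    using assms
    by (intro has_derivative_compose[of "\<lambda>x. s *\<^sub>R x + c", OF _ has_derivative_grad])
      (auto intro!: derivative_eq_intros)
  then show ?thesis by (simp add: pd_eqI grad_def inner_axis)
qed

text \<open>The classical exp(-1/t), multiplied by powers of 1/t. Differentiation raises the power,
  so the whole family is closed under derivatives and its smoothness follows by one
  induction.\<close>

definition flat :: "nat \<Rightarrow> real \<Rightarrow> real" where
  "flat m t = (if 0 < t then exp (- inverse t) * inverse t ^ m else 0)"

text \<open>In the variable 1/t this is the dominance of the exponential over every power; to the
  left of 0 the function vanishes identically.\<close>

lemma flat_tendsto_0: "(flat m \<longlongrightarrow> 0) (at 0)"
proof -
  have "((\<lambda>t. inverse t ^ m / exp (inverse t)) \<longlongrightarrow> 0) (at_right (0::real))"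
    by (rule filterlim_compose[OF tendsto_power_div_exp_0 filterlim_inverse_at_top_right])
  then have r: "(flat m \<longlongrightarrow> 0) (at_right 0)"
    by (rule Lim_transform_eventually)
      (auto simp: flat_def eventually_at_filter exp_minus field_simps)
  have "(flat m \<longlongrightarrow> 0) (at_left 0)"
    by (rule Lim_transform_eventually[of "\<lambda>_. 0"]) (auto simp: flat_def eventually_at_filter)
  with r show ?thesis by (simp add: filterlim_split_at)
qed

lemma flat_deriv:
  "(flat m has_real_derivative flat (m + 2) t - m * flat (m + 1) t) (at t)"
proof (cases t "0::real" rule: linorder_cases)
  case less
  have "eventually (\<lambda>x. flat m x = 0) (nhds t)"
    using less by (auto simp: eventually_nhds flat_def intro!: exI[of _ "{..<0}"])
  then have "(flat m has_real_derivative 0) (at t)"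
    by (subst DERIV_cong_ev[of t t "flat m" "\<lambda>_. 0" 0 0]) auto
  then show ?thesis using less by (simp add: flat_def)
next
  case equal
  \<comment> \<open>At 0 the difference quotient of \<open>flat m\<close> is
    \<open>flat (m + 1)\<close>, which tends to 0, in agreement with the general formula.\<close>
  have "((\<lambda>h. flat (Suc m) h) \<longlongrightarrow> 0) (at 0)" by (rule flat_tendsto_0)
  then have "((\<lambda>h. (flat m (0 + h) - flat m 0) / h) \<longlongrightarrow> 0) (at 0)"
    by (rule Lim_transform_eventually) (auto simp: flat_def eventually_at_filter field_simps)
  then show ?thesis using equal by (auto simp: DERIV_def flat_def)
next
  case greater
  have "((\<lambda>t. exp (- inverse t) * inverse t ^ m) has_real_derivative flat (m + 2) t - m * flat (m + 1) t) (at t)"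
    using greater
    by (auto intro!: derivative_eq_intros simp: flat_def power2_eq_square)
      (cases m; simp add: algebra_simps)
  moreover have "eventually (\<lambda>x. exp (- inverse x) * inverse x ^ m = flat m x) (nhds t)"
    using greater by (auto simp: eventually_nhds flat_def intro!: exI[of _ "{0<..}"])
  ultimately show ?thesis
    by (subst DERIV_cong_ev[OF refl _ refl, of _ "\<lambda>t. exp (- inverse t) * inverse t ^ m"])
      (auto elim!: eventually_mono)
qed

lemma continuous_flat: "continuous_on S (flat m)"
  by (meson DERIV_isCont continuous_at_imp_continuous_on flat_deriv)

lemma has_derivative_flat_comp:
  assumes "f differentiable at x"
  shows "((\<lambda>x. flat m (f x)) has_derivative
     (\<lambda>h. ((flat (m + 2) (f x) - m * flat (m + 1) (f x)) *\<^sub>R grad f x) \<bullet> h)) (at x)"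
  using has_derivative_compose[OF has_derivative_grad[OF assms] flat_deriv[of m "f x", unfolded has_field_derivative_def]]
  by (simp add: algebra_simps)

text \<open>The index \<open>m\<close> is generalised in the induction because one derivative brings
  in \<open>flat (m + 1)\<close> and \<open>flat (m + 2)\<close>.\<close>

lemma Ck_flat: "Ck k f \<Longrightarrow> Ck k (\<lambda>x. flat m (f x))"
proof (induction k arbitrary: f m)
  case 0
  then show ?case using continuous_on_compose2[OF continuous_flat] by auto
next
  case (Suc k)
  then have d: "\<And>x. f differentiable at x" by auto
  note D = has_derivative_flat_comp[OF d]
  have "pd i (\<lambda>x. flat m (f x)) = (\<lambda>x. (flat (m + 2) (f x) + (- real m) * flat (m + 1) (f x)) * pd i f x)" for i
    by (rule ext, subst pd_eqI[OF D]) (simp add: grad_def inner_axis)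
  note pd_flat = this
  moreover have "(\<lambda>x. flat m (f x)) differentiable (at x)" for x
    using D differentiable_def by blast
  moreover have "Ck k f" using Suc.prems Ck_SucD by blast
  then have "Ck k (\<lambda>x. (flat (m + 2) (f x) + (- real m) * flat (m + 1) (f x)) * pd i f x)" for i
    using Suc.prems by (intro Ck_mult Ck_add Ck_const Suc.IH) auto
  ultimately show ?case by (simp only: Ck.simps(2) pd_flat) blast
qed

lemma smooth_flat: "smooth f \<Longrightarrow> smooth (\<lambda>x. flat m (f x))"
  by (simp add: smooth_def Ck_flat)

section \<open>Mollification\<close>

lemma lborel_distr_reflect: "distr lborel borel (\<lambda>z. x - z) = (lborel :: 'a::euclidean_space measure)"
  using lborel_affine[of "-1" x] by (simp add: density_1)

lemma continuous_set_integrable_bounded: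
  fixes g :: "'a::euclidean_space \<Rightarrow> real"
  assumes "continuous_on UNIV g" "bounded A" "A \<in> sets borel"
  shows "set_integrable lborel A g"
proof -
  obtain R where R: "A \<subseteq> cball 0 R" using assms(2) by (auto simp: bounded_iff subset_iff)
  have "set_integrable lborel (cball 0 R) g"
    unfolding set_integrable_def
    by (rule borel_integrable_compact[OF compact_cball continuous_on_subset[OF assms(1) subset_UNIV]])
  then show ?thesis by (rule set_integrable_subset) (use assms(3) R in auto)
qed

lemma bounded_borel_measure: 
  assumes "bounded A" "A \<in> sets borel"
  shows "emeasure lborel (A :: 'a::euclidean_space set) < \<infinity>"
  using emeasure_bounded_finite assms by blast

text \<open>The points x - z with z in a bounded set, together with their small translates, stay in
  one compact ball, where k is uniformly continuous. The uniformity in z is what permits limits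
  under the integral in \<open>conv\<close>.\<close>

lemma uniform_translate:
  fixes k :: "'a::euclidean_space \<Rightarrow> 'b::euclidean_space" and A :: "'a set" and x :: 'a
  assumes "continuous_on UNIV k" "bounded A" "0 < e"
  obtains d where "0 < d" "\<And>z (h::'a). z \<in> A \<Longrightarrow> norm h < d \<Longrightarrow> norm (k (x - z + h) - k (x - z)) < e"
proof -
  obtain R where R: "\<And>z. z \<in> A \<Longrightarrow> norm z \<le> R" using assms(2) by (auto simp: bounded_iff)
  have "uniformly_continuous_on (cball 0 (norm x + R + 1)) k"
    using assms(1) by (intro compact_uniformly_continuous) (auto intro: continuous_on_subset)
  from this[unfolded uniformly_continuous_on_def, rule_format, OF assms(3)]
  obtain d where d: "0 < d" "\<And>u v. u \<in> cball 0 (norm x + R + 1) \<Longrightarrow> v \<in> cball 0 (norm x + R + 1)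
      \<Longrightarrow> dist v u < d \<Longrightarrow> dist (k v) (k u) < e" by blast
  show ?thesis
  proof (rule that[of "min d 1"])
    fix z h :: 'a assume z: "z \<in> A" and h: "norm h < min d 1"
    have "norm (x - z) \<le> norm x + R" using norm_triangle_ineq4[of x z] R[OF z] by linarith
    moreover have "norm (x - z + h) \<le> norm x + R + 1"
      using norm_triangle_ineq[of "x - z" h] calculation h by linarith
    ultimately show "norm (k (x - z + h) - k (x - z)) < e"
      using d(2)[of "x - z" "x - z + h", unfolded mem_cball_0] h by (simp add: dist_norm)
  qed (use d in auto)
qed

lemma Ck_0D: "Ck n f \<Longrightarrow> Ck 0 f"
  by (induction n) (blast dest: Ck_SucD)+

lemma sum_mult_axis: "(\<Sum>j\<in>UNIV. c j * axis i (1::real) $ j) = (c (i::2) :: real)"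
proof -
  have "(\<Sum>j\<in>UNIV. c j * axis i (1::real) $ j) = (\<Sum>j\<in>UNIV. if j = i then c j else 0)"
    by (intro sum.cong) (auto simp: axis_def)
  then show ?thesis by simp
qed

text \<open>Convolution of the kernel k with the indicator of A. All regularity sits in k, so A may
  be any bounded Borel set: an arbitrary set to be cut off, or a large ball.\<close>

definition conv :: "(real^2) set \<Rightarrow> (real^2 \<Rightarrow> real) \<Rightarrow> real^2 \<Rightarrow> real" where
  "conv A k x = (LINT z:A|lborel. k (x - z))"

context
  fixes A :: "(real^2) set"
  assumes A: "bounded A" "A \<in> sets borel"
begin

lemma conv_integrable: "continuous_on UNIV k \<Longrightarrow> set_integrable lborel A (\<lambda>z. (k (x - z) :: real))"
  by (rule continuous_set_integrable_bounded[OF _ A], rule continuous_on_compose2[of UNIV k])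
    (auto intro: continuous_intros)

lemma conv_bound:
  assumes "set_integrable lborel A f" "\<And>z. z \<in> A \<Longrightarrow> \<bar>f z\<bar> \<le> c"
  shows "\<bar>LINT z:A|lborel. f z\<bar> \<le> measure lborel A * (c::real)"
proof -
  have fin: "emeasure lborel A < \<infinity>" by (rule bounded_borel_measure[OF A])
  have "norm (LINT z:A|lborel. f z) \<le> (LINT z|lborel. indicator A z * c)"
    unfolding set_lebesgue_integral_def
  proof (intro order_trans[OF integral_norm_bound integral_mono])
    show "integrable lborel (\<lambda>x. norm (indicat_real A x *\<^sub>R f x))"
      using assms(1) unfolding set_integrable_def by (rule integrable_norm)
    show "integrable lborel (\<lambda>z. indicat_real A z * c)"
      using A fin by (intro integrable_mult_left integrable_real_indicator) auto
    show "norm (indicat_real A x *\<^sub>R f x) \<le> indicat_real A x * c" for x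
      using assms(2)[of x] by (cases "x \<in> A") auto
  qed
  then show ?thesis using fin A by simp
qed

lemma conv_continuous:
  assumes "continuous_on UNIV k"
  shows "continuous_on UNIV (conv A k)"
  unfolding continuous_on_iff
proof safe
  fix x :: "real^2" and e :: real assume "0 < e"
  \<comment> \<open>The 1 keeps the divisor positive even when A is a null set.\<close>
  let ?m = "measure lborel A + 1"
  have m: "0 < ?m" by (simp add: add_nonneg_pos)
  obtain d where d: "0 < d" "\<And>z h. z \<in> A \<Longrightarrow> norm h < d \<Longrightarrow> norm (k (x - z + h) - k (x - z)) < e / ?m"
    using uniform_translate[OF assms A(1), of "e / ?m" x] \<open>0 < e\<close> m by auto
  show "\<exists>d>0. \<forall>y\<in>UNIV. dist y x < d \<longrightarrow> dist (conv A k y) (conv A k x) < e"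
  proof (intro exI conjI ballI impI)
    fix y assume y: "dist y x < d"
    have "conv A k y - conv A k x = (LINT z:A|lborel. k (y - z) - k (x - z))"
      unfolding conv_def using conv_integrable[OF assms] by (simp add: set_integral_diff)
    also have "\<bar>\<dots>\<bar> \<le> measure lborel A * (e / ?m)"
    proof (rule conv_bound)
      show "set_integrable lborel A (\<lambda>z. k (y - z) - k (x - z))"
        using conv_integrable[OF assms] by (simp add: set_integral_diff)
      show "\<bar>k (y - z) - k (x - z)\<bar> \<le> e / ?m" if "z \<in> A" for z
        using d(2)[OF that, of "y - x"] y by (simp add: dist_norm algebra_simps)
    qed
    also have "\<dots> < e"
      using \<open>0 < e\<close> m by (simp add: field_simps)
    finally show "dist (conv A k y) (conv A k x) < e" by (simp add: dist_real_def)
  qed (use d in auto)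
qed

text \<open>Differentiation under the integral. The first-order remainder of k at x - z is small
  uniformly in z, because the gradient of k oscillates little near all these points at once.\<close>

lemma conv_has_derivative:
  assumes "Ck 1 k"
  shows "(conv A k has_derivative (\<lambda>h. \<Sum>i\<in>UNIV. conv A (pd i k) x * h $ i)) (at x)"
  unfolding has_derivative_at_alt
proof safe
  show "bounded_linear (\<lambda>h. \<Sum>i\<in>UNIV. conv A (pd i k) x * h $ i)"
    by (intro bounded_linear_sum bounded_linear_const_mult bounded_linear_vec_nth)
  have kd: "\<And>x. k differentiable (at x)" using assms by (simp add: One_nat_def)
  have kc: "continuous_on UNIV k" using Ck_SucD[of 0 k] assms by simp
  have pc: "continuous_on UNIV (pd i k)" for i using assms by (simp add: One_nat_def)
  have gc: "continuous_on UNIV (grad k)" unfolding grad_def by (intro continuous_on_vec_lambda pc)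
  fix e :: real assume "0 < e"
  let ?m = "measure lborel A + 1"
  have m: "0 < ?m" by (simp add: add_nonneg_pos)
  obtain d where d: "0 < d" "\<And>z h. z \<in> A \<Longrightarrow> norm h < d \<Longrightarrow> norm (grad k (x - z + h) - grad k (x - z)) < e / ?m"
    using uniform_translate[OF gc A(1), of "e / ?m" x] \<open>0 < e\<close> m by auto
  show "\<exists>d>0. \<forall>y. norm (y - x) < d \<longrightarrow>
     norm (conv A k y - conv A k x - (\<Sum>i\<in>UNIV. conv A (pd i k) x * (y - x) $ i)) \<le> e * norm (y - x)"
  proof (intro exI conjI allI impI)
    fix y assume y: "norm (y - x) < d"
    have int: "set_integrable lborel A (\<lambda>z. grad k (x - z) \<bullet> (y - x))"
      by (rule continuous_set_integrable_bounded[OF _ A])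
        (intro continuous_intros continuous_on_compose2[OF gc] subset_UNIV)
    have "(\<Sum>i\<in>UNIV. conv A (pd i k) x * (y - x) $ i) = (LINT z:A|lborel. grad k (x - z) \<bullet> (y - x))"
    proof -
      have "(\<Sum>i\<in>UNIV. conv A (pd i k) x * (y - x) $ i)
          = (\<Sum>i\<in>UNIV. LINT z:A|lborel. pd i k (x - z) * (y - x) $ i)"
        unfolding conv_def by (simp only: set_integral_mult_left)
      also have "\<dots> = (LINT z|lborel. (\<Sum>i\<in>UNIV. indicator A z *\<^sub>R (pd i k (x - z) * (y - x) $ i)))"
        unfolding set_lebesgue_integral_def
        using set_integrable_mult_left[OF conv_integrable[OF pc]]
        by (subst Bochner_Integration.integral_sum) (auto simp: set_integrable_def)
      also have "\<dots> = (LINT z:A|lborel. grad k (x - z) \<bullet> (y - x))"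
        by (simp add: inner_grad set_lebesgue_integral_def sum_distrib_left)
      finally show ?thesis .
    qed
    then have "conv A k y - conv A k x - (\<Sum>i\<in>UNIV. conv A (pd i k) x * (y - x) $ i)
        = (LINT z:A|lborel. k (y - z) - k (x - z) - grad k (x - z) \<bullet> (y - x))"
      unfolding conv_def using conv_integrable[OF kc] int by (simp add: set_integral_diff)
    also have "\<bar>\<dots>\<bar> \<le> measure lborel A * (e / ?m * norm (y - x))"
    proof (rule conv_bound)
      show "set_integrable lborel A (\<lambda>z. k (y - z) - k (x - z) - grad k (x - z) \<bullet> (y - x))"
        using conv_integrable[OF kc] int by (simp add: set_integral_diff)
      fix z assume z: "z \<in> A"
      \<comment> \<open>Subtracting the linear part at x - z turns the remainder into an increment
        of a function whose derivative is the oscillation of the gradient, so the mean value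
        inequality applies.\<close>
      have "norm ((\<lambda>w. k w - grad k (x - z) \<bullet> w) (y - z) - (\<lambda>w. k w - grad k (x - z) \<bullet> w) (x - z))
          \<le> e / ?m * norm ((y - z) - (x - z))"
      proof (rule differentiable_bound[of "ball (x - z) d" _ "\<lambda>w h. grad k w \<bullet> h - grad k (x - z) \<bullet> h"])
        fix w assume w: "w \<in> ball (x - z) d"
        show "((\<lambda>w. k w - grad k (x - z) \<bullet> w) has_derivative (\<lambda>h. grad k w \<bullet> h - grad k (x - z) \<bullet> h))
            (at w within ball (x - z) d)"
          by (intro has_derivative_diff has_derivative_at_withinI[OF has_derivative_grad[OF kd]]
              bounded_linear_imp_has_derivative bounded_linear_inner_right)
        have "norm (grad k w - grad k (x - z)) \<le> e / ?m"
          using d(2)[OF z, of "w - (x - z)"] w by (simp add: dist_norm norm_minus_commute less_imp_le)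
        then have "norm (grad k w \<bullet> h - grad k (x - z) \<bullet> h) \<le> e / ?m * norm h" for h
          unfolding inner_diff_left[symmetric] real_norm_def
          by (intro order_trans[OF Cauchy_Schwarz_ineq2] mult_right_mono) auto
        then show "onorm (\<lambda>h. grad k w \<bullet> h - grad k (x - z) \<bullet> h) \<le> e / ?m"
          by (rule onorm_le)
      qed (use y d(1) in \<open>auto simp: dist_norm norm_minus_commute\<close>)
      then show "\<bar>k (y - z) - k (x - z) - grad k (x - z) \<bullet> (y - x)\<bar> \<le> e / ?m * norm (y - x)"
        by (simp add: inner_diff_right)
    qed
    also have "\<dots> = (measure lborel A / ?m) * e * norm (y - x)" by simp
    also have "\<dots> \<le> 1 * e * norm (y - x)"
      using \<open>0 < e\<close> m by (intro mult_right_mono) auto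
    finally show "norm (conv A k y - conv A k x - (\<Sum>i\<in>UNIV. conv A (pd i k) x * (y - x) $ i)) \<le> e * norm (y - x)"
      by simp
  qed (use d in auto)
qed

lemma pd_conv: "Ck 1 k \<Longrightarrow> pd i (conv A k) = conv A (pd i k)"
  by (rule ext, subst pd_eqI[OF conv_has_derivative]) (auto simp: sum_mult_axis)

lemma Ck_conv: "Ck n k \<Longrightarrow> Ck n (conv A k)"
proof (induction n arbitrary: k)
  case (Suc n)
  have 1: "Ck 1 k"
  proof -
    have "Ck 0 (pd i k)" for i
      using Suc.prems Ck_0D by (metis Ck.simps(2))
    then show ?thesis using Suc.prems by (simp add: One_nat_def)
  qed
  then have "conv A k differentiable at x" for x
    using conv_has_derivative differentiable_def by blast
  moreover have "Ck n (conv A (pd i k))" for i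
    using Suc.prems by (intro Suc.IH) auto
  ultimately show ?case unfolding Ck.simps(2) pd_conv[OF 1] by blast
qed (simp add: conv_continuous)

lemma smooth_conv: "smooth k \<Longrightarrow> smooth (conv A k)"
  by (simp add: smooth_def Ck_conv)

end

section \<open>The bump function and derivatives of functions with compact support\<close>

lemma pd_cmult: "f differentiable at x \<Longrightarrow> pd i (\<lambda>x. c * f x) x = c * pd i f x"
  by (subst pd_mult) (auto simp: pd_eqI[OF has_derivative_const])

lemma smooth_inner_self: "smooth (\<lambda>x. x \<bullet> x)"
proof -
  have "(\<lambda>x::real^2. x \<bullet> x) = (\<lambda>x. (axis 1 1 \<bullet> x) * (axis 1 1 \<bullet> x) + (axis 2 1 \<bullet> x) * (axis 2 1 \<bullet> x))"
    by (simp add: fun_eq_iff inner_vec_def sum_2 axis_def)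
  moreover have "smooth (\<lambda>x::real^2. (axis 1 1 \<bullet> x) * (axis 1 1 \<bullet> x) + (axis 2 1 \<bullet> x) * (axis 2 1 \<bullet> x))"
    by (intro smooth_add smooth_mult smooth_inner)
  ultimately show ?thesis by simp
qed

definition bump :: "real^2 \<Rightarrow> real" where
  "bump x = flat 0 (1 - 4 * (x \<bullet> x))"

lemma smooth_bump: "smooth bump"
proof -
  have "bump = (\<lambda>x. flat 0 (1 + (- 4) * (x \<bullet> x)))" by (simp add: fun_eq_iff bump_def)
  moreover have "smooth (\<lambda>x. flat 0 (1 + (- 4) * (x \<bullet> x)))"
    by (intro smooth_flat smooth_add smooth_const smooth_cmult smooth_inner_self)
  ultimately show ?thesis by simp
qed

lemma bump_nonneg: "0 \<le> bump x"
  by (simp add: bump_def flat_def)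

lemma bump_eq_0: "1 / 2 \<le> norm x \<Longrightarrow> bump x = 0"
proof -
  assume "1 / 2 \<le> norm x"
  then have "(1/2)^2 \<le> (norm x)^2" by (intro power_mono) auto
  then show ?thesis by (simp add: bump_def flat_def dot_square_norm power2_eq_square)
qed

text \<open>Serves nonnegative or [0, 1]-valued functions: where an extreme value is attained the
  gradient vanishes, without any look at the formula.\<close>

lemma pd_eq_0_of_extremum:
  assumes "f differentiable at x" "(\<forall>y. f y \<le> f x) \<or> (\<forall>y. f x \<le> f y)"
  shows "pd i f x = 0"
proof -
  have "(\<lambda>h. grad f x \<bullet> h) = (\<lambda>h. 0)"
    by (rule differential_zero_maxmin[OF UNIV_I open_UNIV has_derivative_grad[OF assms(1)]])
      (use assms(2) in auto)
  from fun_cong[OF this, of "axis i 1"] show ?thesis by (simp add: grad_def inner_axis)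
qed

lemma pd_eq_0_of_open:
  assumes "open S" "x \<in> S" "\<And>y. y \<in> S \<Longrightarrow> f y = c"
  shows "pd i f x = 0"
proof -
  have "(f has_derivative (\<lambda>h. 0)) (at x)"
    by (rule has_derivative_transform_within_open[of "\<lambda>_. c" _ _ UNIV S]) (use assms in auto)
  then show ?thesis by (rule pd_eqI)
qed

lemma pd_bump_eq_0: "1 / 2 \<le> norm x \<Longrightarrow> pd i bump x = 0"
  using smooth_bump bump_nonneg
  by (intro pd_eq_0_of_extremum) (auto simp: bump_eq_0 smooth_differentiable)

lemma continuous_compact_support_integrable:
  fixes f :: "real^2 \<Rightarrow> real"
  assumes "continuous_on UNIV f" "\<And>x. R \<le> norm x \<Longrightarrow> f x = 0"
  shows "integrable lborel f"
proof -
  have "set_integrable lborel (cball 0 R) f"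
    by (rule continuous_set_integrable_bounded[OF assms(1)]) auto
  moreover have "(\<lambda>x. indicator (cball 0 R) x *\<^sub>R f x) = f"
  proof
    fix x show "indicator (cball 0 R) x *\<^sub>R f x = f x"
      using assms(2)[of x] by (cases "norm x \<le> R") auto
  qed
  ultimately show ?thesis by (simp add: set_integrable_def)
qed

lemma lborel_integral_reflect: "(LINT z|lborel. f (x - z)) = (LINT z|lborel. f (z :: 'a::euclidean_space) :: real)"
  if "f \<in> borel_measurable borel"
proof -
  have "(LINT z|lborel. f z) = (LINT z|distr lborel borel (\<lambda>z. x - z). f z)"
    by (simp add: lborel_distr_reflect)
  also have "\<dots> = (LINT z|lborel. f (x - z))"
    using that by (subst integral_distr) auto
  finally show ?thesis by simp
qed

lemma lborel_integrable_reflect: "integrable lborel (\<lambda>z. f (x - z))"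
  if "integrable lborel (f :: 'a::euclidean_space \<Rightarrow> real)"
proof -
  have "integrable (distr lborel borel (\<lambda>z. x - z)) f"
    using that by (simp add: lborel_distr_reflect)
  then show ?thesis
    using that by (subst (asm) integrable_distr_eq) auto
qed

text \<open>Convolve f with the indicator of a ball whose radius exceeds R by 1. Near 0 the
  translated support of f stays inside that ball, so the convolution is locally constant, and its
  derivative at 0 is the integral of \<open>pd i f\<close>.\<close>

lemma integral_pd_eq_0:
  assumes "smooth f" "\<And>x. R \<le> norm x \<Longrightarrow> f x = 0"
  shows "(LINT x|lborel. pd i f x) = 0"
proof -
  let ?A = "ball 0 (max R 0 + 1) :: (real^2) set"
  have A: "bounded ?A" "?A \<in> sets borel" by auto
  have fc: "continuous_on UNIV f" and pc: "continuous_on UNIV (pd i f)"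
    using assms smooth_continuous smooth_pd by blast+
  have "conv ?A f x = (LINT z|lborel. f z)" if "x \<in> ball 0 1" for x
  proof -
    have "indicator ?A z *\<^sub>R f (x - z) = f (x - z)" for z
    proof (cases "z \<in> ?A")
      case False
      then have "R \<le> norm (x - z)" using that norm_triangle_ineq2[of z x] by (simp add: norm_minus_commute)
      then show ?thesis using assms(2) by simp
    qed simp
    note eq = this
    show ?thesis
      unfolding conv_def set_lebesgue_integral_def eq using fc
      by (simp add: lborel_integral_reflect borel_measurable_continuous_onI)
  qed
  then have "pd i (conv ?A f) 0 = 0"
    by (intro pd_eq_0_of_open[OF open_ball, of 0 0 1]) auto
  moreover have "Ck 1 f" using assms(1) smooth_def by blast
  ultimately have "conv ?A (pd i f) 0 = 0"
    using pd_conv[OF A] by simp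
  moreover have "pd i f x = 0" if "R < norm x" for x
  proof (rule pd_eq_0_of_open)
    show "open (- cball (0 :: real^2) R)" by auto
  qed (use that assms(2) in auto)
  then have eq: "indicator ?A z *\<^sub>R pd i f (0 - z) = pd i f (0 - z)" for z
    by (cases "z \<in> ?A") auto
  ultimately have "(LINT z|lborel. pd i f (0 - z)) = 0"
    unfolding conv_def set_lebesgue_integral_def eq by simp
  then show ?thesis
    using lborel_integral_reflect[of "pd i f" 0] pc borel_measurable_continuous_onI by auto
qed

lemma test_function_smooth: "test_function E f \<Longrightarrow> smooth f" by (simp add: test_function_def)

lemma test_functionI:
  assumes "smooth f" "compact K" "K \<subseteq> E" "\<And>x. f x \<noteq> 0 \<Longrightarrow> x \<in> K"
  shows "test_function E f"
proof -
  have "closure {x. f x \<noteq> 0} \<subseteq> K"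
    using assms by (intro closure_minimal) (auto simp: compact_imp_closed)
  moreover have "compact (closure {x. f x \<noteq> 0})"
    unfolding compact_closure
    by (rule bounded_subset[OF compact_imp_bounded[OF assms(2)]]) (use assms(4) in auto)
  ultimately show ?thesis using assms unfolding test_function_def by auto
qed

lemma test_function_mult: "smooth u \<Longrightarrow> test_function E f \<Longrightarrow> test_function E (\<lambda>x. u x * f x)"
  unfolding test_function_def
proof (elim conjE, intro conjI)
  assume f: "compact (closure {x. f x \<noteq> 0})" "closure {x. f x \<noteq> 0} \<subseteq> E" "smooth u" "smooth f"
  have sub: "closure {x. u x * f x \<noteq> 0} \<subseteq> closure {x. f x \<noteq> 0}" by (intro closure_mono) auto
  show "compact (closure {x. u x * f x \<noteq> 0})"
    unfolding compact_closure by (rule bounded_subset[OF f(1)[unfolded compact_closure]]) auto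
  show "closure {x. u x * f x \<noteq> 0} \<subseteq> E" using sub f(2) by blast
qed (auto intro: smooth_mult)

lemma pd_support: "{x. pd i f x \<noteq> 0} \<subseteq> closure {x. f x \<noteq> 0}"
proof safe
  fix x assume "pd i f x \<noteq> 0"
  show "x \<in> closure {x. f x \<noteq> 0}"
  proof (rule ccontr)
    assume n: "x \<notin> closure {x. f x \<noteq> 0}"
    have "pd i f x = 0"
      by (rule pd_eq_0_of_open[of "- closure {x. f x \<noteq> 0}" _ _ 0])
        (use n closure_subset[of "{x. f x \<noteq> 0}"] in auto)
    with \<open>pd i f x \<noteq> 0\<close> show False by simp
  qed
qed

lemma test_function_pd: "test_function E f \<Longrightarrow> test_function E (pd i f)"
  by (rule test_functionI[of _ "closure {x. f x \<noteq> 0}"])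
    (use pd_support[of i f] in \<open>auto simp: test_function_def smooth_pd\<close>)

lemma integral_bump_pos: "0 < (LINT x|lborel. bump x)"
proof -
  have int: "integrable lborel bump"
    by (rule continuous_compact_support_integrable[OF smooth_continuous[OF smooth_bump] bump_eq_0])
  have pos: "0 < bump x" if "x \<in> ball 0 (1/2)" for x
  proof -
    have "(norm x)^2 < (1/2)^2" using that by (intro power_strict_mono) auto
    then show ?thesis by (simp add: bump_def flat_def dot_square_norm power2_eq_square)
  qed
  have "(LINT x|lborel. bump x) \<noteq> 0"
  proof
    assume "(LINT x|lborel. bump x) = 0"
    then have "AE x in lborel. bump x = 0"
      using int by (subst (asm) integral_nonneg_eq_0_iff_AE) (auto simp: bump_nonneg)
    then have "AE x in lborel. x \<notin> ball (0 :: real^2) (1/2)"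
      by (rule eventually_mono) (use pos in fastforce)
    then have "ball (0 :: real^2) (1/2) \<in> null_sets lborel"
      by (subst AE_iff_null_sets) auto
    then have "ball (0 :: real^2) (1/2) \<in> null_sets lebesgue" by (simp add: null_sets_completionI)
    then have "negligible (ball (0 :: real^2) (1/2))" by (simp add: negligible_iff_null_sets)
    then show False using open_not_negligible[of "ball (0 :: real^2) (1/2)"] by auto
  qed
  moreover have "0 \<le> (LINT x|lborel. bump x)" by (simp add: bump_nonneg)
  ultimately show ?thesis by linarith
qed


text \<open>A mollified indicator of A at scale \<epsilon>. The factor \<kappa> is meant to be
  independent of A and \<epsilon>, so that only 1/\<epsilon> enters the gradient and later constants
  are invariant under scaling.\<close>

definition cutoff_family :: "real \<Rightarrow> (real^2) set \<Rightarrow> real \<Rightarrow> (real^2 \<Rightarrow> real) \<Rightarrow> bool" where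
  "cutoff_family \<kappa> A \<epsilon> \<psi> \<longleftrightarrow> smooth \<psi> \<and> (\<forall>x. 0 \<le> \<psi> x \<and> \<psi> x \<le> 1) \<and> (\<forall>x. norm (grad \<psi> x) \<le> \<kappa> / \<epsilon>) \<and>
     (\<forall>x. \<psi> x \<noteq> 0 \<longrightarrow> (\<exists>y\<in>A. dist x y < \<epsilon>)) \<and> (\<forall>x. ball x \<epsilon> \<subseteq> A \<longrightarrow> \<psi> x = 1)"

text \<open>Convolving the indicator with a bump of radius \<epsilon>/2 and dividing by its mass;
  the gradient costs the L1 norm of the partial derivatives of the bump over Z \<epsilon>. The 1
  added to c only secures \<kappa> > 0.\<close>

lemma ex_cutoff:
  obtains \<kappa> where "0 < \<kappa>"
    "\<And>A \<epsilon>. bounded A \<Longrightarrow> A \<in> sets borel \<Longrightarrow> 0 < \<epsilon> \<Longrightarrow> \<exists>\<psi>. cutoff_family \<kappa> A \<epsilon> \<psi>"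
proof -
  define Z where "Z = (LINT x|lborel. bump x)"
  define c where "c = (\<Sum>i\<in>UNIV. LINT x|lborel. \<bar>pd i bump x\<bar>)"
  have Z: "0 < Z" unfolding Z_def by (rule integral_bump_pos)
  have c: "0 \<le> c" unfolding c_def by (intro sum_nonneg) simp
  have bc: "continuous_on UNIV bump" and pc: "continuous_on UNIV (pd i bump)" for i
    using smooth_bump smooth_continuous smooth_pd by blast+
  have b_int: "integrable lborel (\<lambda>z. bump (y - z))" for y
    by (intro lborel_integrable_reflect continuous_compact_support_integrable[OF bc bump_eq_0])
  have p_int: "integrable lborel (\<lambda>z. \<bar>pd i bump (y - z)\<bar>)" for y i
    by (intro integrable_abs lborel_integrable_reflect continuous_compact_support_integrable[OF pc pd_bump_eq_0])
  show ?thesis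
  proof (rule that[of "(c + 1) / Z"])
    show "0 < (c + 1) / Z" using c Z by simp
    fix A :: "(real^2) set" and \<epsilon> :: real assume A: "bounded A" "A \<in> sets borel" and e: "0 < \<epsilon>"
    \<comment> \<open>Rescaling the set instead of the kernel lets the single unit-scale
      \<open>bump\<close> serve for every \<epsilon>.\<close>
    define B where "B = (\<lambda>z. \<epsilon> *\<^sub>R z) -` A"
    define \<psi> where "\<psi> = (\<lambda>x. inverse Z * conv B bump (inverse \<epsilon> *\<^sub>R x + 0))"
    have B: "bounded B" "B \<in> sets borel"
    proof -
      obtain R where R: "\<And>z. z \<in> A \<Longrightarrow> norm z \<le> R" using A(1) by (auto simp: bounded_iff)
      have "norm z \<le> R / \<epsilon>" if "z \<in> B" for z
        using R[of "\<epsilon> *\<^sub>R z"] that e by (simp add: B_def field_simps)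
      then show "bounded B" by (auto simp: bounded_iff)
      have "(\<lambda>z::real^2. \<epsilon> *\<^sub>R z) \<in> borel \<rightarrow>\<^sub>M borel" by simp
      from measurable_sets[OF this A(2)] show "B \<in> sets borel" by (simp add: B_def)
    qed
    have bB: "integrable lborel (\<lambda>z. indicator B z *\<^sub>R bump (y - z))" for y
      using conv_integrable[OF B bc] by (simp add: set_integrable_def)
    have "smooth \<psi>" unfolding \<psi>_def
      by (intro smooth_cmult smooth_affine smooth_conv B smooth_bump)
    moreover have "0 \<le> \<psi> x \<and> \<psi> x \<le> 1" for x
    proof -
      let ?y = "inverse \<epsilon> *\<^sub>R x + 0"
      have "0 \<le> conv B bump ?y"
        unfolding conv_def set_lebesgue_integral_def by (simp add: bump_nonneg)
      moreover have "conv B bump ?y \<le> (LINT z|lborel. bump (?y - z))"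
        unfolding conv_def set_lebesgue_integral_def
        by (intro integral_mono bB b_int) (simp add: indicator_def bump_nonneg)
      moreover have "(LINT z|lborel. bump (?y - z)) = Z"
        unfolding Z_def using bc by (intro lborel_integral_reflect borel_measurable_continuous_onI)
      ultimately show ?thesis using Z by (simp add: \<psi>_def field_simps)
    qed
    moreover have "norm (grad \<psi> x) \<le> (c + 1) / Z / \<epsilon>" for x
    proof -
      let ?y = "inverse \<epsilon> *\<^sub>R x + 0"
      have d: "conv B bump differentiable (at ?y)"
        using smooth_differentiable smooth_conv[OF B smooth_bump] by blast
      have d': "(\<lambda>x. conv B bump (inverse \<epsilon> *\<^sub>R x + 0)) differentiable (at x)"
        by (intro smooth_differentiable smooth_affine smooth_conv B smooth_bump)
      have "Ck 1 bump" using smooth_bump smooth_def by blast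
      then have "pd i \<psi> x = inverse Z * (inverse \<epsilon> * conv B (pd i bump) ?y)" for i
        unfolding \<psi>_def pd_cmult[OF d'] pd_affine[OF d] pd_conv[OF B \<open>Ck 1 bump\<close>] by simp
      moreover have "\<bar>conv B (pd i bump) ?y\<bar> \<le> (LINT x|lborel. \<bar>pd i bump x\<bar>)" for i
      proof -
        have "norm (conv B (pd i bump) ?y) \<le> (LINT z|lborel. norm (indicator B z *\<^sub>R pd i bump (?y - z)))"
          unfolding conv_def set_lebesgue_integral_def by (rule integral_norm_bound)
        also have "\<dots> \<le> (LINT z|lborel. \<bar>pd i bump (?y - z)\<bar>)"
          using conv_integrable[OF B pc]
          by (intro integral_mono integrable_norm p_int) (auto simp: set_integrable_def indicator_def)
        also have "\<dots> = (LINT x|lborel. \<bar>pd i bump x\<bar>)"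
          using pc by (intro lborel_integral_reflect borel_measurable_continuous_onI continuous_intros)
        finally show ?thesis by simp
      qed
      ultimately have "\<bar>grad \<psi> x $ i\<bar> \<le> inverse Z * (inverse \<epsilon> * (LINT x|lborel. \<bar>pd i bump x\<bar>))" for i
        using Z e by (simp add: grad_def abs_mult)
      then have "(\<Sum>i\<in>UNIV. \<bar>grad \<psi> x $ i\<bar>) \<le> (\<Sum>i\<in>UNIV. inverse Z * (inverse \<epsilon> * (LINT x|lborel. \<bar>pd i bump x\<bar>)))"
        by (rule sum_mono)
      also have "\<dots> = c / Z / \<epsilon>"
        by (simp add: c_def sum_distrib_left[symmetric] divide_inverse)
      also have "\<dots> \<le> (c + 1) / Z / \<epsilon>" using Z e by (simp add: divide_right_mono)
      finally show ?thesis using norm_le_l1_cart[of "grad \<psi> x"] by linarith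
    qed
    moreover have "\<exists>y\<in>A. dist x y < \<epsilon>" if "\<psi> x \<noteq> 0" for x
    proof (rule ccontr)
      assume n: "\<not> (\<exists>y\<in>A. dist x y < \<epsilon>)"
      have "indicator B z *\<^sub>R bump (inverse \<epsilon> *\<^sub>R x + 0 - z) = 0" for z
      proof (cases "z \<in> B")
        case True
        then have "\<epsilon> \<le> norm (x - \<epsilon> *\<^sub>R z)" using n by (force simp: B_def dist_norm)
        also have "x - \<epsilon> *\<^sub>R z = \<epsilon> *\<^sub>R (inverse \<epsilon> *\<^sub>R x + 0 - z)" using e by (simp add: scaleR_diff_right)
        finally have "1 / 2 \<le> norm (inverse \<epsilon> *\<^sub>R x + 0 - z)" using e by simp
        then show ?thesis by (simp only: bump_eq_0 scaleR_zero_right)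
      qed simp
      then have "conv B bump (inverse \<epsilon> *\<^sub>R x + 0) = 0"
        unfolding conv_def set_lebesgue_integral_def by (simp only: integral_zero)
      then show False using that by (simp add: \<psi>_def)
    qed
    moreover have "\<psi> x = 1" if "ball x \<epsilon> \<subseteq> A" for x
    proof -
      let ?y = "inverse \<epsilon> *\<^sub>R x + 0"
      have "indicator B z *\<^sub>R bump (?y - z) = bump (?y - z)" for z
      proof (cases "z \<in> B")
        case False
        then have "\<epsilon> \<le> norm (x - \<epsilon> *\<^sub>R z)" using that by (force simp: B_def dist_norm)
        also have "x - \<epsilon> *\<^sub>R z = \<epsilon> *\<^sub>R (?y - z)" using e by (simp add: scaleR_diff_right)
        finally have "1 / 2 \<le> norm (?y - z)" using e by simp
        then show ?thesis by (simp only: bump_eq_0 scaleR_zero_right)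
      qed simp
      then have "conv B bump ?y = (LINT z|lborel. bump (?y - z))"
        unfolding conv_def set_lebesgue_integral_def by (simp only:)
      also have "\<dots> = Z"
        unfolding Z_def using bc by (intro lborel_integral_reflect borel_measurable_continuous_onI)
      finally show ?thesis using Z by (simp add: \<psi>_def)
    qed
    ultimately show "\<exists>\<psi>. cutoff_family ((c + 1) / Z) A \<epsilon> \<psi>"
      unfolding cutoff_family_def by blast
  qed
qed

text \<open>Both values are global extrema of \<psi>.\<close>

lemma cutoff_grad_eq_0:
  assumes "cutoff_family \<kappa> A \<epsilon> \<psi>" "\<psi> x = 0 \<or> \<psi> x = 1"
  shows "grad \<psi> x = 0"
proof -
  have "pd i \<psi> x = 0" for i
    using assms by (intro pd_eq_0_of_extremum smooth_differentiable) (auto simp: cutoff_family_def)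
  then show ?thesis by (simp add: grad_def vec_eq_iff)
qed

section \<open>Star-shaped polygons\<close>

lemma edge_inter:
  assumes "simple_polygon vs" "i < length vs" "j < length vs" "i \<noteq> j"
  shows "edge vs i \<inter> edge vs j = {vs ! i, next_vertex vs i} \<inter> {vs ! j, next_vertex vs j}"
  using assms unfolding simple_polygon_def by blast

lemma next_vertex_neq:
  assumes "simple_polygon vs" "i < length vs"
  shows "vs ! i \<noteq> next_vertex vs i"
proof -
  have "3 \<le> length vs" "distinct vs" using assms(1) by (auto simp: simple_polygon_def)
  moreover have "Suc i mod length vs \<noteq> i"
  proof (cases "Suc i < length vs")
    case False
    then have "Suc i = length vs" using assms(2) by simp
    then show ?thesis using \<open>3 \<le> length vs\<close> by auto
  qed simp
  moreover have "Suc i mod length vs < length vs" using assms(2) by (intro mod_less_divisor) auto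
  ultimately show ?thesis using assms(2) by (simp add: next_vertex_def nth_eq_iff_index_eq)
qed

text \<open>Keeping k below the length avoids the wrap-around in \<open>next_vertex\<close>: the new
  edge can meet the earlier ones only in the vertex at which it is attached, so the arcs can be
  joined.\<close>

lemma arc_polygon_chain:
  assumes sp: "simple_polygon vs"
  shows "0 < k \<Longrightarrow> k < length vs \<Longrightarrow>
    \<exists>g. arc g \<and> pathstart g = vs ! 0 \<and> pathfinish g = vs ! k \<and> path_image g = (\<Union>i<k. edge vs i)"
proof (induction k)
  case (Suc k)
  have d: "distinct vs" using sp by (simp add: simple_polygon_def)
  have nk: "next_vertex vs k = vs ! Suc k" using Suc.prems by (simp add: next_vertex_def)
  have l: "arc (linepath (vs ! k) (vs ! Suc k))"
    using next_vertex_neq[OF sp, of k] nk Suc.prems by (intro arc_linepath) auto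
  show ?case
  proof (cases "k = 0")
    case True
    then show ?thesis using l nk
      by (intro exI[of _ "linepath (vs ! k) (vs ! Suc k)"]) (auto simp: edge_def)
  next
    case False
    then obtain g where g: "arc g" "pathstart g = vs ! 0" "pathfinish g = vs ! k"
      "path_image g = (\<Union>i<k. edge vs i)" using Suc by auto
    have "edge vs i \<inter> edge vs k \<subseteq> {vs ! k}" if "i < k" for i
    proof -
      have "next_vertex vs i = vs ! Suc i" using that Suc.prems by (simp add: next_vertex_def)
      moreover have "vs ! i \<noteq> vs ! k" "vs ! i \<noteq> vs ! Suc k" "vs ! Suc i \<noteq> vs ! Suc k"
        using that Suc.prems d by (auto simp: nth_eq_iff_index_eq)
      ultimately show ?thesis using edge_inter[OF sp, of i k] that Suc.prems nk by auto
    qed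
    then have "path_image g \<inter> path_image (linepath (vs ! k) (vs ! Suc k)) \<subseteq> {vs ! k}"
      using g(4) nk by (auto simp: edge_def)
    then have "arc (g +++ linepath (vs ! k) (vs ! Suc k))"
      using g l by (intro arc_join) auto
    moreover have "path_image (g +++ linepath (vs ! k) (vs ! Suc k)) = (\<Union>i<Suc k. edge vs i)"
      using g nk by (subst path_image_join) (auto simp: edge_def lessThan_Suc)
    ultimately show ?thesis using g
      by (intro exI[of _ "g +++ linepath (vs ! k) (vs ! Suc k)"]) auto
  qed
qed simp

text \<open>The last edge returns to the first vertex and meets the chain at most in its two ends,
  which closes the arc to a simple loop. The circle is moved from the complex plane to
  \<open>real^2\<close> because the Jordan-Brouwer theorem is applied there.\<close>

lemma polygon_boundary_homeomorphic_circle: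
  assumes sp: "simple_polygon vs"
  shows "polygon_boundary vs homeomorphic sphere (0::real^2) 1"
proof -
  define n where "n = length vs - 1"
  have n: "3 \<le> length vs" "Suc n = length vs" "0 < n" "n < length vs"
    using sp by (auto simp: simple_polygon_def n_def)
  obtain g where g: "arc g" "pathstart g = vs ! 0" "pathfinish g = vs ! n"
      "path_image g = (\<Union>i<n. edge vs i)" using arc_polygon_chain[OF sp n(3,4)] by blast
  have nn: "next_vertex vs n = vs ! 0" using n by (simp add: next_vertex_def)
  have l: "arc (linepath (vs ! n) (vs ! 0))"
    using next_vertex_neq[OF sp n(4)] nn by (intro arc_linepath) auto
  have "edge vs i \<inter> edge vs n \<subseteq> {vs ! 0, vs ! n}" if "i < n" for i
    using edge_inter[OF sp, of i n] that n(4) nn by auto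
  then have "path_image g \<inter> path_image (linepath (vs ! n) (vs ! 0)) \<subseteq> {vs ! 0, vs ! n}"
    using g(4) nn by (auto simp: edge_def)
  then have s: "simple_path (g +++ linepath (vs ! n) (vs ! 0))"
    using g l by (intro simple_path_join_loop) auto
  have im: "path_image (g +++ linepath (vs ! n) (vs ! 0)) = polygon_boundary vs"
  proof -
    have "path_image (g +++ linepath (vs ! n) (vs ! 0)) = (\<Union>i<Suc n. edge vs i)"
      using g nn by (subst path_image_join) (auto simp: edge_def lessThan_Suc)
    then show ?thesis unfolding polygon_boundary_def n(2) .
  qed
  have "polygon_boundary vs homeomorphic sphere (0::complex) 1"
    using homeomorphic_simple_path_image_circle[OF s, of 1 0] g im by simp
  moreover have "sphere (0::complex) 1 homeomorphic sphere (0::real^2) 1"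
    by (rule homeomorphic_spheres_gen) auto
  ultimately show ?thesis using homeomorphic_trans by blast
qed

lemma compact_polygon_boundary: "compact (polygon_boundary vs)"
  unfolding polygon_boundary_def edge_def by (intro compact_UN) auto

lemma open_polygon_domain: "open (polygon_domain vs)"
  unfolding polygon_domain_def by (intro open_inside compact_imp_closed compact_polygon_boundary)

lemma polygon_domain_boundary_disjoint: "polygon_domain vs \<inter> polygon_boundary vs = {}"
  unfolding polygon_domain_def by simp

text \<open>By Jordan-Brouwer a single component of the complement already has the whole curve as
  its frontier. A point of the domain provides a bounded component, and that component lies in the
  domain.\<close>

lemma frontier_polygon_domain:
  assumes sp: "simple_polygon vs" and ne: "polygon_domain vs \<noteq> {}"
  shows "frontier (polygon_domain vs) = polygon_boundary vs"
proof
  let ?S = "polygon_boundary vs"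
  show "frontier (polygon_domain vs) \<subseteq> ?S"
    unfolding polygon_domain_def by (intro frontier_inside_subset compact_imp_closed compact_polygon_boundary)
  obtain x where x: "x \<in> inside ?S" using ne unfolding polygon_domain_def by blast
  let ?T = "connected_component_set (- ?S) x"
  have xS: "x \<in> - ?S" and b: "bounded ?T" using x by (auto simp: inside_def)
  have "?T \<in> components (- ?S)" using xS by (rule componentsI)
  then have f: "frontier ?T = ?S"
    using Jordan_Brouwer_frontier[OF polygon_boundary_homeomorphic_circle[OF sp]] by simp
  have "?T \<subseteq> inside ?S"
  proof
    fix y assume y: "y \<in> ?T"
    then have "connected_component_set (- ?S) y = ?T"
      by (simp add: connected_component_eq)
    moreover have "y \<notin> ?S" using y connected_component_subset[of "- ?S" x] by blast
    ultimately show "y \<in> inside ?S" using b by (simp add: inside_def)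
  qed
  then have "closure ?T \<subseteq> closure (polygon_domain vs)"
    unfolding polygon_domain_def by (rule closure_mono)
  then have "?S \<subseteq> closure (polygon_domain vs)" using f by (auto simp: frontier_def)
  then show "?S \<subseteq> frontier (polygon_domain vs)"
    using polygon_domain_boundary_disjoint[of vs] open_polygon_domain[of vs]
    by (auto simp: frontier_def interior_open)
qed

text \<open>Quantitative star-shapedness: the perturbation h is absorbed into the point of the ball
  that carries the weight 1 - s. A contraction by s therefore keeps a distance (1 - s) \<rho> from
  the complement, and all cutoff widths come from this.\<close>

lemma star_shaped_comb:
  fixes E :: "'a::real_normed_vector set"
  assumes "star_shaped_wrt E (ball c \<rho>)" "x \<in> E" "0 \<le> s" "s < 1" "norm h < (1 - s) * \<rho>"
  shows "c + s *\<^sub>R (x - c) + h \<in> E"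
proof -
  define b where "b = c + inverse (1 - s) *\<^sub>R h"
  have "norm (inverse (1 - s) *\<^sub>R h) < \<rho>" using assms by (simp add: field_simps)
  then have b: "b \<in> ball c \<rho>" by (simp add: b_def dist_norm)
  have "s *\<^sub>R x + (1 - s) *\<^sub>R b \<in> convex hull (insert x (ball c \<rho>))"
    using assms b by (intro convexD[OF convex_convex_hull] hull_inc) auto
  moreover have "(1 - s) *\<^sub>R b = (1 - s) *\<^sub>R c + h" using assms by (simp add: b_def scaleR_add_right)
  then have "s *\<^sub>R x + (1 - s) *\<^sub>R b = c + s *\<^sub>R (x - c) + h"
    by (simp add: algebra_simps)
  ultimately show ?thesis using assms(1,2) unfolding star_shaped_wrt_def by auto
qed

text \<open>A closure point is replaced by a nearby point of E, and the error goes into the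
  perturbation that \<open>star_shaped_comb\<close> tolerates.\<close>

lemma star_shaped_closure:
  fixes E :: "'a::real_normed_vector set"
  assumes "star_shaped_wrt E (ball c \<rho>)" "0 < \<rho>" "x \<in> closure E" "0 \<le> s" "s < 1"
  shows "c + s *\<^sub>R (x - c) \<in> E"
proof -
  have "0 < (1 - s) * \<rho>" using assms by simp
  then obtain x' where x': "x' \<in> E" "dist x' x < (1 - s) * \<rho>"
    using assms(3) closure_approachable by blast
  have "norm (s *\<^sub>R (x - x')) \<le> norm (x - x')" using assms by (simp add: mult_left_le_one_le)
  also have "\<dots> < (1 - s) * \<rho>" using x' by (simp add: dist_norm norm_minus_commute)
  finally have "c + s *\<^sub>R (x' - c) + s *\<^sub>R (x - x') \<in> E"
    by (intro star_shaped_comb[OF assms(1) x'(1) assms(4,5)])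
  then show ?thesis by (simp add: algebra_simps)
qed

section \<open>Rays from the centre of a star-shaped domain\<close>

locale star_domain =
  fixes E :: "(real^2) set" and c :: "real^2" and \<rho> :: real
  assumes star: "star_shaped_wrt E (ball c \<rho>)" and rho: "0 < \<rho>"
    and op: "open E" and bd: "bounded E" and ne: "E \<noteq> {}"
begin

lemma ball_subset: "ball c \<rho> \<subseteq> E"
proof -
  obtain x where "x \<in> E" using ne by blast
  then have "convex hull (insert x (ball c \<rho>)) \<subseteq> E" using star by (simp add: star_shaped_wrt_def)
  then show ?thesis using hull_subset[of "insert x (ball c \<rho>)" convex] by blast
qed

lemma centre_mem: "c \<in> E" using ball_subset rho by auto

lemma scaled_mem: "x \<in> E \<Longrightarrow> 0 \<le> s \<Longrightarrow> s \<le> 1 \<Longrightarrow> c + s *\<^sub>R (x - c) \<in> E"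
  using star_shaped_comb[OF star, of x s 0] rho by (cases "s = 1") auto

lemma frontier_scaled_mem: "y \<in> frontier E \<Longrightarrow> 0 \<le> s \<Longrightarrow> s < 1 \<Longrightarrow> c + s *\<^sub>R (y - c) \<in> E"
  by (rule star_shaped_closure[OF star rho]) (auto simp: frontier_def)

lemma frontier_not_mem: "y \<in> frontier E \<Longrightarrow> y \<notin> E"
  using op by (auto simp: frontier_def interior_open)

lemma frontier_scaled_not_mem:
  assumes "y \<in> frontier E" "1 \<le> s"
  shows "c + s *\<^sub>R (y - c) \<notin> E"
proof
  assume "c + s *\<^sub>R (y - c) \<in> E"
  then have "c + inverse s *\<^sub>R ((c + s *\<^sub>R (y - c)) - c) \<in> E"
    by (rule scaled_mem) (use assms(2) in \<open>auto simp: field_simps\<close>)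
  moreover have "c + inverse s *\<^sub>R ((c + s *\<^sub>R (y - c)) - c) = y" using assms(2) by simp
  ultimately show False using assms frontier_not_mem by simp
qed

lemma frontier_scaled_mem_iff:
  "y \<in> frontier E \<Longrightarrow> 0 \<le> s \<Longrightarrow> c + s *\<^sub>R (y - c) \<in> E \<longleftrightarrow> s < 1"
  using frontier_scaled_mem frontier_scaled_not_mem by (meson not_le)

lemma ray_frontier:
  assumes "x \<in> E" "x \<noteq> c"
  obtains y s where "y \<in> frontier E" "0 < s" "s < 1" "x = c + s *\<^sub>R (y - c)"
proof -
  obtain d where d: "0 < d" "c + d *\<^sub>R (x - c) \<in> frontier E"
    using ray_to_frontier[OF bd, of c "x - c"] centre_mem op assms by (auto simp: interior_open)
  have "1 < d"
  proof (rule ccontr)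
    assume "\<not> 1 < d"
    then have "c + d *\<^sub>R (x - c) \<in> E" using assms d by (intro scaled_mem) auto
    then show False using d frontier_not_mem by blast
  qed
  show ?thesis
    by (rule that[OF d(2), of "inverse d"]) (use \<open>1 < d\<close> in \<open>auto simp: field_simps\<close>)
qed

text \<open>If a ray met the frontier twice, the nearer point would be a proper contraction of the
  farther one and hence lie in the open set E.\<close>

lemma ray_unique:
  assumes "y \<in> frontier E" "y' \<in> frontier E" "0 < s" "0 < s'" "c + s *\<^sub>R (y - c) = c + s' *\<^sub>R (y' - c)"
  shows "s = s' \<and> y = y'"
proof -
  have le: False if "y \<in> frontier E" "y' \<in> frontier E" "0 < s" "s < s'" "s *\<^sub>R (y - c) = s' *\<^sub>R (y' - c)"
    for y y' s s'
  proof -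
    have "y' - c = inverse s' *\<^sub>R (s' *\<^sub>R (y' - c))" using that by simp
    also have "\<dots> = inverse s' *\<^sub>R (s *\<^sub>R (y - c))" using that by simp
    also have "\<dots> = (s / s') *\<^sub>R (y - c)" by (simp add: divide_inverse mult.commute)
    finally have "y' = c + (s / s') *\<^sub>R (y - c)" by (simp add: algebra_simps)
    also have "\<dots> \<in> E" using that by (intro frontier_scaled_mem) auto
    finally show False using that frontier_not_mem by blast
  qed
  have eq: "s *\<^sub>R (y - c) = s' *\<^sub>R (y' - c)" using assms(5) by simp
  have "s = s'"
    using le[OF assms(1,2,3) _ eq] le[OF assms(2,1,4) _ eq[symmetric]] by (meson linorder_neqE)
  then show ?thesis using eq assms by simp
qed

end

section \<open>Polar coordinates\<close>

lemma Basis_real2: "(Basis :: (real^2) set) = {axis 1 1, axis 2 1}"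
  by (auto simp: Basis_vec_def UNIV_2)

text \<open>Makes Tonelli's theorem for pairs available on \<open>real^2\<close>; it suffices to
  compare the two measures on boxes.\<close>

lemma lborel_real2: "lborel = distr (lborel \<Otimes>\<^sub>M lborel) borel (\<lambda>(x, y). x *\<^sub>R axis 1 1 + y *\<^sub>R axis 2 1 :: real^2)"
proof (rule lborel_eqI)
  let ?f = "\<lambda>(x::real, y::real). x *\<^sub>R axis 1 1 + y *\<^sub>R axis 2 1 :: real^2"
  have m: "?f \<in> lborel \<Otimes>\<^sub>M lborel \<rightarrow>\<^sub>M borel"
    unfolding lborel_prod measurable_lborel2 case_prod_beta
    by (intro borel_measurable_continuous_onI continuous_intros)
  show "emeasure (distr (lborel \<Otimes>\<^sub>M lborel) borel ?f) (box l u) = (\<Prod>b\<in>Basis. (u - l) \<bullet> b)"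
    if le: "\<And>b. b \<in> Basis \<Longrightarrow> l \<bullet> b \<le> u \<bullet> b" for l u
  proof -
    have le': "l $ 1 \<le> u $ 1" "l $ 2 \<le> u $ 2"
      using le[of "axis 1 1"] le[of "axis 2 1"] by (auto simp: inner_axis)
    have "?f -` box l u = {l $ 1<..<u $ 1} \<times> {l $ 2<..<u $ 2}"
      by (auto simp: mem_box Basis_real2 inner_axis) (auto simp: axis_def)
    then have "emeasure (distr (lborel \<Otimes>\<^sub>M lborel) borel ?f) (box l u)
        = emeasure (lborel \<Otimes>\<^sub>M lborel) ({l $ 1<..<u $ 1} \<times> {l $ 2<..<u $ 2})"
      using m by (subst emeasure_distr) (auto simp: space_pair_measure)
    also have "\<dots> = ennreal (u $ 1 - l $ 1) * ennreal (u $ 2 - l $ 2)"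
      using le' by (subst lborel.emeasure_pair_measure_Times) auto
    also have "\<dots> = (\<Prod>b\<in>Basis. (u - l) \<bullet> b)"
      using le' by (simp add: Basis_real2 inner_axis axis_eq_axis ennreal_mult)
    finally show ?thesis .
  qed
qed simp

definition det2 :: "real^2 \<Rightarrow> real^2 \<Rightarrow> real" where
  "det2 P Q = P $ 1 * Q $ 2 - P $ 2 * Q $ 1"

lemma det2_lincomb: "det2 (x *\<^sub>R P + y *\<^sub>R Q) Q = x * det2 P Q" "det2 P (x *\<^sub>R P + y *\<^sub>R Q) = y * det2 P Q"
  by (simp_all add: det2_def algebra_simps)

text \<open>Cramer's rule in the plane, multiplied through by the determinant.\<close>

lemma det2_expansion: "det2 P Q *\<^sub>R w = det2 w Q *\<^sub>R P + det2 P w *\<^sub>R Q"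
  by (simp add: vec_eq_iff forall_2 det2_def algebra_simps)

text \<open>Lebesgue measure is characterised by its values on boxes, and these follow from the
  determinant formula for linear images; \<open>?g\<close> is the inverse map given by Cramer's
  rule.\<close>

lemma lborel_linear_real2:
  assumes d: "det2 P Q \<noteq> 0"
  shows "lborel = density (distr lborel borel (\<lambda>z::real^2. z $ 1 *\<^sub>R P + z $ 2 *\<^sub>R Q)) (\<lambda>_. ennreal \<bar>det2 P Q\<bar>)"
proof (rule lborel_eqI)
  let ?T = "\<lambda>z::real^2. z $ 1 *\<^sub>R P + z $ 2 *\<^sub>R Q"
  let ?g = "\<lambda>w::real^2. (det2 w Q / det2 P Q) *\<^sub>R axis 1 1 + (det2 P w / det2 P Q) *\<^sub>R axis 2 1 :: real^2"
  have linT: "linear ?T" by (rule linearI) (auto simp: algebra_simps)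
  have ling: "linear ?g"
    by (rule linearI) (auto simp: algebra_simps det2_def add_divide_distrib diff_divide_distrib)
  have gc: "?g w $ 1 = det2 w Q / det2 P Q" "?g w $ 2 = det2 P w / det2 P Q" for w
    by (auto simp: axis_def)
  have Tg: "?T (?g w) = w" for w
  proof -
    have "det2 P Q *\<^sub>R ?T (?g w) = det2 P Q *\<^sub>R w"
      unfolding gc det2_expansion[of P Q w] using d by (simp add: scaleR_add_right)
    then show ?thesis using d by simp
  qed
  have gT: "?g (?T z) = z" for z
    unfolding vec_eq_iff forall_2 gc using d by (simp add: det2_lincomb)
  have mT: "?T \<in> borel \<rightarrow>\<^sub>M borel"
    by (intro borel_measurable_continuous_onI continuous_intros)
  have det: "det (matrix ?T) = det2 P Q"
    by (simp add: det_2 matrix_def det2_def axis_def)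
  fix l u :: "real^2" assume le: "\<And>b. b \<in> Basis \<Longrightarrow> l \<bullet> b \<le> u \<bullet> b"
  let ?S = "?T -` box l u"
  have Sg: "?S = ?g ` box l u"
  proof
    show "?S \<subseteq> ?g ` box l u"
    proof
      fix z assume "z \<in> ?S"
      then show "z \<in> ?g ` box l u" using gT[of z] by (intro image_eqI[of z ?g "?T z"]) auto
    qed
    show "?g ` box l u \<subseteq> ?S" using Tg by auto
  qed
  have Sl: "?S \<in> lmeasurable" unfolding Sg by (intro measurable_linear_image ling) simp
  have Sb: "?S \<in> sets borel" using measurable_sets[OF mT, of "box l u"] by simp
  have "?T ` ?S = box l u" using Tg by (metis (no_types, lifting) surj_def surj_image_vimage_eq)
  then have ms: "measure lebesgue (box l u) = \<bar>det2 P Q\<bar> * measure lebesgue ?S"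
    using measure_linear_image[OF linT Sl] det by simp
  have fin: "emeasure lborel ?S = ennreal (measure lebesgue ?S)"
    using Sl Sb by (subst emeasure_eq_measure2[symmetric]) (auto simp: fmeasurable_def)
  have "emeasure (density (distr lborel borel ?T) (\<lambda>_. ennreal \<bar>det2 P Q\<bar>)) (box l u)
      = ennreal \<bar>det2 P Q\<bar> * emeasure lborel ?S"
    using mT by (simp add: emeasure_density nn_integral_cmult_indicator emeasure_distr)
  also have "\<dots> = ennreal (measure lebesgue (box l u))"
    unfolding fin ms by (simp add: ennreal_mult)
  also have "\<dots> = emeasure lborel (box l u)"
    using le by (simp add: emeasure_lborel_box_eq measure_lborel_box_eq)
  finally show "emeasure (density (distr lborel borel ?T) (\<lambda>_. ennreal \<bar>det2 P Q\<bar>)) (box l u)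
      = (\<Prod>b\<in>Basis. (u - l) \<bullet> b)"
    using le by (simp add: emeasure_lborel_box_eq)
qed simp

lemma nn_integral_real2_linear:
  assumes d: "det2 P Q \<noteq> 0" and f[measurable]: "f \<in> borel_measurable borel"
  shows "(\<integral>\<^sup>+w. f w \<partial>lborel) = ennreal \<bar>det2 P Q\<bar> * (\<integral>\<^sup>+x. \<integral>\<^sup>+y. f (x *\<^sub>R P + y *\<^sub>R Q) \<partial>lborel \<partial>lborel)"
proof -
  let ?T = "\<lambda>z::real^2. z $ 1 *\<^sub>R P + z $ 2 *\<^sub>R Q"
  let ?f = "\<lambda>(x::real, y::real). x *\<^sub>R axis 1 1 + y *\<^sub>R axis 2 1 :: real^2"
  have mT: "?T \<in> borel \<rightarrow>\<^sub>M borel"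
    by (intro borel_measurable_continuous_onI continuous_intros)
  have m: "?f \<in> lborel \<Otimes>\<^sub>M lborel \<rightarrow>\<^sub>M borel"
    unfolding lborel_prod measurable_lborel2 case_prod_beta
    by (intro borel_measurable_continuous_onI continuous_intros)
  have m': "(\<lambda>(x, y). f (x *\<^sub>R P + y *\<^sub>R Q)) \<in> borel_measurable (lborel \<Otimes>\<^sub>M lborel)"
    by measurable
  have Tf: "?T (?f z) = fst z *\<^sub>R P + snd z *\<^sub>R Q" for z
    by (simp add: case_prod_beta axis_def)
  have "(\<integral>\<^sup>+w. f w \<partial>lborel) = ennreal \<bar>det2 P Q\<bar> * (\<integral>\<^sup>+z. f (?T z) \<partial>lborel)"
    using mT by (subst lborel_linear_real2[OF d]) (simp add: nn_integral_density nn_integral_distr nn_integral_cmult)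
  also have "(\<integral>\<^sup>+z. f (?T z) \<partial>lborel) = (\<integral>\<^sup>+z. f (?T z) \<partial>distr (lborel \<Otimes>\<^sub>M lborel) borel ?f)"
    by (simp only: lborel_real2[symmetric])
  also have "\<dots> = (\<integral>\<^sup>+z. f (?T (?f z)) \<partial>(lborel \<Otimes>\<^sub>M lborel))"
    by (rule nn_integral_distr[OF m]) (use mT in measurable)
  also have "\<dots> = (\<integral>\<^sup>+x. \<integral>\<^sup>+y. f (x *\<^sub>R P + y *\<^sub>R Q) \<partial>lborel \<partial>lborel)"
    unfolding Tf using lborel.nn_integral_fst[OF m', symmetric] by (simp add: case_prod_beta')
  finally show ?thesis .
qed

text \<open>The side \<tau> = 0 belongs to the set and the side \<tau> = 1 does not, so that
  triangles over consecutive edges are disjoint. The apex s = 0 and the outer edge s = 1 are left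
  out.\<close>

definition half_open_triangle :: "real^2 \<Rightarrow> real^2 \<Rightarrow> (real^2) set" where
  "half_open_triangle P Q = (\<lambda>(\<tau>, s). s *\<^sub>R ((1 - \<tau>) *\<^sub>R P + \<tau> *\<^sub>R Q)) ` ({0..<1} \<times> {0<..<1})"

text \<open>The two quotients are the weights s (1 - \<tau>) and s \<tau> of P and Q in w, and their
  sum recovers the radial variable s.\<close>

lemma half_open_triangle_eq:
  assumes d: "det2 P Q \<noteq> 0"
  shows "half_open_triangle P Q = {w. 0 < det2 w Q / det2 P Q \<and> 0 \<le> det2 P w / det2 P Q \<and>
     det2 w Q / det2 P Q + det2 P w / det2 P Q < 1}"
proof (intro set_eqI iffI)
  fix w assume "w \<in> half_open_triangle P Q"
  then obtain \<tau> s where ts: "0 \<le> \<tau>" "\<tau> < 1" "0 < s" "s < 1" "w = s *\<^sub>R ((1 - \<tau>) *\<^sub>R P + \<tau> *\<^sub>R Q)"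
    by (auto simp: half_open_triangle_def)
  then have "w = (s * (1 - \<tau>)) *\<^sub>R P + (s * \<tau>) *\<^sub>R Q" by (simp add: scaleR_add_right)
  then have D: "det2 w Q / det2 P Q = s * (1 - \<tau>)" "det2 P w / det2 P Q = s * \<tau>"
    using d by (simp_all only: det2_lincomb) auto
  have "s * (1 - \<tau>) + s * \<tau> = s" by (simp add: algebra_simps)
  then show "w \<in> {w. 0 < det2 w Q / det2 P Q \<and> 0 \<le> det2 P w / det2 P Q \<and>
     det2 w Q / det2 P Q + det2 P w / det2 P Q < 1}"
    unfolding mem_Collect_eq D using ts(1-4) by simp
next
  fix w assume w: "w \<in> {w. 0 < det2 w Q / det2 P Q \<and> 0 \<le> det2 P w / det2 P Q \<and>
     det2 w Q / det2 P Q + det2 P w / det2 P Q < 1}"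
  define a b where "a = det2 w Q / det2 P Q" and "b = det2 P w / det2 P Q"
  have ab: "0 < a" "0 \<le> b" "a + b < 1" using w by (auto simp: a_def b_def)
  have "det2 P Q *\<^sub>R w = det2 P Q *\<^sub>R (a *\<^sub>R P + b *\<^sub>R Q)"
    unfolding det2_expansion[of P Q w] a_def b_def using d by (simp add: scaleR_add_right)
  then have "w = a *\<^sub>R P + b *\<^sub>R Q" using d by simp
  also have "\<dots> = (a + b) *\<^sub>R ((1 - b / (a + b)) *\<^sub>R P + (b / (a + b)) *\<^sub>R Q)"
  proof -
    have "(a + b) * (1 - b / (a + b)) = a" "(a + b) * (b / (a + b)) = b"
      using ab by (simp_all add: field_simps)
    then show ?thesis by (simp only: scaleR_add_right scaleR_scaleR)
  qed
  also have "\<dots> = (\<lambda>(\<tau>, s). s *\<^sub>R ((1 - \<tau>) *\<^sub>R P + \<tau> *\<^sub>R Q)) (b / (a + b), a + b)"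
    by (simp only: case_prod_conv)
  finally show "w \<in> half_open_triangle P Q"
    unfolding half_open_triangle_def by (rule image_eqI) (use ab in simp)
qed

lemma half_open_triangle_borel: 
  assumes d: "det2 P Q \<noteq> 0"
  shows "half_open_triangle P Q \<in> sets borel"
proof -
  have [measurable]: "(\<lambda>w. det2 w Q) \<in> borel_measurable borel" "(\<lambda>w. det2 P w) \<in> borel_measurable borel"
    unfolding det2_def by (intro borel_measurable_continuous_onI continuous_intros)+
  show ?thesis unfolding half_open_triangle_eq[OF d] by measurable
qed

text \<open>Three changes of variables: to coordinates x, y along P and Q, then from y to s = x + y,
  and finally x = s (1 - \<tau>), whose factor |s| is the polar Jacobian; only s in (0, 1)
  contributes.\<close>

lemma nn_integral_triangle:
  assumes d: "det2 P Q \<noteq> 0" and f[measurable]: "f \<in> borel_measurable borel"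
  shows "(\<integral>\<^sup>+w\<in>half_open_triangle P Q. f w \<partial>lborel) = ennreal \<bar>det2 P Q\<bar> *
     (\<integral>\<^sup>+\<tau>\<in>{0..<1}. (\<integral>\<^sup>+s\<in>{0<..<1}. ennreal s * f (s *\<^sub>R ((1 - \<tau>) *\<^sub>R P + \<tau> *\<^sub>R Q)) \<partial>lborel) \<partial>lborel)"
proof -
  define F where "F w = f w * indicator (half_open_triangle P Q) w" for w
  have F[measurable]: "F \<in> borel_measurable borel"
    unfolding F_def using half_open_triangle_borel[OF d] by measurable
  have Feq: "F (s *\<^sub>R ((1 - \<tau>) *\<^sub>R P + \<tau> *\<^sub>R Q)) =
      f (s *\<^sub>R ((1 - \<tau>) *\<^sub>R P + \<tau> *\<^sub>R Q)) * indicator {0..<1} \<tau> * indicator {0<..<1} s" if "s \<noteq> 0" for s \<tau>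
  proof -
    let ?w = "s *\<^sub>R ((1 - \<tau>) *\<^sub>R P + \<tau> *\<^sub>R Q)"
    have "?w = (s * (1 - \<tau>)) *\<^sub>R P + (s * \<tau>) *\<^sub>R Q" by (simp add: scaleR_add_right)
    then have D: "det2 ?w Q / det2 P Q = s * (1 - \<tau>)" "det2 P ?w / det2 P Q = s * \<tau>"
      using d by (simp_all only: det2_lincomb) auto
    have "s * (1 - \<tau>) + s * \<tau> = s" by (simp add: algebra_simps)
    then have "?w \<in> half_open_triangle P Q \<longleftrightarrow> 0 < s * (1 - \<tau>) \<and> 0 \<le> s * \<tau> \<and> s < 1"
      unfolding half_open_triangle_eq[OF d] mem_Collect_eq D by simp
    also have "\<dots> \<longleftrightarrow> \<tau> \<in> {0..<1} \<and> s \<in> {0<..<1}"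
      using that by (auto simp: zero_less_mult_iff zero_le_mult_iff)
    finally show ?thesis by (auto simp: F_def indicator_def)
  qed
  have "(\<integral>\<^sup>+w. F w \<partial>lborel) = ennreal \<bar>det2 P Q\<bar> * (\<integral>\<^sup>+x. \<integral>\<^sup>+y. F (x *\<^sub>R P + y *\<^sub>R Q) \<partial>lborel \<partial>lborel)"
    by (rule nn_integral_real2_linear[OF d F])
  also have "(\<integral>\<^sup>+x. \<integral>\<^sup>+y. F (x *\<^sub>R P + y *\<^sub>R Q) \<partial>lborel \<partial>lborel)
      = (\<integral>\<^sup>+x. \<integral>\<^sup>+s. F (x *\<^sub>R P + (s - x) *\<^sub>R Q) \<partial>lborel \<partial>lborel)"
  proof (rule nn_integral_cong)
    fix x :: real
    show "(\<integral>\<^sup>+y. F (x *\<^sub>R P + y *\<^sub>R Q) \<partial>lborel) = (\<integral>\<^sup>+s. F (x *\<^sub>R P + (s - x) *\<^sub>R Q) \<partial>lborel)"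
      using nn_integral_real_affine[of "\<lambda>y. F (x *\<^sub>R P + y *\<^sub>R Q)" 1 "- x"] by simp
  qed
  also have "\<dots> = (\<integral>\<^sup>+s. \<integral>\<^sup>+x. F (x *\<^sub>R P + (s - x) *\<^sub>R Q) \<partial>lborel \<partial>lborel)"
    by (rule lborel_pair.Fubini'[symmetric]) measurable
  also have "\<dots> = (\<integral>\<^sup>+s. \<integral>\<^sup>+\<tau>. ennreal s * f (s *\<^sub>R ((1 - \<tau>) *\<^sub>R P + \<tau> *\<^sub>R Q)) *
      indicator {0..<1} \<tau> * indicator {0<..<1} s \<partial>lborel \<partial>lborel)"
  proof (rule nn_integral_cong_AE)
    have "AE s in lborel. s \<noteq> (0::real)" by (rule AE_lborel_singleton)
    then show "AE s in lborel. (\<integral>\<^sup>+x. F (x *\<^sub>R P + (s - x) *\<^sub>R Q) \<partial>lborel)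
      = (\<integral>\<^sup>+\<tau>. ennreal s * f (s *\<^sub>R ((1 - \<tau>) *\<^sub>R P + \<tau> *\<^sub>R Q)) *
      indicator {0..<1} \<tau> * indicator {0<..<1} s \<partial>lborel)"
    proof (rule eventually_mono)
      fix s :: real assume s: "s \<noteq> 0"
      have "(\<integral>\<^sup>+x. F (x *\<^sub>R P + (s - x) *\<^sub>R Q) \<partial>lborel)
          = ennreal \<bar>s\<bar> * (\<integral>\<^sup>+\<tau>. F ((s + - s * \<tau>) *\<^sub>R P + (s - (s + - s * \<tau>)) *\<^sub>R Q) \<partial>lborel)"
        using s nn_integral_real_affine[of "\<lambda>x. F (x *\<^sub>R P + (s - x) *\<^sub>R Q)" "- s" s] by simp
      also have "\<dots> = (\<integral>\<^sup>+\<tau>. ennreal \<bar>s\<bar> * F (s *\<^sub>R ((1 - \<tau>) *\<^sub>R P + \<tau> *\<^sub>R Q)) \<partial>lborel)"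
        by (subst nn_integral_cmult) (auto simp: algebra_simps)
      also have "\<dots> = (\<integral>\<^sup>+\<tau>. ennreal s * f (s *\<^sub>R ((1 - \<tau>) *\<^sub>R P + \<tau> *\<^sub>R Q)) *
          indicator {0..<1} \<tau> * indicator {0<..<1} s \<partial>lborel)"
        unfolding Feq[OF s] by (intro nn_integral_cong) (auto simp: indicator_def mult.assoc)
      finally show "(\<integral>\<^sup>+x. F (x *\<^sub>R P + (s - x) *\<^sub>R Q) \<partial>lborel)
        = (\<integral>\<^sup>+\<tau>. ennreal s * f (s *\<^sub>R ((1 - \<tau>) *\<^sub>R P + \<tau> *\<^sub>R Q)) *
          indicator {0..<1} \<tau> * indicator {0<..<1} s \<partial>lborel)" .
    qed
  qed
  also have "\<dots> = (\<integral>\<^sup>+\<tau>. \<integral>\<^sup>+s. ennreal s * f (s *\<^sub>R ((1 - \<tau>) *\<^sub>R P + \<tau> *\<^sub>R Q)) *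
      indicator {0..<1} \<tau> * indicator {0<..<1} s \<partial>lborel \<partial>lborel)"
    by (rule lborel_pair.Fubini'[symmetric]) measurable
  also have "\<dots> = (\<integral>\<^sup>+\<tau>\<in>{0..<1}. (\<integral>\<^sup>+s\<in>{0<..<1}. ennreal s * f (s *\<^sub>R ((1 - \<tau>) *\<^sub>R P + \<tau> *\<^sub>R Q)) \<partial>lborel) \<partial>lborel)"
    by (subst nn_integral_multc[symmetric]) (auto intro!: nn_integral_cong simp: mult_ac)
  finally show ?thesis unfolding F_def .
qed

section \<open>Cauchy-Schwarz and the estimate along a ray\<close>

lemma integral_Cauchy_Schwarz:
  fixes f g :: "'a \<Rightarrow> real"
  assumes f: "integrable M (\<lambda>x. (f x)\<^sup>2)" and g: "integrable M (\<lambda>x. (g x)\<^sup>2)"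
    and fg: "integrable M (\<lambda>x. f x * g x)"
  shows "(LINT x|M. f x * g x)\<^sup>2 \<le> (LINT x|M. (f x)\<^sup>2) * (LINT x|M. (g x)\<^sup>2)"
proof -
  define A B C where "A = (LINT x|M. (f x)\<^sup>2)" and "B = (LINT x|M. f x * g x)" and "C = (LINT x|M. (g x)\<^sup>2)"
  have q: "0 \<le> A + 2 * t * B + t\<^sup>2 * C" for t
  proof -
    have "0 \<le> (LINT x|M. (f x + t * g x)\<^sup>2)" by simp
    also have "\<dots> = (LINT x|M. (f x)\<^sup>2 + 2 * t * (f x * g x) + t\<^sup>2 * (g x)\<^sup>2)"
      by (intro Bochner_Integration.integral_cong) (auto simp: power2_eq_square algebra_simps)
    also have "\<dots> = A + 2 * t * B + t\<^sup>2 * C"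
      using f g fg by (simp add: A_def B_def C_def)
    finally show ?thesis .
  qed
  have C: "0 \<le> C" by (simp add: C_def)
  have "B\<^sup>2 \<le> A * C"
  proof (cases "C = 0")
    case True
    have "B = 0"
    proof (rule ccontr)
      assume "B \<noteq> 0"
      \<comment> \<open>Without the quadratic term the expression is linear in t, and this t makes
        it equal to - 1.\<close>
      then have "A + 2 * (- (A + 1) / (2 * B)) * B = - 1" by (simp add: field_simps)
      then show False using q[of "- (A + 1) / (2 * B)"] True by simp
    qed
    then show ?thesis using True by simp
  next
    case False
    have "0 \<le> (A + 2 * (- B / C) * B + (- B / C)\<^sup>2 * C) * C"
      by (rule mult_nonneg_nonneg[OF q C])
    also have "\<dots> = A * C - B\<^sup>2" using False by (simp add: field_simps power2_eq_square)
    finally show ?thesis by simp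
  qed
  then show ?thesis by (simp add: A_def B_def C_def)
qed

text \<open>The fundamental theorem of calculus from s to 1, with Cauchy-Schwarz contributing the
  length 1 - s; the rest is x^2 \<le> 2 y^2 + 2 (y - x)^2 for x = h s and y = h 1.\<close>

lemma ray_estimate:
  fixes h h' :: "real \<Rightarrow> real"
  assumes s: "s \<le> 1" and d: "\<And>r. (h has_real_derivative h' r) (at r)" and c: "continuous_on UNIV h'"
  shows "(h s)\<^sup>2 \<le> 2 * (h 1)\<^sup>2 + 2 * (1 - s) * (LINT r:{s..1}|lborel. (h' r)\<^sup>2)"
proof -
  let ?i = "indicator {s..1} :: real \<Rightarrow> real"
  have ci: "isCont h' r" for r using c by (simp add: continuous_on_eq_continuous_at)
  have int1: "integrable lborel (\<lambda>r. h' r * ?i r)"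
    using borel_integrable_compact[OF compact_Icc, of s 1 h'] c continuous_on_subset
    by (simp add: mult.commute continuous_on_subset)
  have int2: "integrable lborel (\<lambda>r. (h' r * ?i r)\<^sup>2)"
  proof -
    have "integrable lborel (\<lambda>r. ?i r *\<^sub>R (h' r)\<^sup>2)"
      by (intro borel_integrable_compact continuous_intros continuous_on_subset[OF c]) auto
    moreover have "(\<lambda>r. ?i r *\<^sub>R (h' r)\<^sup>2) = (\<lambda>r. (h' r * ?i r)\<^sup>2)" by (auto simp: indicator_def fun_eq_iff)
    ultimately show ?thesis by simp
  qed
  have i3: "(\<lambda>r. (?i r)\<^sup>2) = ?i" by (auto simp: indicator_def fun_eq_iff)
  have int3: "integrable lborel (\<lambda>r. (?i r)\<^sup>2)" unfolding i3 by (intro integrable_real_indicator) (auto simp: s)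
  have i4: "(\<lambda>r. (h' r * ?i r) * ?i r) = (\<lambda>r. h' r * ?i r)" by (auto simp: indicator_def fun_eq_iff)
  have "(h 1 - h s)\<^sup>2 = (LINT r|lborel. (h' r * ?i r) * ?i r)\<^sup>2"
    unfolding i4 using integral_FTC_Icc_real[OF s d ci] by simp
  also have "\<dots> \<le> (LINT r|lborel. (h' r * ?i r)\<^sup>2) * (LINT r|lborel. (?i r)\<^sup>2)"
    by (intro integral_Cauchy_Schwarz int2 int3) (simp only: i4 int1)
  also have "(LINT r|lborel. (?i r)\<^sup>2) = 1 - s" unfolding i3 using s by simp
  also have "(LINT r|lborel. (h' r * ?i r)\<^sup>2) = (LINT r:{s..1}|lborel. (h' r)\<^sup>2)"
    unfolding set_lebesgue_integral_def by (intro Bochner_Integration.integral_cong) (auto simp: indicator_def)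
  finally have *: "(h 1 - h s)\<^sup>2 \<le> (LINT r:{s..1}|lborel. (h' r)\<^sup>2) * (1 - s)" .
  have "(h s)\<^sup>2 \<le> 2 * (h 1)\<^sup>2 + 2 * (h 1 - h s)\<^sup>2"
    using zero_le_power2[of "h s - 2 * h 1"] by (simp add: power2_eq_square algebra_simps)
  also have "\<dots> \<le> 2 * (h 1)\<^sup>2 + 2 * ((LINT r:{s..1}|lborel. (h' r)\<^sup>2) * (1 - s))" using * by linarith
  also have "\<dots> = 2 * (h 1)\<^sup>2 + 2 * (1 - s) * (LINT r:{s..1}|lborel. (h' r)\<^sup>2)" by simp
  finally show ?thesis .
qed

section \<open>The polygon in polar coordinates around the centre\<close>

locale star_polygon =
  fixes vs :: "(real^2) list" and c :: "real^2" and \<rho> :: real and c' :: "real^2" and \<rho>' :: real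
  assumes sp: "simple_polygon vs" and star_vs: "star_shaped_wrt (polygon_domain vs) (ball c \<rho>)"
    and rho_pos: "0 < \<rho>" and outer: "polygon_domain vs \<subseteq> ball c' \<rho>'" and nonempty: "polygon_domain vs \<noteq> {}"
begin

abbreviation E :: "(real^2) set" where "E \<equiv> polygon_domain vs"

sublocale star_domain E c \<rho>
proof
  show "bounded E" using outer bounded_subset[OF bounded_ball] by blast
qed (use star_vs rho_pos nonempty open_polygon_domain in auto)

lemma frontier_E: "frontier E = polygon_boundary vs"
  by (rule frontier_polygon_domain[OF sp nonempty])

lemma dist_centre: "x \<in> closure E \<Longrightarrow> norm (x - c) \<le> 2 * \<rho>'"
proof -
  assume x: "x \<in> closure E"
  have "closure E \<subseteq> cball c' \<rho>'" using outer by (intro closure_minimal) auto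
  then have "dist c' x \<le> \<rho>'" "dist c' c \<le> \<rho>'" using x centre_mem outer by (auto simp: subset_iff less_imp_le)
  then show ?thesis using dist_triangle[of x c c'] by (simp add: dist_norm norm_minus_commute)
qed

lemma rho'_pos: "0 < \<rho>'"
  using nonempty outer by (metis ball_eq_empty not_le subset_empty)

definition P :: "nat \<Rightarrow> real^2" where "P i = vs ! i - c"
definition Q :: "nat \<Rightarrow> real^2" where "Q i = next_vertex vs i - c"
text \<open>Twice the area of the triangle with apex c over the edge; this is the constant part of
  the polar Jacobian there.\<close>

definition D :: "nat \<Rightarrow> real" where "D i = \<bar>det2 (P i) (Q i)\<bar>"
definition ep :: "nat \<Rightarrow> real \<Rightarrow> real^2" where "ep i \<tau> = (1 - \<tau>) *\<^sub>R (vs ! i) + \<tau> *\<^sub>R next_vertex vs i"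

lemma ep_minus: "ep i \<tau> - c = (1 - \<tau>) *\<^sub>R P i + \<tau> *\<^sub>R Q i"
  by (simp add: ep_def P_def Q_def algebra_simps)

lemma ep_edge: "0 \<le> \<tau> \<Longrightarrow> \<tau> \<le> 1 \<Longrightarrow> ep i \<tau> \<in> edge vs i"
  by (auto simp: ep_def edge_def in_segment)

lemma ep_frontier: "i < length vs \<Longrightarrow> 0 \<le> \<tau> \<Longrightarrow> \<tau> \<le> 1 \<Longrightarrow> ep i \<tau> \<in> frontier E"
  unfolding frontier_E polygon_boundary_def using ep_edge by blast

lemma next_vertex_nth: "i < length vs \<Longrightarrow> \<exists>j<length vs. next_vertex vs i = vs ! j"
  unfolding next_vertex_def by (intro exI[of _ "Suc i mod length vs"] conjI refl mod_less_divisor) linarith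

lemma boundary_half_open:
  assumes "y \<in> frontier E"
  obtains i \<tau> where "i < length vs" "0 \<le> \<tau>" "\<tau> < 1" "y = ep i \<tau>"
proof -
  obtain i where i: "i < length vs" "y \<in> edge vs i"
    using assms unfolding frontier_E polygon_boundary_def by blast
  then obtain \<tau> where t: "0 \<le> \<tau>" "\<tau> \<le> 1" "y = ep i \<tau>" by (auto simp: edge_def in_segment ep_def)
  show ?thesis
  proof (cases "\<tau> = 1")
    case True
    \<comment> \<open>The final vertex of an edge counts as the initial vertex of its
      successor.\<close>
    then have "y = next_vertex vs i" using t by (simp add: ep_def)
    then obtain j where "j < length vs" "y = vs ! j" using next_vertex_nth[OF i(1)] by auto
    then show ?thesis by (intro that[of j 0]) (auto simp: ep_def)
  qed (use that i t in auto)
qed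

text \<open>A common point of two edges is a vertex of both. With final vertices excluded it is the
  initial vertex of both, which distinctness of the vertices forbids.\<close>

lemma ep_half_open_unique:
  assumes "i < length vs" "0 \<le> \<tau>" "\<tau> < 1" "j < length vs" "0 \<le> \<tau>'" "\<tau>' < 1" "ep i \<tau> = ep j \<tau>'"
  shows "i = j"
proof (rule ccontr)
  assume n: "i \<noteq> j"
  have neq: "ep i \<tau> \<noteq> next_vertex vs i" if "i < length vs" "\<tau> < 1" for i \<tau>
  proof
    assume "ep i \<tau> = next_vertex vs i"
    then have "(1 - \<tau>) *\<^sub>R (vs ! i) = (1 - \<tau>) *\<^sub>R next_vertex vs i" by (simp add: ep_def algebra_simps)
    then show False using that next_vertex_neq[OF sp that(1)] by simp
  qed
  have "ep i \<tau> \<in> edge vs i \<inter> edge vs j"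
    using ep_edge[of \<tau> i] ep_edge[of \<tau>' j] assms by auto
  then have "ep i \<tau> \<in> {vs ! i, next_vertex vs i} \<inter> {vs ! j, next_vertex vs j}"
    using edge_inter[OF sp assms(1,4) n] by simp
  moreover have "ep i \<tau> \<noteq> next_vertex vs i" "ep i \<tau> \<noteq> next_vertex vs j"
    using neq[OF assms(1,3)] neq[OF assms(4,6)] assms(7) by auto
  ultimately have "vs ! i = vs ! j" by (metis IntE insertE singletonD)
  then show False using n assms(1,4) sp by (simp add: simple_polygon_def nth_eq_iff_index_eq)
qed

text \<open>An edge on a line through c would either lie on one ray, which then meets the frontier
  twice, or pass through c itself, which is interior.\<close>

lemma det2_neq_0:
  assumes i: "i < length vs"
  shows "det2 (P i) (Q i) \<noteq> 0"
proof
  assume d: "det2 (P i) (Q i) = 0"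
  have f: "vs ! i \<in> frontier E" "next_vertex vs i \<in> frontier E"
    using ep_frontier[OF i, of 0] ep_frontier[OF i, of 1] by (auto simp: ep_def)
  have P0: "P i \<noteq> 0" and Q0: "Q i \<noteq> 0" using f frontier_not_mem centre_mem by (auto simp: P_def Q_def)
  define l where "l = (P i \<bullet> Q i) / (P i \<bullet> P i)"
  have "(P i \<bullet> P i) *\<^sub>R Q i = (P i \<bullet> Q i) *\<^sub>R P i"
    using d by (simp add: vec_eq_iff forall_2 inner_vec_def sum_2 det2_def) algebra
  then have "inverse (P i \<bullet> P i) *\<^sub>R ((P i \<bullet> P i) *\<^sub>R Q i) = inverse (P i \<bullet> P i) *\<^sub>R ((P i \<bullet> Q i) *\<^sub>R P i)" by simp
  then have Ql: "Q i = l *\<^sub>R P i" using P0 by (simp add: l_def divide_inverse mult.commute)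
  then have "l \<noteq> 0" using Q0 by auto
  show False
  proof (cases "0 < l")
    case True
    have "c + 1 *\<^sub>R (next_vertex vs i - c) = c + l *\<^sub>R (vs ! i - c)" using Ql by (simp add: P_def Q_def)
    then have "next_vertex vs i = vs ! i" using ray_unique[OF f(2,1), of 1 l] True by simp
    then show False using next_vertex_neq[OF sp i] by simp
  next
    case False
    then have l: "l < 0" using \<open>l \<noteq> 0\<close> by simp
    \<comment> \<open>The parameter at which the edge passes through c.\<close>
    define t where "t = 1 / (1 - l)"
    have t: "0 \<le> t" "t \<le> 1" "1 - t + t * l = 0" using l by (auto simp: t_def field_simps)
    have "ep i t - c = (1 - t + t * l) *\<^sub>R P i" unfolding ep_minus Ql by (simp add: algebra_simps)
    then have "ep i t = c" using t by simp
    then show False using ep_frontier[OF i t(1,2)] frontier_not_mem centre_mem by auto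
  qed
qed

lemma triangle_mem_iff:
  "w \<in> half_open_triangle (P i) (Q i) \<longleftrightarrow> (\<exists>\<tau> s. 0 \<le> \<tau> \<and> \<tau> < 1 \<and> 0 < s \<and> s < 1 \<and> w = s *\<^sub>R (ep i \<tau> - c))"
proof
  assume "w \<in> half_open_triangle (P i) (Q i)"
  then show "\<exists>\<tau> s. 0 \<le> \<tau> \<and> \<tau> < 1 \<and> 0 < s \<and> s < 1 \<and> w = s *\<^sub>R (ep i \<tau> - c)"
    unfolding half_open_triangle_def ep_minus by fastforce
next
  assume "\<exists>\<tau> s. 0 \<le> \<tau> \<and> \<tau> < 1 \<and> 0 < s \<and> s < 1 \<and> w = s *\<^sub>R (ep i \<tau> - c)"
  then obtain \<tau> s where "0 \<le> \<tau>" "\<tau> < 1" "0 < s" "s < 1" "w = s *\<^sub>R (ep i \<tau> - c)" by blast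
  then show "w \<in> half_open_triangle (P i) (Q i)"
    unfolding half_open_triangle_def ep_minus by (intro image_eqI[of _ _ "(\<tau>, s)"]) auto
qed

text \<open>A point of E other than c lies on one ray to one frontier point, and that point on one
  half-open edge; hence the triangles tile E up to the centre.\<close>

lemma sum_indicator_triangle:
  assumes "w \<noteq> 0"
  shows "(\<Sum>i<length vs. indicator (half_open_triangle (P i) (Q i)) w) = (indicator E (c + w) :: ennreal)"
proof (cases "c + w \<in> E")
  case True
  obtain y s where ys: "y \<in> frontier E" "0 < s" "s < 1" "c + w = c + s *\<^sub>R (y - c)"
    using ray_frontier[OF True] assms by auto
  obtain i \<tau> where i: "i < length vs" "0 \<le> \<tau>" "\<tau> < 1" "y = ep i \<tau>"
    using boundary_half_open[OF ys(1)] by blast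
  have wi: "w \<in> half_open_triangle (P i) (Q i)"
  proof -
    have "w = s *\<^sub>R (ep i \<tau> - c)" using ys(4) i(4) by simp
    then show ?thesis unfolding triangle_mem_iff using ys(2,3) i(2,3) by blast
  qed
  have "w \<notin> half_open_triangle (P j) (Q j)" if j: "j < length vs" "j \<noteq> i" for j
  proof
    assume "w \<in> half_open_triangle (P j) (Q j)"
    then obtain \<tau>' s' where t: "0 \<le> \<tau>'" "\<tau>' < 1" "0 < s'" "s' < 1" "w = s' *\<^sub>R (ep j \<tau>' - c)"
      unfolding triangle_mem_iff by blast
    have "c + s *\<^sub>R (y - c) = c + s' *\<^sub>R (ep j \<tau>' - c)" unfolding ys(4)[symmetric] t(5) ..
    then have "y = ep j \<tau>'"
      using ray_unique[OF ys(1) ep_frontier[OF j(1) t(1) less_imp_le[OF t(2)]] ys(2) t(3)] by blast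
    then have "i = j" unfolding i(4) by (rule ep_half_open_unique[OF i(1-3) j(1) t(1,2)])
    then show False using j(2) by simp
  qed
  then have "(\<Sum>j<length vs. indicator (half_open_triangle (P j) (Q j)) w) = (\<Sum>j<length vs. if j = i then 1 else (0::ennreal))"
    using wi by (intro sum.cong) auto
  then show ?thesis using True i by simp
next
  case False
  have "w \<notin> half_open_triangle (P j) (Q j)" if j: "j < length vs" for j
  proof
    assume "w \<in> half_open_triangle (P j) (Q j)"
    then obtain \<tau>' s' where t: "0 \<le> \<tau>'" "\<tau>' < 1" "0 < s'" "s' < 1" "w = s' *\<^sub>R (ep j \<tau>' - c)"
      unfolding triangle_mem_iff by blast
    then have "c + w \<in> E" using frontier_scaled_mem[OF ep_frontier[OF j, of \<tau>'], of s'] by simp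
    then show False using False by simp
  qed
  then show ?thesis using False by simp
qed

lemma E_borel [measurable]: "E \<in> sets borel" using op by simp

text \<open>Polar coordinates centred at \<open>c\<close>, the angle being replaced by the parameter on each edge.\<close>

lemma nn_integral_polar:
  assumes f[measurable]: "f \<in> borel_measurable borel"
  shows "(\<integral>\<^sup>+x\<in>E. f x \<partial>lborel) = (\<Sum>i<length vs. ennreal (D i) *
     (\<integral>\<^sup>+\<tau>\<in>{0..<1}. (\<integral>\<^sup>+s\<in>{0<..<1}. ennreal s * f (c + s *\<^sub>R (ep i \<tau> - c)) \<partial>lborel) \<partial>lborel))"
proof -
  have m: "half_open_triangle (P i) (Q i) \<in> sets borel" if "i < length vs" for i
    by (rule half_open_triangle_borel[OF det2_neq_0[OF that]])
  have "(\<integral>\<^sup>+x\<in>E. f x \<partial>lborel) = (\<integral>\<^sup>+x. f x * indicator E x \<partial>distr lborel borel ((+) c))"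
    by (simp only: lborel_distr_plus)
  also have "\<dots> = (\<integral>\<^sup>+w. f (c + w) * indicator E (c + w) \<partial>lborel)"
    by (rule nn_integral_distr) auto
  also have "\<dots> = (\<integral>\<^sup>+w. (\<Sum>i<length vs. f (c + w) * indicator (half_open_triangle (P i) (Q i)) w) \<partial>lborel)"
  proof (rule nn_integral_cong_AE)
    have "AE w in lborel. w \<noteq> (0::real^2)" by (rule AE_lborel_singleton)
    then show "AE w in lborel. f (c + w) * indicator E (c + w) =
        (\<Sum>i<length vs. f (c + w) * indicator (half_open_triangle (P i) (Q i)) w)"
      by (rule eventually_mono) (simp add: sum_indicator_triangle sum_distrib_left[symmetric])
  qed
  also have "\<dots> = (\<Sum>i<length vs. \<integral>\<^sup>+w\<in>half_open_triangle (P i) (Q i). f (c + w) \<partial>lborel)"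
    using m by (intro nn_integral_sum) auto
  also have "\<dots> = (\<Sum>i<length vs. ennreal (D i) *
     (\<integral>\<^sup>+\<tau>\<in>{0..<1}. (\<integral>\<^sup>+s\<in>{0<..<1}. ennreal s * f (c + s *\<^sub>R (ep i \<tau> - c)) \<partial>lborel) \<partial>lborel))"
    unfolding D_def ep_minus by (intro sum.cong refl nn_integral_triangle det2_neq_0) auto
  finally show ?thesis .
qed

text \<open>E without its copy contracted about c by the factor a. The premise 0 < a makes
  \<open>strip 0\<close> all of E, so that one inequality yields both the Poincare estimate and the
  thin-strip estimate.\<close>

definition strip :: "real \<Rightarrow> (real^2) set" where
  "strip a = {x \<in> E. 0 < a \<longrightarrow> c + inverse a *\<^sub>R (x - c) \<notin> E}"

lemma strip_borel [measurable]: "strip a \<in> sets borel"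
  unfolding strip_def by measurable

lemma strip_0: "strip 0 = E" by (simp add: strip_def)

lemma strip_subset: "strip a \<subseteq> E" by (auto simp: strip_def)

lemma ray_strip_iff:
  assumes "y \<in> frontier E" "0 < s" "s < 1" "0 \<le> a"
  shows "c + s *\<^sub>R (y - c) \<in> strip a \<longleftrightarrow> a \<le> s"
proof (cases "0 < a")
  case True
  have e: "c + inverse a *\<^sub>R ((c + s *\<^sub>R (y - c)) - c) = c + (s / a) *\<^sub>R (y - c)" by (simp add: divide_inverse mult.commute)
  have "c + (s / a) *\<^sub>R (y - c) \<in> E \<longleftrightarrow> \<not> a \<le> s"
    using frontier_scaled_mem_iff[OF assms(1), of "s / a"] True assms by (simp add: field_simps not_le)
  then show ?thesis
    unfolding strip_def mem_Collect_eq e using True assms frontier_scaled_mem[OF assms(1), of s] by simp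
qed (use assms frontier_scaled_mem in \<open>auto simp: strip_def\<close>)

lemma nn_integral_strip:
  assumes f[measurable]: "f \<in> borel_measurable borel" and a: "0 \<le> a"
  shows "(\<integral>\<^sup>+x\<in>strip a. f x \<partial>lborel) = (\<Sum>i<length vs. ennreal (D i) *
     (\<integral>\<^sup>+\<tau>\<in>{0..<1}. (\<integral>\<^sup>+s\<in>{0<..<1} \<inter> {a..}. ennreal s * f (c + s *\<^sub>R (ep i \<tau> - c)) \<partial>lborel) \<partial>lborel))"
proof -
  have "(\<integral>\<^sup>+x\<in>strip a. f x \<partial>lborel) = (\<integral>\<^sup>+x\<in>E. f x * indicator (strip a) x \<partial>lborel)"
    using strip_subset by (intro nn_integral_cong) (auto simp: indicator_def)
  also have "\<dots> = (\<Sum>i<length vs. ennreal (D i) *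
     (\<integral>\<^sup>+\<tau>\<in>{0..<1}. (\<integral>\<^sup>+s\<in>{0<..<1}. ennreal s * (f (c + s *\<^sub>R (ep i \<tau> - c)) *
        indicator (strip a) (c + s *\<^sub>R (ep i \<tau> - c))) \<partial>lborel) \<partial>lborel))"
    by (rule nn_integral_polar) measurable
  also have "\<dots> = (\<Sum>i<length vs. ennreal (D i) *
     (\<integral>\<^sup>+\<tau>\<in>{0..<1}. (\<integral>\<^sup>+s\<in>{0<..<1} \<inter> {a..}. ennreal s * f (c + s *\<^sub>R (ep i \<tau> - c)) \<partial>lborel) \<partial>lborel))"
  proof (rule sum.cong[OF refl])
    fix i assume i: "i \<in> {..<length vs}"
    have e: "(\<integral>\<^sup>+s\<in>{0<..<1}. ennreal s * (f (c + s *\<^sub>R (ep i \<tau> - c)) *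
        indicator (strip a) (c + s *\<^sub>R (ep i \<tau> - c))) \<partial>lborel) * indicator {0..<1} \<tau>
      = (\<integral>\<^sup>+s\<in>{0<..<1} \<inter> {a..}. ennreal s * f (c + s *\<^sub>R (ep i \<tau> - c)) \<partial>lborel) * indicator {0..<1} \<tau>" for \<tau>
    proof (cases "\<tau> \<in> {0..<1}")
      case True
      then have y: "ep i \<tau> \<in> frontier E" using i by (intro ep_frontier) auto
      have e: "ennreal s * (f (c + s *\<^sub>R (ep i \<tau> - c)) * indicator (strip a) (c + s *\<^sub>R (ep i \<tau> - c))) * indicator {0<..<1} s
        = ennreal s * f (c + s *\<^sub>R (ep i \<tau> - c)) * indicator ({0<..<1} \<inter> {a..}) s" for s
        using ray_strip_iff[OF y _ _ a, of s] by (cases "0 < s \<and> s < 1") (auto simp: indicator_def)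
      show ?thesis unfolding e ..
    qed simp
    show "ennreal (D i) * (\<integral>\<^sup>+\<tau>\<in>{0..<1}. (\<integral>\<^sup>+s\<in>{0<..<1}. ennreal s * (f (c + s *\<^sub>R (ep i \<tau> - c)) *
        indicator (strip a) (c + s *\<^sub>R (ep i \<tau> - c))) \<partial>lborel) \<partial>lborel)
      = ennreal (D i) * (\<integral>\<^sup>+\<tau>\<in>{0..<1}. (\<integral>\<^sup>+s\<in>{0<..<1} \<inter> {a..}. ennreal s * f (c + s *\<^sub>R (ep i \<tau> - c)) \<partial>lborel) \<partial>lborel)"
      unfolding e ..
  qed
  finally show ?thesis .
qed

text \<open>The ray estimate integrated in polar coordinates. Boundary values enter with one factor
  1 - a, the radial width; the gradient enters with two, one from Cauchy-Schwarz and one from the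
  integration in s. The 8 \<rho>'^2 is 2 (2 \<rho>')^2, with 2 \<rho>' bounding the length of a
  ray.\<close>

lemma strip_estimate:
  assumes u: "smooth u" and a: "0 \<le> a" "a < 1"
  shows "(\<integral>\<^sup>+x\<in>strip a. ennreal ((u x)\<^sup>2) \<partial>lborel) \<le>
    ennreal (2 * (1 - a)) * (\<Sum>i<length vs. ennreal (D i) * (\<integral>\<^sup>+\<tau>\<in>{0..<1}. ennreal ((u (ep i \<tau>))\<^sup>2) \<partial>lborel))
    + ennreal (8 * \<rho>'\<^sup>2 * (1 - a)\<^sup>2) * (\<integral>\<^sup>+x\<in>strip a. ennreal ((norm (grad u x))\<^sup>2) \<partial>lborel)"
proof -
  let ?g = "\<lambda>x. (norm (grad u x))\<^sup>2"
  have uc[measurable]: "u \<in> borel_measurable borel" and gc[measurable]: "?g \<in> borel_measurable borel"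
    using u by (auto intro!: borel_measurable_continuous_onI smooth_continuous continuous_intros continuous_grad)
  let ?K = "\<lambda>i \<tau>. \<integral>\<^sup>+s\<in>{0<..<1} \<inter> {a..}. ennreal s * ennreal (?g (c + s *\<^sub>R (ep i \<tau> - c))) \<partial>lborel"
  have epm[measurable]: "(\<lambda>\<tau>. ep i \<tau>) \<in> borel_measurable borel" for i
    unfolding ep_def by measurable
  have Km[measurable]: "(\<lambda>\<tau>. ?K i \<tau>) \<in> borel_measurable borel" for i
    by measurable
  have inner: "(\<integral>\<^sup>+s\<in>{0<..<1} \<inter> {a..}. ennreal s * ennreal ((u (c + s *\<^sub>R (ep i \<tau> - c)))\<^sup>2) \<partial>lborel)
      \<le> ennreal (2 * (1 - a)) * ennreal ((u (ep i \<tau>))\<^sup>2) + ennreal (8 * \<rho>'\<^sup>2 * (1 - a)\<^sup>2) * ?K i \<tau>"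
    if i: "i < length vs" and t: "0 \<le> \<tau>" "\<tau> < 1" for i \<tau>
  proof -
    let ?y = "ep i \<tau> - c"
    have y: "norm ?y \<le> 2 * \<rho>'"
      using ep_frontier[OF i t(1)] t by (intro dist_centre) (auto simp: frontier_def)
    define h' where "h' r = grad u (c + r *\<^sub>R ?y) \<bullet> ?y" for r
    have d: "((\<lambda>r. u (c + r *\<^sub>R ?y)) has_real_derivative h' r) (at r)" for r
    proof -
      have "((\<lambda>r. u (c + r *\<^sub>R ?y)) has_derivative (\<lambda>h. grad u (c + r *\<^sub>R ?y) \<bullet> (h *\<^sub>R ?y))) (at r)"
        by (intro has_derivative_compose[of "\<lambda>r. c + r *\<^sub>R ?y", OF _ has_derivative_grad] smooth_differentiable u)
          (auto intro!: derivative_eq_intros)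
      then show ?thesis by (simp add: has_field_derivative_def h'_def mult.commute[of _ "_ \<bullet> _"])
    qed
    have gcu: "continuous_on UNIV (grad u)" by (rule continuous_grad[OF u])
    have gr: "continuous_on UNIV (\<lambda>r. grad u (c + r *\<^sub>R ?y))"
      by (rule continuous_on_compose2[OF gcu]) (auto intro!: continuous_intros)
    have h'c: "continuous_on UNIV h'"
      unfolding h'_def by (intro continuous_intros gr)
    have gi: "integrable lborel (\<lambda>r. indicator {s..1} r *\<^sub>R (r * ?g (c + r *\<^sub>R ?y)))"
      "integrable lborel (\<lambda>r. indicator {s..1} r *\<^sub>R (?g (c + r *\<^sub>R ?y)))" 
      "integrable lborel (\<lambda>r. indicator {s..1} r *\<^sub>R ((h' r)\<^sup>2))" for s
      by (intro borel_integrable_compact continuous_intros continuous_on_subset[OF gr]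
          continuous_on_subset[OF h'c]; simp)+
    have pt: "ennreal s * ennreal ((u (c + s *\<^sub>R ?y))\<^sup>2)
        \<le> ennreal 2 * ennreal ((u (ep i \<tau>))\<^sup>2) + ennreal (8 * \<rho>'\<^sup>2 * (1 - a)) * ?K i \<tau>"
      if s: "0 < s" "s < 1" "a \<le> s" for s
    proof -
      \<comment> \<open>G lacks the polar weight and H carries it. Since the value at s is estimated
        by data farther out, where r \<ge> s, the weight s in front of G is dominated: s G \<le>
        H.\<close>
      define G where "G = (LINT r:{s..1}|lborel. ?g (c + r *\<^sub>R ?y))"
      define H where "H = (LINT r:{s..1}|lborel. r * ?g (c + r *\<^sub>R ?y))"
      have H0: "0 \<le> H" unfolding H_def set_lebesgue_integral_def
        using s by (intro Bochner_Integration.integral_nonneg) (auto simp: indicator_def)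
      have "(LINT r:{s..1}|lborel. (h' r)\<^sup>2) \<le> 4 * \<rho>'\<^sup>2 * G"
      proof -
        have "(h' r)\<^sup>2 \<le> 4 * \<rho>'\<^sup>2 * ?g (c + r *\<^sub>R ?y)" for r
        proof -
          have "\<bar>h' r\<bar> \<le> norm (grad u (c + r *\<^sub>R ?y)) * norm ?y"
            unfolding h'_def by (rule Cauchy_Schwarz_ineq2)
          also have "\<dots> \<le> norm (grad u (c + r *\<^sub>R ?y)) * (2 * \<rho>')"
            using y by (intro mult_left_mono) auto
          finally have "\<bar>h' r\<bar>\<^sup>2 \<le> (norm (grad u (c + r *\<^sub>R ?y)) * (2 * \<rho>'))\<^sup>2" by (intro power_mono) auto
          then show ?thesis by (simp add: power_mult_distrib mult_ac)
        qed
        then have "(LINT r:{s..1}|lborel. (h' r)\<^sup>2) \<le> (LINT r:{s..1}|lborel. 4 * \<rho>'\<^sup>2 * ?g (c + r *\<^sub>R ?y))"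
          using gi by (intro set_integral_mono) (auto simp: set_integrable_def mult.left_commute[of _ "4 * _"] 
              intro!: integrable_mult_right)
        then show ?thesis by (simp add: G_def)
      qed
      then have "(u (c + s *\<^sub>R ?y))\<^sup>2 \<le> 2 * (u (ep i \<tau>))\<^sup>2 + 2 * (1 - s) * (4 * \<rho>'\<^sup>2 * G)"
        using ray_estimate[of s "\<lambda>r. u (c + r *\<^sub>R ?y)" h', OF _ d h'c] s
        by (simp) (smt (verit) mult_left_mono)
      then have "s * (u (c + s *\<^sub>R ?y))\<^sup>2 \<le> s * (2 * (u (ep i \<tau>))\<^sup>2 + 2 * (1 - s) * (4 * \<rho>'\<^sup>2 * G))"
        using s by (intro mult_left_mono) auto
      also have "\<dots> = s * (2 * (u (ep i \<tau>))\<^sup>2) + 8 * \<rho>'\<^sup>2 * (1 - s) * (s * G)" by (simp add: algebra_simps)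
      also have "\<dots> \<le> 1 * (2 * (u (ep i \<tau>))\<^sup>2) + 8 * \<rho>'\<^sup>2 * (1 - a) * H"
      proof (intro add_mono mult_mono)
        have "s * G = (LINT r:{s..1}|lborel. s * ?g (c + r *\<^sub>R ?y))" by (simp add: G_def)
        also have "\<dots> \<le> H" unfolding H_def
          using gi s by (intro set_integral_mono) (auto simp: set_integrable_def mult.left_commute[of _ s] 
              intro!: integrable_mult_right mult_right_mono)
        finally show "s * G \<le> H" .
        show "0 \<le> s * G" unfolding G_def set_lebesgue_integral_def
          using s by (intro mult_nonneg_nonneg Bochner_Integration.integral_nonneg) (auto simp: indicator_def)
      qed (use s a in auto)
      finally have "ennreal (s * (u (c + s *\<^sub>R ?y))\<^sup>2) \<le> ennreal (2 * (u (ep i \<tau>))\<^sup>2 + 8 * \<rho>'\<^sup>2 * (1 - a) * H)"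
        by (intro ennreal_leI) simp
      also have "\<dots> = ennreal 2 * ennreal ((u (ep i \<tau>))\<^sup>2) + ennreal (8 * \<rho>'\<^sup>2 * (1 - a)) * ennreal H"
      proof -
        have n: "0 \<le> 2 * (u (ep i \<tau>))\<^sup>2" "0 \<le> 8 * \<rho>'\<^sup>2 * (1 - a)" using a by simp_all
        have "ennreal (2 * (u (ep i \<tau>))\<^sup>2) = ennreal 2 * ennreal ((u (ep i \<tau>))\<^sup>2)"
          by (rule ennreal_mult) simp_all
        moreover have "ennreal (8 * \<rho>'\<^sup>2 * (1 - a) * H) = ennreal (8 * \<rho>'\<^sup>2 * (1 - a)) * ennreal H"
          by (rule ennreal_mult[OF n(2) H0])
        moreover have "0 \<le> 8 * \<rho>'\<^sup>2 * (1 - a) * H" by (rule mult_nonneg_nonneg[OF n(2) H0])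
        ultimately show ?thesis using n(1) by (simp only: ennreal_plus)
      qed
      also have "ennreal H \<le> ?K i \<tau>"
      proof -
        have "ennreal H = (\<integral>\<^sup>+r. ennreal (indicator {s..1} r *\<^sub>R (r * ?g (c + r *\<^sub>R ?y))) \<partial>lborel)"
          unfolding H_def set_lebesgue_integral_def
          using gi(1)[of s] s by (intro nn_integral_eq_integral[symmetric]) (auto simp: indicator_def)
        also have "\<dots> \<le> ?K i \<tau>"
        proof (rule nn_integral_mono_AE)
          have "AE r in lborel. r \<noteq> (1::real)" by (rule AE_lborel_singleton)
          then show "AE r in lborel. ennreal (indicator {s..1} r *\<^sub>R (r * ?g (c + r *\<^sub>R ?y)))
              \<le> ennreal r * ennreal (?g (c + r *\<^sub>R ?y)) * indicator ({0<..<1} \<inter> {a..}) r"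
            by (rule eventually_mono) (use s in \<open>auto simp: indicator_def ennreal_mult\<close>)
        qed
        finally show ?thesis .
      qed
      finally show ?thesis using s by (simp add: ennreal_mult add_left_mono mult_left_mono)
    qed
    have "(\<integral>\<^sup>+s\<in>{0<..<1} \<inter> {a..}. ennreal s * ennreal ((u (c + s *\<^sub>R ?y))\<^sup>2) \<partial>lborel)
        \<le> (\<integral>\<^sup>+s. (ennreal 2 * ennreal ((u (ep i \<tau>))\<^sup>2) + ennreal (8 * \<rho>'\<^sup>2 * (1 - a)) * ?K i \<tau>) * indicator {a..<1} s \<partial>lborel)"
      by (rule nn_integral_mono) (use pt in \<open>auto simp: indicator_def\<close>)
    also have "\<dots> = (ennreal 2 * ennreal ((u (ep i \<tau>))\<^sup>2) + ennreal (8 * \<rho>'\<^sup>2 * (1 - a)) * ?K i \<tau>) * ennreal (1 - a)"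
      using a by (subst nn_integral_cmult_indicator) auto
    also have "\<dots> = ennreal (2 * (1 - a)) * ennreal ((u (ep i \<tau>))\<^sup>2) + ennreal (8 * \<rho>'\<^sup>2 * (1 - a)\<^sup>2) * ?K i \<tau>"
    proof -
      have "ennreal (2 * (1 - a)) = ennreal 2 * ennreal (1 - a)"
        using a by (intro ennreal_mult) simp_all
      moreover have "ennreal (8 * \<rho>'\<^sup>2 * (1 - a)\<^sup>2) = ennreal (8 * \<rho>'\<^sup>2 * (1 - a)) * ennreal (1 - a)"
        using a by (subst ennreal_mult[symmetric]) (simp_all add: power2_eq_square)
      ultimately show ?thesis by (simp only: distrib_left distrib_right mult_ac)
    qed
    finally show ?thesis .
  qed
  have "(\<integral>\<^sup>+x\<in>strip a. ennreal ((u x)\<^sup>2) \<partial>lborel) = (\<Sum>i<length vs. ennreal (D i) *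
     (\<integral>\<^sup>+\<tau>\<in>{0..<1}. (\<integral>\<^sup>+s\<in>{0<..<1} \<inter> {a..}. ennreal s * ennreal ((u (c + s *\<^sub>R (ep i \<tau> - c)))\<^sup>2) \<partial>lborel) \<partial>lborel))"
    by (rule nn_integral_strip[OF _ a(1)]) measurable
  also have "\<dots> \<le> (\<Sum>i<length vs. ennreal (D i) *
     (\<integral>\<^sup>+\<tau>\<in>{0..<1}. (ennreal (2 * (1 - a)) * ennreal ((u (ep i \<tau>))\<^sup>2) + ennreal (8 * \<rho>'\<^sup>2 * (1 - a)\<^sup>2) * ?K i \<tau>) \<partial>lborel))"
    using inner by (intro sum_mono mult_left_mono nn_integral_mono) (auto simp: indicator_def)
  also have "\<dots> = (\<Sum>i<length vs. ennreal (D i) *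
     (ennreal (2 * (1 - a)) * (\<integral>\<^sup>+\<tau>\<in>{0..<1}. ennreal ((u (ep i \<tau>))\<^sup>2) \<partial>lborel)
      + ennreal (8 * \<rho>'\<^sup>2 * (1 - a)\<^sup>2) * (\<integral>\<^sup>+\<tau>\<in>{0..<1}. ?K i \<tau> \<partial>lborel)))"
    by (simp add: distrib_right mult.assoc nn_integral_add nn_integral_cmult)
  also have "\<dots> = ennreal (2 * (1 - a)) * (\<Sum>i<length vs. ennreal (D i) * (\<integral>\<^sup>+\<tau>\<in>{0..<1}. ennreal ((u (ep i \<tau>))\<^sup>2) \<partial>lborel))
     + ennreal (8 * \<rho>'\<^sup>2 * (1 - a)\<^sup>2) * (\<Sum>i<length vs. ennreal (D i) * (\<integral>\<^sup>+\<tau>\<in>{0..<1}. ?K i \<tau> \<partial>lborel))"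
    by (simp add: distrib_left sum.distrib sum_distrib_left mult_ac)
  also have "(\<Sum>i<length vs. ennreal (D i) * (\<integral>\<^sup>+\<tau>\<in>{0..<1}. ?K i \<tau> \<partial>lborel))
      = (\<integral>\<^sup>+x\<in>strip a. ennreal (?g x) \<partial>lborel)"
    by (rule nn_integral_strip[OF _ a(1), symmetric]) measurable
  finally show ?thesis .
qed

end

text \<open>Chosen once for all sets and scales, so that the final constant can be written as a
  closed function of the ratio of the radii.\<close>

definition cutoff_const :: real where
  "cutoff_const = (SOME \<kappa>. 0 < \<kappa> \<and> (\<forall>A \<epsilon>. bounded A \<longrightarrow> A \<in> sets borel \<longrightarrow> 0 < \<epsilon> \<longrightarrow> (\<exists>\<psi>. cutoff_family \<kappa> A \<epsilon> \<psi>)))"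

lemma cutoff_const:
  "0 < cutoff_const"
  "bounded A \<Longrightarrow> A \<in> sets borel \<Longrightarrow> 0 < \<epsilon> \<Longrightarrow> \<exists>\<psi>. cutoff_family cutoff_const A \<epsilon> \<psi>"
proof -
  have "\<exists>\<kappa>. 0 < \<kappa> \<and> (\<forall>A \<epsilon>. bounded A \<longrightarrow> A \<in> sets borel \<longrightarrow> 0 < \<epsilon> \<longrightarrow> (\<exists>\<psi>. cutoff_family \<kappa> A \<epsilon> \<psi>))"
    using ex_cutoff by metis
  from someI_ex[OF this]
  have *: "0 < cutoff_const \<and> (\<forall>A \<epsilon>. bounded A \<longrightarrow> A \<in> sets borel \<longrightarrow> 0 < \<epsilon> \<longrightarrow> (\<exists>\<psi>. cutoff_family cutoff_const A \<epsilon> \<psi>))"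
    unfolding cutoff_const_def .
  show "0 < cutoff_const" using * by simp
  show "bounded A \<Longrightarrow> A \<in> sets borel \<Longrightarrow> 0 < \<epsilon> \<Longrightarrow> \<exists>\<psi>. cutoff_family cutoff_const A \<epsilon> \<psi>" using * by simp
qed

text \<open>Lagrange's identity: the squares of determinant and inner product add up to |P|^2
  |Q|^2.\<close>

lemma abs_det2_le: "\<bar>det2 P Q\<bar> \<le> norm P * norm Q"
proof -
  have "(det2 P Q)\<^sup>2 + (P \<bullet> Q)\<^sup>2 = (norm P * norm Q)\<^sup>2"
    by (simp add: power_mult_distrib power2_norm_eq_inner inner_vec_def sum_2 det2_def) algebra
  then have "(det2 P Q)\<^sup>2 \<le> (norm P * norm Q)\<^sup>2" using zero_le_power2[of "P \<bullet> Q"] by linarith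
  then show ?thesis by (rule abs_le_square_iff[THEN iffD2, THEN order_trans]) simp
qed

section \<open>Integrals over the boundary and over the domain\<close>

lemma sets_boundary_measure [simp]: "sets (boundary_measure vs) = sets (restrict_space borel (polygon_boundary vs))"
  by (simp add: boundary_measure_def)

lemma space_boundary_measure [simp]: "space (boundary_measure vs) = polygon_boundary vs"
  by (simp add: boundary_measure_def space_restrict_space)

lemma measurable_boundary_measure: "borel_measurable (boundary_measure vs) = borel_measurable (restrict_space borel (polygon_boundary vs))"
  by (rule measurable_cong_sets) simp_all

lemma finite_measure_boundary: "finite_measure (boundary_measure vs)"
proof
  have "emeasure (boundary_measure vs) (space (boundary_measure vs)) = (\<integral>\<^sup>+x. 1 \<partial>boundary_measure vs)"
    by simp
  also have "\<dots> = (\<Sum>i<length vs. ennreal (dist (vs ! i) (next_vertex vs i)) * (\<integral>\<^sup>+t\<in>{0..1::real}. 1 \<partial>lborel))"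
    by (rule nn_integral_boundary_measure) simp
  also have "\<dots> = (\<Sum>i<length vs. ennreal (dist (vs ! i) (next_vertex vs i)))" by simp
  also have "\<dots> < \<infinity>" by simp
  finally show "emeasure (boundary_measure vs) (space (boundary_measure vs)) \<noteq> \<infinity>" by simp
qed

lemma continuous_boundary_integrable:
  assumes "continuous_on UNIV (f :: real^2 \<Rightarrow> real)"
  shows "integrable (boundary_measure vs) f"
proof -
  interpret finite_measure "boundary_measure vs" by (rule finite_measure_boundary)
  have "bounded (f ` polygon_boundary vs)"
    by (intro compact_imp_bounded compact_continuous_image compact_polygon_boundary continuous_on_subset[OF assms]) simp
  then obtain B where B: "\<And>x. x \<in> polygon_boundary vs \<Longrightarrow> norm (f x) \<le> B" by (auto simp: bounded_iff)
  have "f \<in> borel_measurable (boundary_measure vs)"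
    unfolding measurable_boundary_measure
    by (intro measurable_restrict_space1 borel_measurable_continuous_onI assms)
  then show ?thesis by (intro integrable_const_bound[where B=B] AE_I2) (use B in auto)
qed

context star_polygon
begin

abbreviation M :: "(real^2) measure" where "M \<equiv> lebesgue_on E"

lemma E_lebesgue [measurable]: "E \<in> sets lebesgue" using E_borel by auto

lemma finite_measure_M: "finite_measure M"
  by (rule finite_measure_lebesgue_on) (use bd open_polygon_domain in \<open>auto intro: lmeasurable_open\<close>)

lemma continuous_integrable:
  fixes f :: "real^2 \<Rightarrow> real"
  assumes "continuous_on UNIV f"
  shows "integrable M f"
proof -
  have "set_integrable lborel E f" by (rule continuous_set_integrable_bounded[OF assms bd E_borel])
  then show ?thesis
    using E_lebesgue by (simp add: integrable_restrict_space integrable_completion set_integrable_def)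
qed

lemma borel_measurable_M: "f \<in> borel_measurable borel \<Longrightarrow> f \<in> borel_measurable M"
  by (intro measurable_restrict_space1 measurable_completion) simp

lemma nn_integral_M:
  assumes "f \<in> borel_measurable borel" "S \<in> sets borel" "S \<subseteq> E"
  shows "(\<integral>\<^sup>+x\<in>S. f x \<partial>lborel) = (\<integral>\<^sup>+x. f x * indicator S x \<partial>M)"
proof -
  have [measurable]: "f \<in> borel_measurable borel" "S \<in> sets borel" by fact+
  have "(\<integral>\<^sup>+x. f x * indicator S x \<partial>M) = (\<integral>\<^sup>+x. f x * indicator S x * indicator E x \<partial>lebesgue)"
    using E_lebesgue by (subst nn_integral_restrict_space) auto
  also have "\<dots> = (\<integral>\<^sup>+x. f x * indicator S x \<partial>lebesgue)"
    using assms(3) by (intro nn_integral_cong) (auto simp: indicator_def)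
  also have "\<dots> = (\<integral>\<^sup>+x. f x * indicator S x \<partial>lborel)"
    by (subst nn_integral_completion) auto
  finally show ?thesis by simp
qed

lemma emeasure_E_finite: "emeasure lborel E < \<infinity>" using emeasure_bounded_finite[OF bd] .

text \<open>Replacing Q by Q - P leaves the determinant unchanged, so the Jacobian is at most |P|
  times the edge length. This converts integrals over edge parameters into integrals for
  \<open>boundary_measure\<close>.\<close>

lemma D_le: "i < length vs \<Longrightarrow> D i \<le> 2 * \<rho>' * dist (vs ! i) (next_vertex vs i)"
proof -
  assume i: "i < length vs"
  have "det2 (P i) (Q i) = det2 (P i) (Q i - P i)" by (simp add: det2_def algebra_simps)
  then have "D i \<le> norm (P i) * norm (Q i - P i)" unfolding D_def using abs_det2_le by simp
  moreover have "norm (P i) \<le> 2 * \<rho>'"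
    using ep_frontier[OF i, of 0] dist_centre[of "vs ! i"] by (simp add: P_def ep_def frontier_def)
  moreover have "norm (Q i - P i) = dist (vs ! i) (next_vertex vs i)"
    by (simp add: P_def Q_def dist_norm norm_minus_commute)
  ultimately show ?thesis by (smt (verit) mult_right_mono norm_ge_zero)
qed

text \<open>The polar formula for the constant 1, with radial integral 1/2. It charges constant
  boundary bounds to the area of E and not to its perimeter.\<close>

lemma sum_D: "(\<Sum>i<length vs. ennreal (D i)) = 2 * emeasure lborel E"
proof -
  have h: "(\<integral>\<^sup>+s\<in>{0<..<1}. ennreal s * 1 \<partial>lborel) = ennreal (1 / 2)"
  proof -
    have "(\<integral>\<^sup>+s\<in>{0<..<1}. ennreal s * 1 \<partial>lborel) = (\<integral>\<^sup>+s\<in>{0..1}. ennreal s \<partial>lborel)"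
    proof (rule nn_integral_cong_AE)
      have "AE s in lborel. s \<noteq> (0::real)" "AE s in lborel. s \<noteq> (1::real)" by (rule AE_lborel_singleton)+
      then show "AE s in lborel. ennreal s * 1 * indicator {0<..<1} s = ennreal s * indicator {0..1} s"
        by eventually_elim (auto simp: indicator_def)
    qed
    also have "\<dots> = ennreal (1\<^sup>2 / 2 - 0\<^sup>2 / 2)"
      by (rule nn_integral_FTC_Icc) (auto intro!: derivative_eq_intros)
    finally show ?thesis by simp
  qed
  have "emeasure lborel E = (\<integral>\<^sup>+x\<in>E. 1 \<partial>lborel)" by simp
  also have "\<dots> = (\<Sum>i<length vs. ennreal (D i) * (\<integral>\<^sup>+\<tau>\<in>{0..<1::real}. (\<integral>\<^sup>+s\<in>{0<..<1}. ennreal s * 1 \<partial>lborel) \<partial>lborel))"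
    by (rule nn_integral_polar) simp
  also have "\<dots> = (\<Sum>i<length vs. ennreal (D i) * ennreal (1 / 2))"
  proof -
    have "(\<integral>\<^sup>+\<tau>\<in>{0..<1::real}. ennreal (1 / 2) \<partial>lborel) = ennreal (1 / 2)"
      by (subst nn_integral_cmult_indicator) auto
    then show ?thesis unfolding h by (simp only:)
  qed
  also have "\<dots> = (\<Sum>i<length vs. ennreal (D i)) * ennreal (1 / 2)" by (simp add: sum_distrib_right)
  finally have "2 * emeasure lborel E = (\<Sum>i<length vs. ennreal (D i)) * (ennreal (1 / 2) * 2)" by (simp add: mult_ac)
  also have "ennreal (1 / 2) * 2 = ennreal (1 / 2 * 2)" by (subst ennreal_mult) auto
  finally show ?thesis by simp
qed

text \<open>The boundary bound is split: \<open>b\<close> is paid by arc length through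
  \<open>D_le\<close>, the constant K by area through \<open>sum_D\<close>. In the applications
  \<open>b\<close> is zero or a multiple of the squared distance to the trace, which disappears in
  the limit.\<close>

lemma strip_estimate_real:
  assumes u: "smooth u" and a: "0 \<le> a" "a < 1"
    and b: "integrable (boundary_measure vs) b" "\<And>x. 0 \<le> b x" and K: "0 \<le> K"
    and ub: "AE x in boundary_measure vs. (u x)\<^sup>2 \<le> b x + K"
  shows "(LINT x|M. indicator (strip a) x * (u x)\<^sup>2) \<le>
    4 * \<rho>' * (1 - a) * (LINT x|boundary_measure vs. b x) + 4 * (1 - a) * K * measure lborel E
    + 8 * \<rho>'\<^sup>2 * (1 - a)\<^sup>2 * (LINT x|M. indicator (strip a) x * (norm (grad u x))\<^sup>2)"
proof -
  let ?g = "\<lambda>x. (norm (grad u x))\<^sup>2"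
  have cu: "continuous_on UNIV (\<lambda>x. (u x)\<^sup>2)" and cg: "continuous_on UNIV ?g"
    using u by (auto intro!: smooth_continuous continuous_intros continuous_grad)
  have um: "(\<lambda>x. (u x)\<^sup>2) \<in> borel_measurable borel" and gm: "?g \<in> borel_measurable borel"
    using cu cg by (auto intro: borel_measurable_continuous_onI)
  have strip_M: "strip a \<in> sets M"
    using strip_borel[of a] strip_subset E_lebesgue by (subst sets_restrict_space_iff) auto
  have int_strip: "ennreal (LINT x|M. indicator (strip a) x * f x) = (\<integral>\<^sup>+x\<in>strip a. ennreal (f x) \<partial>lborel)"
    if f: "continuous_on UNIV f" "\<And>x. 0 \<le> f x" for f
  proof -
    have "integrable M (\<lambda>x. indicator (strip a) x *\<^sub>R f x)"
      by (rule integrable_mult_indicator[OF strip_M continuous_integrable[OF f(1)]])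
    then have "ennreal (LINT x|M. indicator (strip a) x * f x) = (\<integral>\<^sup>+x. ennreal (indicator (strip a) x * f x) \<partial>M)"
      using f(2) by (intro nn_integral_eq_integral[symmetric]) auto
    also have "\<dots> = (\<integral>\<^sup>+x. ennreal (f x) * indicator (strip a) x \<partial>M)"
      by (intro nn_integral_cong) (auto simp: indicator_def)
    also have "\<dots> = (\<integral>\<^sup>+x\<in>strip a. ennreal (f x) \<partial>lborel)"
      using strip_subset f by (intro nn_integral_M[symmetric] strip_borel) (auto intro: borel_measurable_continuous_onI)
    finally show ?thesis .
  qed
  \<comment> \<open>The bound on u^2 holds only almost everywhere for the boundary measure, while
    the edge integrals are compared pointwise. This majorant makes it hold everywhere and equals
    \<open>b\<close> almost everywhere.\<close>
  define b' where "b' x = max (b x) ((u x)\<^sup>2 - K)" for x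
  have b'm: "(\<lambda>x. ennreal (b' x)) \<in> borel_measurable (restrict_space borel (polygon_boundary vs))"
  proof -
    have "b \<in> borel_measurable (restrict_space borel (polygon_boundary vs))"
      using borel_measurable_integrable[OF b(1)] unfolding measurable_boundary_measure .
    moreover have "(\<lambda>x. (u x)\<^sup>2) \<in> borel_measurable (restrict_space borel (polygon_boundary vs))"
      by (rule measurable_restrict_space1[OF um])
    ultimately show ?thesis unfolding b'_def by simp
  qed
  have b'0: "0 \<le> b' x" for x using b(2) by (simp add: b'_def le_max_iff_disj)
  have epm: "(\<lambda>\<tau>. ennreal (b' (ep i \<tau>)) * indicator {0..<1} \<tau>) \<in> borel_measurable borel" if i: "i < length vs" for i
  proof -
    have "(\<lambda>\<tau>. ep i \<tau>) \<in> restrict_space borel {0..<1} \<rightarrow>\<^sub>M restrict_space borel (polygon_boundary vs)"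
    proof (rule measurable_restrict_space2)
      show "ep i \<in> space (restrict_space borel {0..<1}) \<rightarrow> polygon_boundary vs"
        using ep_frontier[OF i] unfolding frontier_E by (auto simp: space_restrict_space)
      have "continuous_on UNIV (ep i)" unfolding ep_def by (intro continuous_intros)
      then show "ep i \<in> restrict_space borel {0..<1} \<rightarrow>\<^sub>M borel"
        by (intro measurable_restrict_space1 borel_measurable_continuous_onI)
    qed
    from measurable_compose[OF this b'm]
    show ?thesis by (subst (asm) borel_measurable_restrict_space_iff_ennreal) (auto simp: mult.commute)
  qed
  have "(\<Sum>i<length vs. ennreal (D i) * (\<integral>\<^sup>+\<tau>\<in>{0..<1}. ennreal ((u (ep i \<tau>))\<^sup>2) \<partial>lborel))
      \<le> (\<Sum>i<length vs. ennreal (2 * \<rho>') * (ennreal (dist (vs ! i) (next_vertex vs i)) *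
          (\<integral>\<^sup>+\<tau>\<in>{0..1}. ennreal (b' (ep i \<tau>)) \<partial>lborel)) + ennreal (D i) * ennreal K)"
  proof (rule sum_mono)
    fix i assume "i \<in> {..<length vs}"
    then have i: "i < length vs" by simp
    have "(\<integral>\<^sup>+\<tau>\<in>{0..<1}. ennreal ((u (ep i \<tau>))\<^sup>2) \<partial>lborel)
        \<le> (\<integral>\<^sup>+\<tau>. ennreal (b' (ep i \<tau>)) * indicator {0..<1} \<tau> + ennreal K * indicator {0..<1} \<tau> \<partial>lborel)"
    proof (rule nn_integral_mono)
      fix \<tau> :: real
      have "ennreal ((u (ep i \<tau>))\<^sup>2) \<le> ennreal (b' (ep i \<tau>) + K)"
        by (rule ennreal_leI) (simp add: b'_def)
      then show "ennreal ((u (ep i \<tau>))\<^sup>2) * indicator {0..<1} \<tau> \<le>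
          ennreal (b' (ep i \<tau>)) * indicator {0..<1} \<tau> + ennreal K * indicator {0..<1} \<tau>"
        using b'0 K by (auto simp: indicator_def)
    qed
    also have "\<dots> = (\<integral>\<^sup>+\<tau>\<in>{0..<1}. ennreal (b' (ep i \<tau>)) \<partial>lborel) + ennreal K"
      using epm[OF i] by (subst nn_integral_add) (auto simp: nn_integral_cmult_indicator)
    finally have "ennreal (D i) * (\<integral>\<^sup>+\<tau>\<in>{0..<1}. ennreal ((u (ep i \<tau>))\<^sup>2) \<partial>lborel)
        \<le> ennreal (D i) * ((\<integral>\<^sup>+\<tau>\<in>{0..<1}. ennreal (b' (ep i \<tau>)) \<partial>lborel) + ennreal K)"
      by (intro mult_left_mono) auto
    also have "\<dots> = ennreal (D i) * (\<integral>\<^sup>+\<tau>\<in>{0..<1}. ennreal (b' (ep i \<tau>)) \<partial>lborel) + ennreal (D i) * ennreal K"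
      by (simp only: distrib_left)
    also have "\<dots> \<le> ennreal (2 * \<rho>' * dist (vs ! i) (next_vertex vs i)) * (\<integral>\<^sup>+\<tau>\<in>{0..1}. ennreal (b' (ep i \<tau>)) \<partial>lborel) + ennreal (D i) * ennreal K"
      using D_le[OF i] by (intro add_right_mono mult_mono ennreal_leI nn_integral_mono) (auto simp: indicator_def)
    also have "ennreal (2 * \<rho>' * dist (vs ! i) (next_vertex vs i)) = ennreal (2 * \<rho>') * ennreal (dist (vs ! i) (next_vertex vs i))"
      using rho'_pos by (intro ennreal_mult) auto
    finally show "ennreal (D i) * (\<integral>\<^sup>+\<tau>\<in>{0..<1}. ennreal ((u (ep i \<tau>))\<^sup>2) \<partial>lborel)
      \<le> ennreal (2 * \<rho>') * (ennreal (dist (vs ! i) (next_vertex vs i)) *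
          (\<integral>\<^sup>+\<tau>\<in>{0..1}. ennreal (b' (ep i \<tau>)) \<partial>lborel)) + ennreal (D i) * ennreal K"
      by (simp only: mult.assoc)
  qed
  also have "\<dots> = ennreal (2 * \<rho>') * (\<Sum>i<length vs. ennreal (dist (vs ! i) (next_vertex vs i)) *
          (\<integral>\<^sup>+\<tau>\<in>{0..1}. ennreal (b' (ep i \<tau>)) \<partial>lborel)) + (\<Sum>i<length vs. ennreal (D i)) * ennreal K"
    by (simp only: sum.distrib sum_distrib_left sum_distrib_right)
  also have "(\<Sum>i<length vs. ennreal (dist (vs ! i) (next_vertex vs i)) * (\<integral>\<^sup>+\<tau>\<in>{0..1}. ennreal (b' (ep i \<tau>)) \<partial>lborel))
      = (\<integral>\<^sup>+x. ennreal (b' x) \<partial>boundary_measure vs)"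
    unfolding ep_def by (rule nn_integral_boundary_measure[OF b'm, symmetric])
  also have "\<dots> = (\<integral>\<^sup>+x. ennreal (b x) \<partial>boundary_measure vs)"
    by (rule nn_integral_cong_AE) (use ub in eventually_elim, auto simp: b'_def)
  also have "\<dots> = ennreal (LINT x|boundary_measure vs. b x)"
    by (rule nn_integral_eq_integral[OF b(1)]) (use b(2) in auto)
  also have "(\<Sum>i<length vs. ennreal (D i)) * ennreal K = ennreal (2 * measure lborel E * K)"
  proof -
    have "emeasure lborel E = ennreal (measure lborel E)"
      using emeasure_E_finite by (simp add: emeasure_eq_ennreal_measure less_top[symmetric])
    then show ?thesis unfolding sum_D using K by (simp add: ennreal_mult)
  qed
  also have "ennreal (2 * \<rho>') * ennreal (LINT x|boundary_measure vs. b x) + ennreal (2 * measure lborel E * K)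
     = ennreal (2 * \<rho>' * (LINT x|boundary_measure vs. b x) + 2 * measure lborel E * K)"
  proof -
    have "0 \<le> (LINT x|boundary_measure vs. b x)" using b(2) by simp
    then show ?thesis using rho'_pos K by (simp add: ennreal_mult ennreal_plus)
  qed
  finally have bdry: "(\<Sum>i<length vs. ennreal (D i) * (\<integral>\<^sup>+\<tau>\<in>{0..<1}. ennreal ((u (ep i \<tau>))\<^sup>2) \<partial>lborel))
      \<le> ennreal (2 * \<rho>' * (LINT x|boundary_measure vs. b x) + 2 * measure lborel E * K)" .
  define X where "X = 2 * \<rho>' * (LINT x|boundary_measure vs. b x) + 2 * measure lborel E * K"
  define Y where "Y = (LINT x|M. indicator (strip a) x * ?g x)"
  have X0: "0 \<le> X" unfolding X_def using rho'_pos b(2) K by simp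
  have Y0: "0 \<le> Y" unfolding Y_def by (intro Bochner_Integration.integral_nonneg) auto
  have "ennreal (LINT x|M. indicator (strip a) x * (u x)\<^sup>2) \<le> ennreal (2 * (1 - a)) * ennreal X + ennreal (8 * \<rho>'\<^sup>2 * (1 - a)\<^sup>2) * ennreal Y"
    unfolding Y_def int_strip[OF cu zero_le_power2] int_strip[OF cg zero_le_power2]
    using bdry[folded X_def] by (intro order_trans[OF strip_estimate[OF u a]] add_right_mono mult_left_mono) auto
  also have "\<dots> = ennreal (2 * (1 - a) * X + 8 * \<rho>'\<^sup>2 * (1 - a)\<^sup>2 * Y)"
  proof -
    have n: "0 \<le> 2 * (1 - a)" "0 \<le> 8 * \<rho>'\<^sup>2 * (1 - a)\<^sup>2" using a by auto
    show ?thesis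
      using ennreal_mult[OF n(1) X0] ennreal_mult[OF n(2) Y0]
        ennreal_plus[OF mult_nonneg_nonneg[OF n(1) X0] mult_nonneg_nonneg[OF n(2) Y0]] by (simp only:)
  qed
  finally have "(LINT x|M. indicator (strip a) x * (u x)\<^sup>2) \<le> 2 * (1 - a) * X + 8 * \<rho>'\<^sup>2 * (1 - a)\<^sup>2 * Y"
    using X0 Y0 a by (subst (asm) ennreal_le_iff) auto
  then show ?thesis unfolding X_def Y_def by (simp add: algebra_simps)
qed

text \<open>Three nested contractions of E: \<psi> is 1 on the copy with factor 1 - \<delta>, it
  mollifies the copy with factor 1 - \<delta>/2 at scale \<delta> \<rho> / 4, and it is supported in
  the copy with factor 1 - \<delta>/4. By \<open>star_shaped_comb\<close> the gaps between the
  copies leave room for this scale.\<close>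

lemma ex_strip_cutoff:
  assumes d: "0 < \<delta>" "\<delta> < 1"
  obtains \<psi> where "test_function E \<psi>" "\<And>x. 0 \<le> \<psi> x \<and> \<psi> x \<le> 1"
    "\<And>x. norm (grad \<psi> x) \<le> 4 * cutoff_const / (\<delta> * \<rho>)"
    "\<And>x. x \<in> E \<Longrightarrow> x \<notin> strip (1 - \<delta>) \<Longrightarrow> \<psi> x = 1 \<and> grad \<psi> x = 0"
proof -
  define t where "t = 1 - \<delta> / 2"
  define A where "A = {x. c + inverse t *\<^sub>R (x - c) \<in> E}"
  have t: "0 < t" "t < 1" using d by (auto simp: t_def)
  have AE: "A = (\<lambda>x. c + t *\<^sub>R (x - c)) ` E"
  proof
    show "A \<subseteq> (\<lambda>x. c + t *\<^sub>R (x - c)) ` E"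
    proof
      fix x assume "x \<in> A"
      then show "x \<in> (\<lambda>x. c + t *\<^sub>R (x - c)) ` E"
        using t by (intro image_eqI[of _ _ "c + inverse t *\<^sub>R (x - c)"]) (auto simp: A_def)
    qed
    show "(\<lambda>x. c + t *\<^sub>R (x - c)) ` E \<subseteq> A" using t by (auto simp: A_def)
  qed
  have "A \<in> sets borel" unfolding A_def by measurable
  moreover have "A \<subseteq> E" unfolding AE using scaled_mem t by auto
  then have "bounded A" using bd bounded_subset by blast
  moreover have e: "0 < \<delta> * \<rho> / 4" using d rho_pos by simp
  ultimately obtain \<psi> where psi: "cutoff_family cutoff_const A (\<delta> * \<rho> / 4) \<psi>"
    using cutoff_const(2) by blast
  show ?thesis
  proof (rule that)
    define s where "s = 1 - \<delta> / 4"
    have s: "0 < s" "s < 1" "t < s" using d by (auto simp: s_def t_def)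
    \<comment> \<open>Contracting the closure of E gives a compact set that still lies in E.\<close>
    define K where "K = (\<lambda>x. c + s *\<^sub>R (x - c)) ` closure E"
    show "test_function E \<psi>"
    proof (rule test_functionI)
      show "smooth \<psi>" using psi by (simp add: cutoff_family_def)
      show "compact K" unfolding K_def
        by (intro compact_continuous_image continuous_intros) (use bd in simp)
      show "K \<subseteq> E" unfolding K_def using star_shaped_closure[OF star rho] s by auto
      fix x assume "\<psi> x \<noteq> 0"
      then obtain y where y: "y \<in> A" "dist x y < \<delta> * \<rho> / 4" using psi unfolding cutoff_family_def by blast
      then obtain z where z: "z \<in> E" "y = c + t *\<^sub>R (z - c)" unfolding AE by blast
      let ?h = "inverse s *\<^sub>R (x - y)"
      have "norm (x - y) < (s - t) * \<rho>" using y(2) by (simp add: dist_norm s_def t_def)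
      then have "norm (x - y) / s < (s - t) * \<rho> / s" using s by (intro divide_strict_right_mono)
      moreover have "norm ?h = norm (x - y) / s" using s by (simp add: divide_inverse mult.commute)
      moreover have "(s - t) * \<rho> / s = (1 - t / s) * \<rho>" using s by (simp add: field_simps)
      ultimately have "norm ?h < (1 - t / s) * \<rho>" by simp
      then have "c + (t / s) *\<^sub>R (z - c) + ?h \<in> E"
        using s t by (intro star_shaped_comb[OF star z(1)]) auto
      moreover have "x = c + s *\<^sub>R ((c + (t / s) *\<^sub>R (z - c) + ?h) - c)"
      proof -
        have "s *\<^sub>R ((c + (t / s) *\<^sub>R (z - c) + ?h) - c) = t *\<^sub>R (z - c) + (x - y)"
          using s by (simp add: scaleR_add_right)
        then show ?thesis using z(2) by simp
      qed
      ultimately show "x \<in> K" unfolding K_def using closure_subset by blast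
    qed
    show "0 \<le> \<psi> x \<and> \<psi> x \<le> 1" for x using psi by (simp add: cutoff_family_def)
    show "norm (grad \<psi> x) \<le> 4 * cutoff_const / (\<delta> * \<rho>)" for x
    proof -
      have "norm (grad \<psi> x) \<le> cutoff_const / (\<delta> * \<rho> / 4)" using psi by (simp add: cutoff_family_def)
      then show ?thesis by (simp add: mult.commute)
    qed
    show "\<psi> x = 1 \<and> grad \<psi> x = 0" if x: "x \<in> E" "x \<notin> strip (1 - \<delta>)" for x
    proof -
      define z where "z = c + inverse (1 - \<delta>) *\<^sub>R (x - c)"
      have z: "z \<in> E" using x d by (auto simp: strip_def z_def)
      have xz: "x = c + (1 - \<delta>) *\<^sub>R (z - c)" using d by (simp add: z_def)
      have "ball x (\<delta> * \<rho> / 4) \<subseteq> A"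
      proof
        fix y assume y: "y \<in> ball x (\<delta> * \<rho> / 4)"
        let ?h = "inverse t *\<^sub>R (y - x)"
        have "norm (y - x) < \<delta> * \<rho> / 4" using y by (simp add: dist_norm norm_minus_commute)
        also have "\<dots> < (t - (1 - \<delta>)) * \<rho>" using d rho_pos by (simp add: t_def field_simps)
        finally have "norm (y - x) / t < (t - (1 - \<delta>)) * \<rho> / t" using t by (intro divide_strict_right_mono)
        moreover have "norm ?h = norm (y - x) / t" using t by (simp add: divide_inverse mult.commute)
        moreover have "(t - (1 - \<delta>)) * \<rho> / t = (1 - (1 - \<delta>) / t) * \<rho>" using t by (simp add: field_simps)
        ultimately have "norm ?h < (1 - (1 - \<delta>) / t) * \<rho>" by simp
        then have "c + ((1 - \<delta>) / t) *\<^sub>R (z - c) + ?h \<in> E"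
          using d t by (intro star_shaped_comb[OF star z]) (auto simp: t_def)
        moreover have "inverse t *\<^sub>R (y - c) = ((1 - \<delta>) / t) *\<^sub>R (z - c) + ?h"
        proof -
          have "inverse t *\<^sub>R (y - c) = inverse t *\<^sub>R (x - c) + ?h" by (simp add: scaleR_diff_right)
          also have "inverse t *\<^sub>R (x - c) = ((1 - \<delta>) / t) *\<^sub>R (z - c)" 
            unfolding xz by (simp add: divide_inverse mult.commute)
          finally show ?thesis .
        qed
        ultimately show "y \<in> A" by (simp add: A_def add.assoc)
      qed
      then have "\<psi> x = 1" using psi by (simp add: cutoff_family_def)
      then show ?thesis using cutoff_grad_eq_0[OF psi] by blast
    qed
  qed
qed

end

section \<open>The energy estimate\<close>

lemma integrable_inner_of_squares:
  fixes f g :: "'a \<Rightarrow> 'b::euclidean_space"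
  assumes "f \<in> borel_measurable M" "g \<in> borel_measurable M"
    "integrable M (\<lambda>x. (norm (f x))\<^sup>2)" "integrable M (\<lambda>x. (norm (g x))\<^sup>2)"
  shows "integrable M (\<lambda>x. f x \<bullet> g x)"
proof (rule Bochner_Integration.integrable_bound)
  show "integrable M (\<lambda>x. (norm (f x))\<^sup>2 + (norm (g x))\<^sup>2)" using assms by simp
  have "\<bar>f x \<bullet> g x\<bar> \<le> (norm (f x))\<^sup>2 + (norm (g x))\<^sup>2" for x
  proof -
    have "\<bar>f x \<bullet> g x\<bar> \<le> norm (f x) * norm (g x)" by (rule Cauchy_Schwarz_ineq2)
    also have "\<dots> \<le> 2 * (norm (f x) * norm (g x))" by simp
    also have "\<dots> \<le> (norm (f x))\<^sup>2 + (norm (g x))\<^sup>2"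
      using sum_squares_bound[of "norm (f x)" "norm (g x)"] by (simp add: mult.assoc)
    finally show ?thesis .
  qed
  then show "AE x in M. norm (f x \<bullet> g x) \<le> norm ((norm (f x))\<^sup>2 + (norm (g x))\<^sup>2)" by simp
qed (use assms in measurable)

lemma norm_diff_square_le: "(norm (a - b))\<^sup>2 \<le> 2 * (norm a)\<^sup>2 + 2 * (norm (b::'a::real_inner))\<^sup>2"
proof -
  have "0 \<le> (norm (a + b))\<^sup>2" by simp
  then show ?thesis by (simp add: power2_norm_eq_inner inner_simps inner_commute)
qed

lemma integrable_norm_diff_square:
  fixes f g :: "'a \<Rightarrow> 'b::euclidean_space"
  assumes "f \<in> borel_measurable M" "g \<in> borel_measurable M"
    "integrable M (\<lambda>x. (norm (f x))\<^sup>2)" "integrable M (\<lambda>x. (norm (g x))\<^sup>2)"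
  shows "integrable M (\<lambda>x. (norm (f x - g x))\<^sup>2)"
proof (rule Bochner_Integration.integrable_bound)
  show "integrable M (\<lambda>x. 2 * (norm (f x))\<^sup>2 + 2 * (norm (g x))\<^sup>2)" using assms by simp
qed (use assms norm_diff_square_le in \<open>auto\<close>)

lemma L2_tendsto_inner:
  fixes g :: "'a \<Rightarrow> real"
  assumes h: "square_integrable M h" and g: "square_integrable M g" and gn: "\<And>n. square_integrable M (gn n)"
    and lim: "(\<lambda>n. LINT x|M. (gn n x - g x)\<^sup>2) \<longlonglongrightarrow> 0"
  shows "(\<lambda>n. LINT x|M. h x * gn n x) \<longlonglongrightarrow> (LINT x|M. h x * g x)"
proof -
  have m: "h \<in> borel_measurable M" "g \<in> borel_measurable M" "\<And>n. gn n \<in> borel_measurable M"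
    "integrable M (\<lambda>x. (h x)\<^sup>2)" "integrable M (\<lambda>x. (g x)\<^sup>2)" "\<And>n. integrable M (\<lambda>x. (gn n x)\<^sup>2)"
    using h g gn by (auto simp: square_integrable_def)
  have d: "integrable M (\<lambda>x. (gn n x - g x)\<^sup>2)" for n
    using integrable_norm_diff_square[OF m(3)[of n] m(2)] m by simp
  have i1: "integrable M (\<lambda>x. h x * g x)" using integrable_inner_of_squares[OF m(1,2)] m by simp
  have i2: "integrable M (\<lambda>x. h x * gn n x)" for n using integrable_inner_of_squares[OF m(1) m(3)[of n]] m by simp
  have i3: "integrable M (\<lambda>x. h x * (gn n x - g x))" for n
    using i1 i2 by (simp add: right_diff_distrib)
  have bound: "\<bar>(LINT x|M. h x * gn n x) - (LINT x|M. h x * g x)\<bar>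
      \<le> sqrt ((LINT x|M. (h x)\<^sup>2) * (LINT x|M. (gn n x - g x)\<^sup>2))" for n
  proof -
    have "(LINT x|M. h x * gn n x) - (LINT x|M. h x * g x) = (LINT x|M. h x * (gn n x - g x))"
      using i1 i2 by (simp add: right_diff_distrib)
    then have "\<bar>(LINT x|M. h x * gn n x) - (LINT x|M. h x * g x)\<bar>\<^sup>2
        \<le> (LINT x|M. (h x)\<^sup>2) * (LINT x|M. (gn n x - g x)\<^sup>2)"
      using integral_Cauchy_Schwarz[OF m(4) d[of n] i3[of n]] unfolding power2_abs by simp
    then show ?thesis by (rule real_le_rsqrt)
  qed
  have "(\<lambda>n. sqrt ((LINT x|M. (h x)\<^sup>2) * (LINT x|M. (gn n x - g x)\<^sup>2))) \<longlonglongrightarrow> sqrt ((LINT x|M. (h x)\<^sup>2) * 0)"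
    by (intro tendsto_intros lim)
  then have "(\<lambda>n. (LINT x|M. h x * gn n x) - (LINT x|M. h x * g x)) \<longlonglongrightarrow> 0"
    unfolding mult_zero_right real_sqrt_zero
    by (rule Lim_null_comparison[rotated]) (use bound in \<open>simp add: always_eventually\<close>)
  then show ?thesis by (simp add: LIM_zero_iff)
qed

text \<open>Expand the square around g; the cross term converges by \<open>L2_tendsto_inner\<close>
  with h = g.\<close>

lemma L2_tendsto_square:
  fixes g :: "'a \<Rightarrow> real"
  assumes g: "square_integrable M g" and gn: "\<And>n. square_integrable M (gn n)"
    and lim: "(\<lambda>n. LINT x|M. (gn n x - g x)\<^sup>2) \<longlonglongrightarrow> 0"
  shows "(\<lambda>n. LINT x|M. (gn n x)\<^sup>2) \<longlonglongrightarrow> (LINT x|M. (g x)\<^sup>2)"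
proof -
  have m: "g \<in> borel_measurable M" "\<And>n. gn n \<in> borel_measurable M"
    "integrable M (\<lambda>x. (g x)\<^sup>2)" "\<And>n. integrable M (\<lambda>x. (gn n x)\<^sup>2)"
    using g gn by (auto simp: square_integrable_def)
  have d: "integrable M (\<lambda>x. (gn n x - g x)\<^sup>2)" for n
    using integrable_norm_diff_square[OF m(2)[of n] m(1)] m by simp
  have i2: "integrable M (\<lambda>x. g x * gn n x)" for n using integrable_inner_of_squares[OF m(1) m(2)[of n]] m by simp
  have eq: "(LINT x|M. (gn n x)\<^sup>2) = (LINT x|M. (gn n x - g x)\<^sup>2) + 2 * (LINT x|M. g x * gn n x) - (LINT x|M. (g x)\<^sup>2)" for n
  proof -
    have "(LINT x|M. (gn n x)\<^sup>2) = (LINT x|M. (gn n x - g x)\<^sup>2 + 2 * (g x * gn n x) - (g x)\<^sup>2)"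
      by (intro Bochner_Integration.integral_cong) (auto simp: power2_eq_square algebra_simps)
    then show ?thesis using d i2 m by simp
  qed
  have "(\<lambda>n. (LINT x|M. (gn n x - g x)\<^sup>2) + 2 * (LINT x|M. g x * gn n x) - (LINT x|M. (g x)\<^sup>2))
      \<longlonglongrightarrow> 0 + 2 * (LINT x|M. g x * g x) - (LINT x|M. (g x)\<^sup>2)"
    by (intro tendsto_intros lim L2_tendsto_inner[OF g g gn lim])
  then show ?thesis unfolding eq by (simp add: power2_eq_square)
qed

section \<open>Truncations and the weak equation\<close>

lemma grad_mult:
  assumes "f differentiable at x" "g differentiable at x"
  shows "grad (\<lambda>x. f x * g x) x = f x *\<^sub>R grad g x + g x *\<^sub>R grad f x"
  using pd_mult[OF assms] by (simp add: grad_def vec_eq_iff)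

text \<open>Smoothness is expressed through compositions because \<open>smooth\<close> speaks of
  functions on the plane. The bounds on the derivative make F monotone and 1-Lipschitz, so that it
  preserves L2 convergence.\<close>

definition truncation :: "(real \<Rightarrow> real) \<Rightarrow> (real \<Rightarrow> real) \<Rightarrow> bool" where
  "truncation F F' \<longleftrightarrow> (\<forall>u. smooth u \<longrightarrow> smooth (\<lambda>x. F (u x))) \<and>
     (\<forall>t. (F has_real_derivative F' t) (at t) \<and> 0 \<le> F' t \<and> F' t \<le> 1)"

lemma truncation_lipschitz: "truncation F F' \<Longrightarrow> \<bar>F a - F b\<bar> \<le> \<bar>a - b\<bar>"
  using field_differentiable_bound[of UNIV F F' 1 a b] by (auto simp: truncation_def)

lemma grad_truncation:
  assumes "truncation F F'" "u differentiable at x"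
  shows "grad (\<lambda>x. F (u x)) x = F' (u x) *\<^sub>R grad u x"
proof (rule grad_eqI)
  have "(F has_derivative (\<lambda>h. F' (u x) * h)) (at (u x))"
    using assms(1) by (simp add: truncation_def has_field_derivative_def)
  from has_derivative_compose[OF has_derivative_grad[OF assms(2)] this]
  show "((\<lambda>x. F (u x)) has_derivative (\<lambda>h. (F' (u x) *\<^sub>R grad u x) \<bullet> h)) (at x)"
    by (simp only: inner_scaleR_left)
qed

text \<open>The field H has distributional divergence f. H is not tied to a function, so that
  gradients of smooth approximants can be compared with it.\<close>

definition weak_poisson :: "(real^2) set \<Rightarrow> (real^2 \<Rightarrow> real^2) \<Rightarrow> (real^2 \<Rightarrow> real) \<Rightarrow> bool" where
  "weak_poisson E H f \<longleftrightarrow> (\<forall>\<phi>. test_function E \<phi> \<longrightarrow>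
     (LINT x|lebesgue_on E. H x \<bullet> grad \<phi> x) = - (LINT x|lebesgue_on E. f x * \<phi> x))"

context star_polygon
begin

lemma borel_measurable_continuous_M: "continuous_on UNIV f \<Longrightarrow> f \<in> borel_measurable M"
  by (intro borel_measurable_M borel_measurable_continuous_onI)

lemma square_integrable_continuous:
  fixes f :: "real^2 \<Rightarrow> 'b::euclidean_space"
  assumes "continuous_on UNIV f" shows "square_integrable M f"
  unfolding square_integrable_def
  by (intro conjI borel_measurable_continuous_M assms continuous_integrable continuous_intros)

lemma strip_M: "strip a \<in> sets M"
  using strip_borel[of a] strip_subset E_lebesgue by (subst sets_restrict_space_iff) auto

lemma integrable_strip: "integrable M f \<Longrightarrow> integrable M (\<lambda>x. indicator (strip a) x * (f x :: real))"
  using integrable_mult_indicator[OF strip_M, of f a] by simp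

text \<open>The test function is F(u) \<psi>. Since the smooth u does not solve the equation, A
  measures its gradient against H, t its boundary values against T, and h the energy of H in the
  strip where \<psi> varies. The factor 8 \<rho>'^2 in front is the Poincare constant for
  F(u).\<close>

lemma energy_step:
  assumes u: "smooth u" and H: "square_integrable M H" and T: "square_integrable (boundary_measure vs) T"
    and wp: "weak_poisson E H f" and f: "continuous_on UNIV f"
    and F: "truncation F F'" "AE x in boundary_measure vs. F (T x) = 0"
    and d: "0 < \<delta>" "\<delta> < 1"
    and psi: "test_function E \<psi>" "\<And>x. 0 \<le> \<psi> x \<and> \<psi> x \<le> 1" "\<And>x. norm (grad \<psi> x) \<le> \<kappa>"
      "\<And>x. x \<in> E \<Longrightarrow> x \<notin> strip (1 - \<delta>) \<Longrightarrow> \<psi> x = 1 \<and> grad \<psi> x = 0"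
  defines "A \<equiv> LINT x|M. (norm (grad u x - H x))\<^sup>2"
    and "t \<equiv> LINT x|boundary_measure vs. (u x - T x)\<^sup>2"
    and "h \<equiv> LINT x|M. indicator (strip (1 - \<delta>)) x * (norm (H x))\<^sup>2"
  shows "(LINT x|M. (F (u x))\<^sup>2) \<le> 4 * \<rho>' * t + 8 * \<rho>'\<^sup>2 *
     (3 * A - 2 * (LINT x|M. (f x * \<psi> x) * F (u x)) + 3 * h + \<kappa>\<^sup>2 * (4 * \<rho>' * \<delta> * t + 8 * \<rho>'\<^sup>2 * \<delta>\<^sup>2 * (2 * A + 2 * h)))"
proof -
  let ?Fu = "\<lambda>x. F (u x)" and ?S = "strip (1 - \<delta>)"
  have Fu: "smooth ?Fu" using F(1) u by (simp add: truncation_def)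
  have sp: "smooth \<psi>" using psi(1) by (rule test_function_smooth)
  have gFu: "grad ?Fu x = F' (u x) *\<^sub>R grad u x" for x
    by (rule grad_truncation[OF F(1) smooth_differentiable[OF u]])
  define g where "g = grad ?Fu"
  have q: "0 \<le> F' s" "F' s \<le> 1" for s using F(1) by (auto simp: truncation_def)
  have gle: "(norm (g x))\<^sup>2 \<le> (norm (grad u x))\<^sup>2" for x
  proof -
    have "norm (g x) \<le> norm (grad u x)" unfolding g_def gFu using q by (simp add: mult_left_le_one_le)
    then show ?thesis by (intro power_mono) auto
  qed
  \<comment> \<open>With q = F'(u) in [0, 1] one has q^2 \<le> q. Then q |grad u|^2 is expanded
    through |grad u - H|^2, and the term - q |H|^2 is dropped.\<close>
  have gH: "(norm (g x))\<^sup>2 \<le> 2 * (g x \<bullet> H x) + (norm (grad u x - H x))\<^sup>2" for x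
  proof -
    let ?q = "F' (u x)"
    have "(norm (g x))\<^sup>2 = ?q * (?q * (norm (grad u x))\<^sup>2)"
      unfolding g_def gFu by (simp add: power_mult_distrib power2_eq_square)
    also have "\<dots> \<le> 1 * (?q * (norm (grad u x))\<^sup>2)" using q by (intro mult_right_mono) auto
    also have "\<dots> = ?q * ((norm (grad u x - H x))\<^sup>2 - (norm (H x))\<^sup>2) + 2 * (g x \<bullet> H x)"
      unfolding g_def gFu by (simp add: power2_norm_eq_inner inner_simps inner_commute algebra_simps)
    also have "\<dots> \<le> ?q * (norm (grad u x - H x))\<^sup>2 + 2 * (g x \<bullet> H x)" using q by (simp add: mult_left_mono)
    also have "\<dots> \<le> 1 * (norm (grad u x - H x))\<^sup>2 + 2 * (g x \<bullet> H x)"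
      using q by (intro add_right_mono mult_right_mono) auto
    finally show ?thesis by simp
  qed
  define \<phi> where "\<phi> = (\<lambda>x. ?Fu x * \<psi> x)"
  have tphi: "test_function E \<phi>" unfolding \<phi>_def by (rule test_function_mult[OF Fu psi(1)])
  have gphi: "grad \<phi> x = ?Fu x *\<^sub>R grad \<psi> x + \<psi> x *\<^sub>R g x" for x
    unfolding \<phi>_def g_def by (intro grad_mult smooth_differentiable Fu sp)
  have cg: "continuous_on UNIV g" "continuous_on UNIV (grad u)" "continuous_on UNIV (grad \<phi>)"
    "continuous_on UNIV ?Fu" "continuous_on UNIV \<psi>"
    unfolding g_def by (intro continuous_grad Fu u test_function_smooth[OF tphi] smooth_continuous sp)+
  have Hm: "H \<in> borel_measurable M" and Hi: "integrable M (\<lambda>x. (norm (H x))\<^sup>2)"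
    using H by (auto simp: square_integrable_def)
  have Ai: "integrable M (\<lambda>x. (norm (grad u x - H x))\<^sup>2)"
    by (intro integrable_norm_diff_square Hm Hi borel_measurable_continuous_M continuous_integrable continuous_intros cg)
  \<comment> \<open>The first term is prepared for the weak equation. Off the strip \<psi> = 1 and
    its gradient vanishes, so the cutoff errors carry the indicator of the strip.\<close>
  have pw: "(norm (g x))\<^sup>2 \<le> 2 * (H x \<bullet> grad \<phi> x) + 3 * (norm (grad u x - H x))\<^sup>2
      + 3 * (indicator ?S x * (norm (H x))\<^sup>2) + \<kappa>\<^sup>2 * (indicator ?S x * (?Fu x)\<^sup>2)" if x: "x \<in> E" for x
  proof (cases "x \<in> ?S")
    case False
    then have "\<psi> x = 1" "grad \<psi> x = 0" using psi(4) x by auto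
    then have e1: "H x \<bullet> grad \<phi> x = g x \<bullet> H x" by (simp add: gphi inner_commute)
    have "0 \<le> (norm (grad u x - H x))\<^sup>2" by simp
    moreover have e2: "indicator ?S x = (0::real)" using False by simp
    ultimately show ?thesis using gH[of x] unfolding e1 e2 mult_zero_left mult_zero_right by linarith
  next
    case True
    have "(norm (g x))\<^sup>2 = \<psi> x * (norm (g x))\<^sup>2 + (1 - \<psi> x) * (norm (g x))\<^sup>2" by (simp add: algebra_simps)
    also have "\<dots> \<le> \<psi> x * (2 * (g x \<bullet> H x) + (norm (grad u x - H x))\<^sup>2) + 1 * (norm (grad u x))\<^sup>2"
      using psi(2)[of x] gH[of x] gle[of x] by (intro add_mono mult_mono) auto
    also have "\<dots> \<le> 2 * \<psi> x * (g x \<bullet> H x) + 1 * (norm (grad u x - H x))\<^sup>2 + (norm (grad u x))\<^sup>2"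
    proof -
      have "\<psi> x * (norm (grad u x - H x))\<^sup>2 \<le> 1 * (norm (grad u x - H x))\<^sup>2"
        using psi(2)[of x] by (intro mult_right_mono) auto
      then show ?thesis by (simp add: algebra_simps)
    qed
    also have "(norm (grad u x))\<^sup>2 \<le> 2 * (norm (grad u x - H x))\<^sup>2 + 2 * (norm (H x))\<^sup>2"
      using norm_diff_square_le[of "grad u x - H x" "- H x"] by simp
    also have "2 * \<psi> x * (g x \<bullet> H x) = 2 * (H x \<bullet> grad \<phi> x) - 2 * (?Fu x * (H x \<bullet> grad \<psi> x))"
      by (simp add: gphi inner_simps inner_commute algebra_simps)
    finally have 1: "(norm (g x))\<^sup>2 \<le> 2 * (H x \<bullet> grad \<phi> x) - 2 * (?Fu x * (H x \<bullet> grad \<psi> x))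
      + 3 * (norm (grad u x - H x))\<^sup>2 + 2 * (norm (H x))\<^sup>2" by simp
    have "- 2 * (?Fu x * (H x \<bullet> grad \<psi> x)) \<le> 2 * (\<bar>?Fu x\<bar> * (norm (H x) * norm (grad \<psi> x)))"
    proof -
      have "- (?Fu x * (H x \<bullet> grad \<psi> x)) \<le> \<bar>?Fu x\<bar> * \<bar>H x \<bullet> grad \<psi> x\<bar>"
        unfolding abs_mult[symmetric] by (rule abs_ge_minus_self)
      also have "\<dots> \<le> \<bar>?Fu x\<bar> * (norm (H x) * norm (grad \<psi> x))"
        by (rule mult_left_mono[OF Cauchy_Schwarz_ineq2 abs_ge_zero])
      finally show ?thesis by linarith
    qed
    also have "\<dots> \<le> 2 * (\<bar>?Fu x\<bar> * (norm (H x) * \<kappa>))"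
      by (intro mult_left_mono psi(3)) simp_all
    \<comment> \<open>Grouping \<kappa> with F(u) in Young's inequality leaves \<kappa>^2 F(u)^2 on
      the strip; its energy part gets a factor \<delta>^2 from the strip inequality, which
      compensates a \<kappa> of order 1/\<delta>.\<close>
    also have "\<dots> = 2 * norm (H x) * (\<kappa> * \<bar>?Fu x\<bar>)" by simp
    also have "\<dots> \<le> (norm (H x))\<^sup>2 + (\<kappa> * \<bar>?Fu x\<bar>)\<^sup>2" by (rule sum_squares_bound)
    also have "(\<kappa> * \<bar>?Fu x\<bar>)\<^sup>2 = \<kappa>\<^sup>2 * (?Fu x)\<^sup>2" by (simp add: power_mult_distrib)
    finally have 2: "- 2 * (?Fu x * (H x \<bullet> grad \<psi> x)) \<le> (norm (H x))\<^sup>2 + \<kappa>\<^sup>2 * (?Fu x)\<^sup>2" .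
    have e: "indicator ?S x = (1::real)" using True by simp
    show ?thesis using 1 2 unfolding e mult_1 by linarith
  qed
  have iHphi: "integrable M (\<lambda>x. H x \<bullet> grad \<phi> x)"
    by (intro integrable_inner_of_squares Hm Hi borel_measurable_continuous_M continuous_integrable continuous_intros cg)
  have iFu: "integrable M (\<lambda>x. indicator ?S x * (?Fu x)\<^sup>2)"
    by (intro integrable_strip continuous_integrable continuous_intros cg)
  have ig: "integrable M (\<lambda>x. (norm (g x))\<^sup>2)" by (intro continuous_integrable continuous_intros cg)
  have iH: "integrable M (\<lambda>x. indicator ?S x * (norm (H x))\<^sup>2)" by (intro integrable_strip Hi)
  define s where "s = (LINT x|M. indicator ?S x * (?Fu x)\<^sup>2)"
  have "(LINT x|M. (norm (g x))\<^sup>2) \<le> (LINT x|M. 2 * (H x \<bullet> grad \<phi> x) + 3 * (norm (grad u x - H x))\<^sup>2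
      + 3 * (indicator ?S x * (norm (H x))\<^sup>2) + \<kappa>\<^sup>2 * (indicator ?S x * (?Fu x)\<^sup>2))"
    using pw by (intro integral_mono ig Bochner_Integration.integrable_add integrable_mult_right iHphi Ai iH iFu) auto
  also have "\<dots> = 2 * (LINT x|M. H x \<bullet> grad \<phi> x) + 3 * A + 3 * h + \<kappa>\<^sup>2 * s"
    unfolding A_def h_def s_def using iHphi Ai iH iFu by simp
  also have "(LINT x|M. H x \<bullet> grad \<phi> x) = - (LINT x|M. f x * \<phi> x)"
    using wp tphi unfolding weak_poisson_def by blast
  also have "(LINT x|M. f x * \<phi> x) = (LINT x|M. (f x * \<psi> x) * F (u x))"
    by (simp add: \<phi>_def mult_ac)
  finally have G: "(LINT x|M. (norm (g x))\<^sup>2) \<le> 3 * A - 2 * (LINT x|M. (f x * \<psi> x) * F (u x)) + 3 * h + \<kappa>\<^sup>2 * s"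
    by simp
  have bi: "integrable (boundary_measure vs) (\<lambda>x. (u x - T x)\<^sup>2)"
  proof -
    have "integrable (boundary_measure vs) (\<lambda>x. (norm (u x - T x))\<^sup>2)"
    proof (rule integrable_norm_diff_square)
      show "u \<in> borel_measurable (boundary_measure vs)"
        by (intro borel_measurable_integrable continuous_boundary_integrable smooth_continuous u)
      show "integrable (boundary_measure vs) (\<lambda>x. (norm (u x))\<^sup>2)"
        by (intro continuous_boundary_integrable continuous_intros smooth_continuous u)
    qed (use T in \<open>auto simp: square_integrable_def\<close>)
    then show ?thesis by simp
  qed
  \<comment> \<open>F vanishes on the trace and is 1-Lipschitz, so the boundary values of F(u) are
    controlled by u - T alone.\<close>
  have ub: "AE x in boundary_measure vs. (?Fu x)\<^sup>2 \<le> (u x - T x)\<^sup>2 + 0"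
    using F(2)
  proof eventually_elim
    case (elim x)
    have "\<bar>?Fu x\<bar> \<le> \<bar>u x - T x\<bar>" using truncation_lipschitz[OF F(1), of "u x" "T x"] elim by simp
    then show ?case by (simp add: abs_le_square_iff)
  qed
  have s_le: "s \<le> 4 * \<rho>' * \<delta> * t + 8 * \<rho>'\<^sup>2 * \<delta>\<^sup>2 * (2 * A + 2 * h)"
  proof -
    have "(LINT x|M. indicator ?S x * (norm (g x))\<^sup>2) \<le> (LINT x|M. 2 * (norm (grad u x - H x))\<^sup>2 + 2 * (indicator ?S x * (norm (H x))\<^sup>2))"
    proof (intro integral_mono integrable_strip ig Bochner_Integration.integrable_add integrable_mult_right Ai Hi)
      fix x
      have "(norm (grad u x))\<^sup>2 \<le> 2 * (norm (grad u x - H x))\<^sup>2 + 2 * (norm (H x))\<^sup>2"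
        using norm_diff_square_le[of "grad u x - H x" "- H x"] by simp
      then show "indicator ?S x * (norm (g x))\<^sup>2 \<le> 2 * (norm (grad u x - H x))\<^sup>2 + 2 * (indicator ?S x * (norm (H x))\<^sup>2)"
        using order_trans[OF gle[of x]] by (cases "x \<in> ?S") (simp_all del: power2_norm_eq_inner abs_le_square_iff)
    qed
    also have "\<dots> = 2 * A + 2 * h" unfolding A_def h_def using Ai iH by simp
    finally have "8 * \<rho>'\<^sup>2 * \<delta>\<^sup>2 * (LINT x|M. indicator ?S x * (norm (g x))\<^sup>2) \<le> 8 * \<rho>'\<^sup>2 * \<delta>\<^sup>2 * (2 * A + 2 * h)"
      by (intro mult_left_mono) auto
    then show ?thesis
      using strip_estimate_real[OF Fu _ _ bi _ _ ub, of "1 - \<delta>"] d unfolding s_def t_def g_def by simp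
  qed
  have E1: "(LINT x|M. indicator (strip 0) x * k x) = (LINT x|M. k x)" for k :: "real^2 \<Rightarrow> real"
    by (intro Bochner_Integration.integral_cong) (auto simp: strip_0)
  \<comment> \<open>The strip inequality on all of E, that is, the Poincare inequality for
    F(u).\<close>
  have "(LINT x|M. (?Fu x)\<^sup>2) \<le> 4 * \<rho>' * t + 8 * \<rho>'\<^sup>2 * (LINT x|M. (norm (g x))\<^sup>2)"
    using strip_estimate_real[OF Fu _ _ bi _ _ ub, of 0] unfolding t_def g_def E1 by simp
  also have "\<dots> \<le> 4 * \<rho>' * t + 8 * \<rho>'\<^sup>2 * (3 * A - 2 * (LINT x|M. (f x * \<psi> x) * F (u x)) + 3 * h + \<kappa>\<^sup>2 *
      (4 * \<rho>' * \<delta> * t + 8 * \<rho>'\<^sup>2 * \<delta>\<^sup>2 * (2 * A + 2 * h)))"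
  proof (intro add_left_mono mult_left_mono)
    have "\<kappa>\<^sup>2 * s \<le> \<kappa>\<^sup>2 * (4 * \<rho>' * \<delta> * t + 8 * \<rho>'\<^sup>2 * \<delta>\<^sup>2 * (2 * A + 2 * h))"
      by (rule mult_left_mono[OF s_le]) simp
    then show "(LINT x|M. (norm (g x))\<^sup>2) \<le> 3 * A - 2 * (LINT x|M. (f x * \<psi> x) * F (u x)) + 3 * h + \<kappa>\<^sup>2 *
      (4 * \<rho>' * \<delta> * t + 8 * \<rho>'\<^sup>2 * \<delta>\<^sup>2 * (2 * A + 2 * h))" using G by linarith
  qed simp
  finally show ?thesis .
qed

end

lemma truncation_square_integrable:
  assumes F: "truncation F F'" and M: "finite_measure M" and w: "square_integrable M w"
  shows "square_integrable M (\<lambda>x. F (w x))"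
proof -
  interpret finite_measure M by (rule M)
  have "continuous_on UNIV F"
  proof -
    have "(F has_real_derivative F' t) (at t)" for t using F by (simp add: truncation_def)
    then show ?thesis by (meson DERIV_isCont continuous_at_imp_continuous_on)
  qed
  then have Fm: "F \<in> borel_measurable borel" by (rule borel_measurable_continuous_onI)
  have wm: "w \<in> borel_measurable M" and wi: "integrable M (\<lambda>x. (w x)\<^sup>2)"
    using w by (auto simp: square_integrable_def)
  have m: "(\<lambda>x. F (w x)) \<in> borel_measurable M" by (rule measurable_compose[OF wm Fm])
  have b: "(F (w x))\<^sup>2 \<le> 2 * (F 0)\<^sup>2 + 2 * (w x)\<^sup>2" for x
  proof -
    have "(F (w x) - F 0)\<^sup>2 \<le> (w x)\<^sup>2"
      using truncation_lipschitz[OF F, of "w x" 0] by (simp add: abs_le_square_iff)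
    moreover have "(F (w x))\<^sup>2 \<le> 2 * (F (w x) - F 0)\<^sup>2 + 2 * (F 0)\<^sup>2"
      using zero_le_power2[of "F (w x) - 2 * F 0"] by (simp add: power2_eq_square algebra_simps)
    ultimately show ?thesis by linarith
  qed
  have "integrable M (\<lambda>x. (F (w x))\<^sup>2)"
  proof (rule Bochner_Integration.integrable_bound)
    show "integrable M (\<lambda>x. 2 * (F 0)\<^sup>2 + 2 * (w x)\<^sup>2)" using wi by simp
    show "AE x in M. norm ((F (w x))\<^sup>2) \<le> norm (2 * (F 0)\<^sup>2 + 2 * (w x)\<^sup>2)"
    proof (rule AE_I2)
      fix x
      have "0 \<le> (F (w x))\<^sup>2" by simp
      then show "norm ((F (w x))\<^sup>2) \<le> norm (2 * (F 0)\<^sup>2 + 2 * (w x)\<^sup>2)"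
        using b[of x] unfolding real_norm_def by linarith
    qed
  qed (use m in measurable)
  then show ?thesis using m by (simp add: square_integrable_def)
qed

lemma L2_truncation:
  assumes F: "truncation F F'" and g: "square_integrable M g" and gn: "\<And>n. square_integrable M (gn n)"
    and M: "finite_measure M"
    and lim: "(\<lambda>n. LINT x|M. (gn n x - g x)\<^sup>2) \<longlonglongrightarrow> 0"
  shows "(\<lambda>n. LINT x|M. (F (gn n x) - F (g x))\<^sup>2) \<longlonglongrightarrow> 0"
proof (rule Lim_null_comparison[OF _ lim], rule always_eventually, rule allI)
  fix n
  have i: "integrable M (\<lambda>x. (a x - b x)\<^sup>2)" if "square_integrable M a" "square_integrable M b" for a b :: "'a \<Rightarrow> real"
    using integrable_norm_diff_square[of a M b] that by (simp add: square_integrable_def)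
  have "(LINT x|M. (F (gn n x) - F (g x))\<^sup>2) \<le> (LINT x|M. (gn n x - g x)\<^sup>2)"
  proof (intro integral_mono i g gn truncation_square_integrable[OF F M])
    show "(F (gn n x) - F (g x))\<^sup>2 \<le> (gn n x - g x)\<^sup>2" for x
      using truncation_lipschitz[OF F] by (simp add: abs_le_square_iff)
  qed
  then show "norm (LINT x|M. (F (gn n x) - F (g x))\<^sup>2) \<le> (LINT x|M. (gn n x - g x)\<^sup>2)" by simp
qed

context star_polygon
begin

text \<open>E is open, so a slight dilation about c keeps x in E. The denominator m + 2 makes the
  width strictly less than 1 already for m = 0.\<close>

lemma eventually_not_strip:
  assumes x: "x \<in> E"
  shows "\<forall>\<^sub>F m in sequentially. x \<notin> strip (1 - inverse (real (Suc (Suc m))))"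
proof -
  have l: "(\<lambda>m. inverse (real (Suc (Suc m)))) \<longlonglongrightarrow> 0"
    using LIMSEQ_Suc[OF LIMSEQ_inverse_real_of_nat] by simp
  have "(\<lambda>m. c + inverse (1 - inverse (real (Suc (Suc m)))) *\<^sub>R (x - c)) \<longlonglongrightarrow> c + inverse (1 - 0) *\<^sub>R (x - c)"
    by (intro tendsto_intros l) simp
  then have "(\<lambda>m. c + inverse (1 - inverse (real (Suc (Suc m)))) *\<^sub>R (x - c)) \<longlonglongrightarrow> x" by simp
  from topological_tendstoD[OF this op x]
  show ?thesis
  proof eventually_elim
    case (elim m)
    have "0 < 1 - inverse (real (Suc (Suc m)))" by (simp add: field_simps)
    then show ?case using elim unfolding strip_def by simp
  qed
qed

text \<open>The indicators of the strips tend to 0 pointwise on E, and dominated convergence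
  applies.\<close>

lemma strip_integral_tendsto:
  assumes k: "integrable M k"
  shows "(\<lambda>m. LINT x|M. indicator (strip (1 - inverse (real (Suc (Suc m))))) x * (k x :: real)) \<longlonglongrightarrow> 0"
proof -
  have "(\<lambda>m. LINT x|M. indicator (strip (1 - inverse (real (Suc (Suc m))))) x * k x) \<longlonglongrightarrow> (LINT x|M. 0)"
  proof (rule integral_dominated_convergence)
    show "integrable M (\<lambda>x. norm (k x))" using k by simp
    show "AE x in M. (\<lambda>m. indicator (strip (1 - inverse (real (Suc (Suc m))))) x * k x) \<longlonglongrightarrow> 0"
    proof (rule AE_I2)
      fix x assume "x \<in> space M"
      then have "x \<in> E" by simp
      show "(\<lambda>m. indicator (strip (1 - inverse (real (Suc (Suc m))))) x * k x) \<longlonglongrightarrow> 0"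
        by (rule tendsto_eventually) (use eventually_not_strip[OF \<open>x \<in> E\<close>] in eventually_elim, simp)
    qed
    show "(\<lambda>x. indicator (strip (1 - inverse (real (Suc (Suc m))))) x * k x) \<in> borel_measurable M" for m
      using integrable_strip[OF k] by (rule borel_measurable_integrable)
    show "AE x in M. norm (indicator (strip (1 - inverse (real (Suc (Suc m))))) x * k x) \<le> norm (k x)" for m
      by (rule AE_I2) (auto simp: indicator_def)
  qed (simp_all)
  then show ?thesis by simp
qed

lemma cutoff_integral_tendsto:
  assumes k: "integrable M (k :: _ \<Rightarrow> real)"
    and psi: "\<And>m. test_function E (\<psi> m)" "\<And>m x. 0 \<le> \<psi> m x \<and> \<psi> m x \<le> 1"
      "\<And>m x. x \<in> E \<Longrightarrow> x \<notin> strip (1 - inverse (real (Suc (Suc m)))) \<Longrightarrow> \<psi> m x = 1"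
  shows "(\<lambda>m. LINT x|M. \<psi> m x * k x) \<longlonglongrightarrow> (LINT x|M. k x)"
proof (rule integral_dominated_convergence)
  show "integrable M (\<lambda>x. norm (k x))" using k by simp
  show "AE x in M. (\<lambda>m. \<psi> m x * k x) \<longlonglongrightarrow> k x"
  proof (rule AE_I2)
    fix x assume "x \<in> space M"
    then have "x \<in> E" by simp
    show "(\<lambda>m. \<psi> m x * k x) \<longlonglongrightarrow> k x"
      by (rule tendsto_eventually) (use eventually_not_strip[OF \<open>x \<in> E\<close>] in eventually_elim, simp add: psi(3) \<open>x \<in> E\<close>)
  qed
  show "(\<lambda>x. \<psi> m x * k x) \<in> borel_measurable M" for m
    using borel_measurable_continuous_M[OF smooth_continuous[OF test_function_smooth[OF psi(1)]]]
      borel_measurable_integrable[OF k] by (rule borel_measurable_times)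
  show "AE x in M. norm (\<psi> m x * k x) \<le> norm (k x)" for m
    using psi(2)[of m] by (intro AE_I2) (simp add: abs_mult mult_left_le_one_le)
qed (use k in auto)

text \<open>Two limits in a fixed order. At fixed strip width the approximants remove A and t; then
  the width tends to 0 and with it the strip energy of H. The cutoff gradient times the width is the
  constant k, so the factor of \<open>h m\<close> stays bounded. The 16 is the Poincare factor 8
  times the 2 in front of the tested equation.\<close>

theorem energy_estimate:
  assumes wn: "\<And>n. smooth (wn n)" and w: "square_integrable M w" and H: "square_integrable M H"
    and T: "square_integrable (boundary_measure vs) T"
    and lims: "(\<lambda>n. LINT x|M. (wn n x - w x)\<^sup>2) \<longlonglongrightarrow> 0"
      "(\<lambda>n. LINT x|M. (norm (grad (wn n) x - H x))\<^sup>2) \<longlonglongrightarrow> 0"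
      "(\<lambda>n. LINT x|boundary_measure vs. (wn n x - T x)\<^sup>2) \<longlonglongrightarrow> 0"
    and wp: "weak_poisson E H f" and f: "continuous_on UNIV f"
    and F: "truncation F F'" "AE x in boundary_measure vs. F (T x) = 0"
  shows "(LINT x|M. (F (w x))\<^sup>2) \<le> 16 * \<rho>'\<^sup>2 * - (LINT x|M. f x * F (w x))"
proof -
  let ?Fw = "\<lambda>x. F (w x)"
  have wnL: "square_integrable M (wn n)" for n by (intro square_integrable_continuous smooth_continuous wn)
  have Fw: "square_integrable M ?Fw" and Fwn: "square_integrable M (\<lambda>x. F (wn n x))" for n
    by (intro truncation_square_integrable[OF F(1) finite_measure_M] w wnL)+
  have limF: "(\<lambda>n. LINT x|M. (F (wn n x) - ?Fw x)\<^sup>2) \<longlonglongrightarrow> 0"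
    by (rule L2_truncation[OF F(1) w wnL finite_measure_M lims(1)])
  define k where "k = 4 * cutoff_const / \<rho>"
  define \<delta> where "\<delta> m = inverse (real (Suc (Suc m)))" for m
  define h where "h m = (LINT x|M. indicator (strip (1 - \<delta> m)) x * (norm (H x))\<^sup>2)" for m
  have d: "0 < \<delta> m" "\<delta> m < 1" for m by (auto simp: \<delta>_def field_simps)
  have "\<exists>\<psi>. test_function E \<psi> \<and> (\<forall>x. 0 \<le> \<psi> x \<and> \<psi> x \<le> 1) \<and> (\<forall>x. norm (grad \<psi> x) \<le> 4 * cutoff_const / (\<delta> m * \<rho>)) \<and>
      (\<forall>x. x \<in> E \<longrightarrow> x \<notin> strip (1 - \<delta> m) \<longrightarrow> \<psi> x = 1 \<and> grad \<psi> x = 0)" for m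
    by (rule ex_strip_cutoff[OF d[of m]]) blast
  then obtain \<psi> where psi: "\<And>m. test_function E (\<psi> m)" "\<And>m x. 0 \<le> \<psi> m x \<and> \<psi> m x \<le> 1"
      "\<And>m x. norm (grad (\<psi> m) x) \<le> 4 * cutoff_const / (\<delta> m * \<rho>)"
      "\<And>m x. x \<in> E \<Longrightarrow> x \<notin> strip (1 - \<delta> m) \<Longrightarrow> \<psi> m x = 1 \<and> grad (\<psi> m) x = 0"
    by metis
  have fpsi: "square_integrable M (\<lambda>x. f x * \<psi> m x)" for m
    by (intro square_integrable_continuous continuous_intros f smooth_continuous test_function_smooth[OF psi(1)])
  have step: "(LINT x|M. (?Fw x)\<^sup>2) \<le> 8 * \<rho>'\<^sup>2 * (- 2 * (LINT x|M. (f x * \<psi> m x) * ?Fw x) + (3 + 16 * \<rho>'\<^sup>2 * k\<^sup>2) * h m)" for m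
  proof -
    let ?\<kappa> = "4 * cutoff_const / (\<delta> m * \<rho>)"
    let ?A = "\<lambda>n. LINT x|M. (norm (grad (wn n) x - H x))\<^sup>2"
    let ?t = "\<lambda>n. LINT x|boundary_measure vs. (wn n x - T x)\<^sup>2"
    let ?I = "\<lambda>n. LINT x|M. (f x * \<psi> m x) * F (wn n x)"
    have "(LINT x|M. (?Fw x)\<^sup>2) \<le> 4 * \<rho>' * 0 + 8 * \<rho>'\<^sup>2 *
       (3 * 0 - 2 * (LINT x|M. (f x * \<psi> m x) * ?Fw x) + 3 * h m + ?\<kappa>\<^sup>2 * (4 * \<rho>' * \<delta> m * 0 + 8 * \<rho>'\<^sup>2 * (\<delta> m)\<^sup>2 * (2 * 0 + 2 * h m)))"
    proof (rule LIMSEQ_le)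
      show "(\<lambda>n. LINT x|M. (F (wn n x))\<^sup>2) \<longlonglongrightarrow> (LINT x|M. (?Fw x)\<^sup>2)"
        by (rule L2_tendsto_square[OF Fw Fwn limF])
      show "(\<lambda>n. 4 * \<rho>' * ?t n + 8 * \<rho>'\<^sup>2 *
       (3 * ?A n - 2 * ?I n + 3 * h m + ?\<kappa>\<^sup>2 * (4 * \<rho>' * \<delta> m * ?t n + 8 * \<rho>'\<^sup>2 * (\<delta> m)\<^sup>2 * (2 * ?A n + 2 * h m))))
        \<longlonglongrightarrow> 4 * \<rho>' * 0 + 8 * \<rho>'\<^sup>2 *
       (3 * 0 - 2 * (LINT x|M. (f x * \<psi> m x) * ?Fw x) + 3 * h m + ?\<kappa>\<^sup>2 * (4 * \<rho>' * \<delta> m * 0 + 8 * \<rho>'\<^sup>2 * (\<delta> m)\<^sup>2 * (2 * 0 + 2 * h m)))"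
        by (intro tendsto_intros lims L2_tendsto_inner[OF fpsi Fw Fwn limF])
      show "\<exists>N. \<forall>n\<ge>N. (LINT x|M. (F (wn n x))\<^sup>2) \<le> 4 * \<rho>' * ?t n + 8 * \<rho>'\<^sup>2 *
       (3 * ?A n - 2 * ?I n + 3 * h m + ?\<kappa>\<^sup>2 * (4 * \<rho>' * \<delta> m * ?t n + 8 * \<rho>'\<^sup>2 * (\<delta> m)\<^sup>2 * (2 * ?A n + 2 * h m)))"
        unfolding h_def
        by (intro exI allI impI energy_step[OF wn H T wp f F d psi(1,2,3,4)])
    qed
    also have "\<dots> = 8 * \<rho>'\<^sup>2 * (- 2 * (LINT x|M. (f x * \<psi> m x) * ?Fw x) + (3 + 16 * \<rho>'\<^sup>2 * (?\<kappa> * \<delta> m)\<^sup>2) * h m)"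
      by (simp add: power_mult_distrib power_divide algebra_simps)
    also have "?\<kappa> * \<delta> m = k" using d[of m] by (simp add: k_def)
    finally show ?thesis .
  qed
  have "(LINT x|M. (?Fw x)\<^sup>2) \<le> 8 * \<rho>'\<^sup>2 * (- 2 * (LINT x|M. f x * ?Fw x) + (3 + 16 * \<rho>'\<^sup>2 * k\<^sup>2) * 0)"
  proof (rule LIMSEQ_le_const)
    have fF: "integrable M (\<lambda>x. f x * ?Fw x)"
      using Fw square_integrable_continuous[OF f] integrable_inner_of_squares[of f M ?Fw]
      by (simp add: square_integrable_def)
    have "(\<lambda>m. LINT x|M. \<psi> m x * (f x * ?Fw x)) \<longlonglongrightarrow> (LINT x|M. f x * ?Fw x)"
      by (rule cutoff_integral_tendsto[OF fF psi(1,2)]) (use psi(4) in \<open>auto simp: \<delta>_def\<close>)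
    then have l1: "(\<lambda>m. LINT x|M. (f x * \<psi> m x) * ?Fw x) \<longlonglongrightarrow> (LINT x|M. f x * ?Fw x)"
      by (simp add: mult_ac)
    have "integrable M (\<lambda>x. (norm (H x))\<^sup>2)" using H by (simp add: square_integrable_def)
    then have l2: "h \<longlonglongrightarrow> 0" unfolding h_def \<delta>_def by (rule strip_integral_tendsto)
    show "(\<lambda>m. 8 * \<rho>'\<^sup>2 * (- 2 * (LINT x|M. (f x * \<psi> m x) * ?Fw x) + (3 + 16 * \<rho>'\<^sup>2 * k\<^sup>2) * h m))
      \<longlonglongrightarrow> 8 * \<rho>'\<^sup>2 * (- 2 * (LINT x|M. f x * ?Fw x) + (3 + 16 * \<rho>'\<^sup>2 * k\<^sup>2) * 0)"
      by (intro tendsto_intros l1 l2)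
  qed (use step in blast)
  then show ?thesis by simp
qed

end

section \<open>Truncation functions\<close>

text \<open>For t > k this is (t - k) exp(- m / (t - k)): a smooth positive part of t - k, below the
  true one by at most m.\<close>

definition ramp :: "real \<Rightarrow> real \<Rightarrow> real \<Rightarrow> real" where
  "ramp k m t = m * ((t - k) / m * flat 0 ((t - k) / m))"

definition ramp' :: "real \<Rightarrow> real \<Rightarrow> real \<Rightarrow> real" where
  "ramp' k m t = flat 0 ((t - k) / m) + (t - k) / m * flat 2 ((t - k) / m)"

lemma flat_0_bounds: "0 \<le> flat 0 s" "flat 0 s \<le> 1" "0 < s \<Longrightarrow> s - 1 \<le> s * flat 0 s"
proof -
  show "0 \<le> flat 0 s" "flat 0 s \<le> 1" by (simp_all add: flat_def)
  assume s: "0 < s"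
  have "1 + (- inverse s) \<le> exp (- inverse s)" by (rule exp_ge_add_one_self)
  then have "s * (1 + (- inverse s)) \<le> s * exp (- inverse s)" using s by (intro mult_left_mono) auto
  then show "s - 1 \<le> s * flat 0 s" using s by (simp add: flat_def algebra_simps)
qed

lemma flat_nonpos: "s \<le> 0 \<Longrightarrow> flat j s = 0"
  by (simp add: flat_def)

lemma ramp_deriv: "0 < m \<Longrightarrow> (ramp k m has_real_derivative ramp' k m t) (at t)"
proof -
  assume m: "0 < m"
  have l: "((\<lambda>t. (t - k) / m) has_real_derivative inverse m) (at t)"
    using m by (auto intro!: derivative_eq_intros simp: divide_inverse)
  have f: "((\<lambda>t. flat 0 ((t - k) / m)) has_real_derivative (flat 2 ((t - k) / m) * inverse m)) (at t)"
    using DERIV_chain2[OF flat_deriv[of 0 "(t - k) / m"] l] by (simp add: numeral_2_eq_2)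
  have "(ramp k m has_real_derivative m * ((t - k) / m * (flat 2 ((t - k) / m) * inverse m) + inverse m * flat 0 ((t - k) / m))) (at t)"
    unfolding ramp_def[abs_def] using DERIV_cmult[OF DERIV_mult[OF l f], of m] by (simp add: add.commute mult.commute)
  moreover have "m * ((t - k) / m * (flat 2 ((t - k) / m) * inverse m) + inverse m * flat 0 ((t - k) / m)) = ramp' k m t"
    using m by (simp add: ramp'_def field_simps)
  ultimately show ?thesis by simp
qed

text \<open>With s = (t - k) / m the derivative for t > k is exp(- 1/s) (1 + 1/s), and 1 + x \<le>
  exp x at x = 1/s bounds it by 1.\<close>

lemma ramp'_bounds:
  assumes "0 < m"
  shows "0 \<le> ramp' k m t" "ramp' k m t \<le> 1" "t \<le> k \<Longrightarrow> ramp' k m t = 0"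
proof -
  have eq: "ramp' k m t = exp (- inverse s) * (1 + inverse s)" if "0 < s" "s = (t - k) / m" for s
    using that(1) unfolding ramp'_def that(2)[symmetric] by (simp add: flat_def power2_eq_square algebra_simps)
  have z: "ramp' k m t = 0" if "t \<le> k"
    using flat_nonpos[of "(t - k) / m"] divide_nonpos_pos[of "t - k" m] that assms by (simp add: ramp'_def)
  show "t \<le> k \<Longrightarrow> ramp' k m t = 0" by (rule z)
  show "0 \<le> ramp' k m t"
  proof (cases "t \<le> k")
    case False
    then have "0 < (t - k) / m" using assms by simp
    then have "0 < inverse ((t - k) / m)" by (rule positive_imp_inverse_positive)
    then show ?thesis unfolding eq[OF \<open>0 < (t - k) / m\<close> refl] by (intro mult_nonneg_nonneg) auto
  qed (simp add: z)
  show "ramp' k m t \<le> 1"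
  proof (cases "t \<le> k")
    case False
    then have s: "0 < (t - k) / m" using assms by simp
    have "exp (- inverse ((t - k) / m)) * (1 + inverse ((t - k) / m)) \<le>
        exp (- inverse ((t - k) / m)) * exp (inverse ((t - k) / m))"
      by (intro mult_left_mono exp_ge_add_one_self) simp
    also have "\<dots> = 1" by (simp add: exp_add[symmetric])
    finally show ?thesis using eq[OF s refl] by simp
  qed (simp add: z)
qed

lemma ramp_eq_0: "0 < m \<Longrightarrow> t \<le> k \<Longrightarrow> ramp k m t = 0"
  using flat_nonpos[of "(t - k) / m"] divide_nonpos_pos[of "t - k" m] by (simp add: ramp_def)

lemma ramp_pos: "0 < m \<Longrightarrow> k < t \<Longrightarrow> 0 < ramp k m t"
  by (simp add: ramp_def flat_def)

lemma ramp_nonneg: "0 < m \<Longrightarrow> 0 \<le> ramp k m t"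
  using ramp_eq_0[of m t k] ramp_pos[of m k t] by (cases "t \<le> k") auto

lemma ramp_bounds:
  assumes "0 < m" "k < t"
  shows "ramp k m t \<le> t - k" "t - k - m \<le> ramp k m t"
proof -
  let ?s = "(t - k) / m"
  have s: "0 < ?s" "m * ?s = t - k" using assms by auto
  have "m * (?s * flat 0 ?s) \<le> m * (?s * 1)"
    using assms s flat_0_bounds(2)[of ?s] by (intro mult_left_mono) auto
  then show "ramp k m t \<le> t - k" using s by (simp add: ramp_def)
  have "m * (?s - 1) \<le> m * (?s * flat 0 ?s)"
    using assms s flat_0_bounds(3)[of ?s] by (intro mult_left_mono) auto
  then show "t - k - m \<le> ramp k m t" using s(2) by (simp add: ramp_def right_diff_distrib)
qed

lemma smooth_ramp:
  assumes "smooth u" shows "smooth (\<lambda>x. ramp k m (u x))"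
proof -
  have "(\<lambda>x. ramp k m (u x)) = (\<lambda>x. m * ((- k / m + inverse m * u x) * flat 0 (- k / m + inverse m * u x)))"
  proof
    fix x
    have "(u x - k) / m = - k / m + inverse m * u x" by (simp add: divide_inverse algebra_simps)
    then show "ramp k m (u x) = m * ((- k / m + inverse m * u x) * flat 0 (- k / m + inverse m * u x))"
      unfolding ramp_def by (simp only:)
  qed
  moreover have "smooth (\<lambda>x. m * ((- k / m + inverse m * u x) * flat 0 (- k / m + inverse m * u x)))"
    by (intro smooth_cmult smooth_mult smooth_flat smooth_add smooth_const assms)
  ultimately show ?thesis by (simp only:)
qed

lemma truncation_ramp: "0 < m \<Longrightarrow> truncation (ramp k m) (ramp' k m)"
  using ramp_deriv[of m k] ramp'_bounds[of m k] by (simp add: truncation_def smooth_ramp)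

text \<open>A smooth substitute for \<open>t \<mapsto> t - max (- m) (min m t)\<close>.\<close>

definition soft_threshold :: "real \<Rightarrow> real \<Rightarrow> real" where
  "soft_threshold m t = ramp m m t - ramp m m (- t)"

text \<open>The two ramps act on disjoint half-lines, so at most one of the two derivatives is
  nonzero and their sum stays below 1.\<close>

lemma truncation_soft_threshold:
  assumes m: "0 < m"
  shows "truncation (soft_threshold m) (\<lambda>t. ramp' m m t + ramp' m m (- t))"
  unfolding truncation_def
proof (intro conjI allI impI)
  fix u assume u: "smooth u"
  have "smooth (\<lambda>x. ramp m m (u x) + - ramp m m (- u x))"
    by (intro smooth_add smooth_uminus smooth_ramp u)
  then show "smooth (\<lambda>x. soft_threshold m (u x))" by (simp add: soft_threshold_def)
next
  fix t
  have "((\<lambda>t. ramp m m (- t)) has_real_derivative ramp' m m (- t) * - 1) (at t)"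
    by (rule DERIV_chain2[OF ramp_deriv[OF m]]) (auto intro!: derivative_eq_intros)
  from DERIV_diff[OF ramp_deriv[OF m] this]
  show "(soft_threshold m has_real_derivative ramp' m m t + ramp' m m (- t)) (at t)"
    unfolding soft_threshold_def[abs_def] by simp
  show "0 \<le> ramp' m m t + ramp' m m (- t)" using ramp'_bounds(1)[OF m] by simp
  have "ramp' m m t = 0 \<or> ramp' m m (- t) = 0"
    using ramp'_bounds(3)[OF m, of t m] ramp'_bounds(3)[OF m, of "- t" m] m by linarith
  then show "ramp' m m t + ramp' m m (- t) \<le> 1"
    using ramp'_bounds(2)[OF m, of m t] ramp'_bounds(2)[OF m, of m "- t"] by auto
qed

lemma soft_threshold_eq_0: "0 < m \<Longrightarrow> \<bar>t\<bar> \<le> m \<Longrightarrow> soft_threshold m t = 0"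
  by (simp add: soft_threshold_def ramp_eq_0)

text \<open>One m for the threshold and one for the smoothing error of the ramp.\<close>

lemma soft_threshold_diff: 
  assumes m: "0 < m" shows "\<bar>t - soft_threshold m t\<bar> \<le> 2 * m"
proof -
  consider "\<bar>t\<bar> \<le> m" | "m < t" | "t < - m" by linarith
  then show ?thesis
  proof cases
    case 1
    then show ?thesis using soft_threshold_eq_0[OF m 1] by simp
  next
    case 2
    then show ?thesis
      using ramp_bounds[OF m 2] ramp_eq_0[OF m, of "- t" m] m by (simp add: soft_threshold_def)
  next
    case 3
    then show ?thesis
      using ramp_bounds[OF m, of m "- t"] ramp_eq_0[OF m, of t m] m by (simp add: soft_threshold_def)
  qed
qed

section \<open>Test functions, affine functions and integration by parts\<close>

lemma test_function_support:
  assumes "test_function E f"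
  obtains R where "\<And>x. R \<le> norm x \<Longrightarrow> f x = 0"
proof -
  have "bounded (closure {x. f x \<noteq> 0})" using assms by (simp add: test_function_def compact_imp_bounded)
  then obtain R where R: "\<And>x. x \<in> closure {x. f x \<noteq> 0} \<Longrightarrow> norm x \<le> R" by (auto simp: bounded_iff)
  show ?thesis
  proof (rule that[of "R + 1"])
    fix x :: "real^2" assume "R + 1 \<le> norm x"
    then have "x \<notin> closure {x. f x \<noteq> 0}" using R[of x] by auto
    then show "f x = 0" using closure_subset[of "{x. f x \<noteq> 0}"] by auto
  qed
qed

lemma test_function_mem: "test_function E f \<Longrightarrow> f x \<noteq> 0 \<Longrightarrow> x \<in> E"
  using closure_subset[of "{x. f x \<noteq> 0}"] by (auto simp: test_function_def)

lemma laplacian_affine: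
  assumes "smooth f"
  shows "laplacian (\<lambda>x. f (s *\<^sub>R x + b)) x = s\<^sup>2 * laplacian f (s *\<^sub>R x + b)"
proof -
  have 1: "pd i (\<lambda>x. f (s *\<^sub>R x + b)) = (\<lambda>x. s * pd i f (s *\<^sub>R x + b))" for i
    by (intro ext pd_affine smooth_differentiable assms)
  have 2: "pd i (\<lambda>x. s * pd i f (s *\<^sub>R x + b)) x = s * (s * pd i (pd i f) (s *\<^sub>R x + b))" for i
  proof -
    have "(\<lambda>x. pd i f (s *\<^sub>R x + b)) differentiable (at x)"
      by (intro smooth_differentiable smooth_affine smooth_pd assms)
    moreover have "pd i f differentiable at (s *\<^sub>R x + b)"
      by (intro smooth_differentiable smooth_pd assms)
    ultimately show ?thesis by (simp add: pd_cmult pd_affine)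
  qed
  show ?thesis unfolding laplacian_def 1 2 by (simp add: sum_distrib_left power2_eq_square mult.assoc)
qed

lemma continuous_laplacian: "smooth f \<Longrightarrow> continuous_on S (laplacian f)"
  unfolding laplacian_def[abs_def] by (intro continuous_intros smooth_continuous smooth_pd)

lemma P1_affine: "p \<in> P1 \<Longrightarrow> \<exists>a b. \<forall>x. p x = a + b \<bullet> (x - c)"
proof -
  assume "p \<in> P1"
  then obtain a b where "p = (\<lambda>x. a + b \<bullet> x)" by (auto simp: P1_def)
  then have "\<forall>x. p x = (a + b \<bullet> c) + b \<bullet> (x - c)" by (simp add: inner_diff_right)
  then show ?thesis by blast
qed

lemma affine_P1: "(\<lambda>x. a + b \<bullet> (x - c)) \<in> P1"
proof -
  have "(\<lambda>x. a + b \<bullet> (x - c)) = (\<lambda>x. (a - b \<bullet> c) + b \<bullet> x)" by (simp add: inner_diff_right fun_eq_iff)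
  then show ?thesis unfolding P1_def by blast
qed

lemma grad_affine_fun: "grad (\<lambda>x. a + b \<bullet> (x - c)) x = b"
proof (rule grad_eqI)
  show "((\<lambda>x. a + b \<bullet> (x - c)) has_derivative (\<lambda>h. b \<bullet> h)) (at x)"
    by (auto intro!: derivative_eq_intros)
qed

lemma P1_continuous: "p \<in> P1 \<Longrightarrow> continuous_on S p"
  using smooth_continuous smooth_P1 by blast

context star_polygon
begin

lemma integral_M_lborel:
  assumes "continuous_on UNIV (f :: real^2 \<Rightarrow> real)" "\<And>x. f x \<noteq> 0 \<Longrightarrow> x \<in> E"
  shows "(LINT x|M. f x) = (LINT x|lborel. f x)"
proof -
  have "(LINT x|M. f x) = (LINT x|lebesgue. indicator E x *\<^sub>R f x)"
    using E_lebesgue by (subst integral_restrict_space) auto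
  also have "\<dots> = (LINT x|lebesgue. f x)"
    using assms(2) by (intro Bochner_Integration.integral_cong) (auto simp: indicator_def)
  also have "\<dots> = (LINT x|lborel. f x)"
    using assms(1) by (intro integral_completion) (simp add: borel_measurable_continuous_onI)
  finally show ?thesis .
qed

lemma integral_pd_test_function:
  assumes t: "test_function E \<phi>" shows "(LINT x|M. pd i \<phi> x) = 0"
proof -
  obtain R where R: "\<And>x. R \<le> norm x \<Longrightarrow> \<phi> x = 0" using test_function_support[OF t] by blast
  have s: "smooth \<phi>" by (rule test_function_smooth[OF t])
  have "(LINT x|M. pd i \<phi> x) = (LINT x|lborel. pd i \<phi> x)"
    by (intro integral_M_lborel smooth_continuous smooth_pd s test_function_mem[OF test_function_pd[OF t]])
  then show ?thesis using integral_pd_eq_0[OF s R] by simp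
qed

lemma integral_by_parts:
  assumes u: "smooth u" and t: "test_function E \<phi>"
  shows "(LINT x|M. u x * pd i \<phi> x) = - (LINT x|M. pd i u x * \<phi> x)"
proof -
  have s: "smooth \<phi>" by (rule test_function_smooth[OF t])
  have "pd i (\<lambda>x. u x * \<phi> x) = (\<lambda>x. u x * pd i \<phi> x + pd i u x * \<phi> x)"
    by (intro ext pd_mult smooth_differentiable u s)
  then have "0 = (LINT x|M. u x * pd i \<phi> x + pd i u x * \<phi> x)"
    using integral_pd_test_function[OF test_function_mult[OF u t], of i] by simp
  also have "\<dots> = (LINT x|M. u x * pd i \<phi> x) + (LINT x|M. pd i u x * \<phi> x)"
    by (intro Bochner_Integration.integral_add continuous_integrable continuous_intros smooth_continuous smooth_pd u s)
  finally show ?thesis by linarith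
qed

text \<open>In the distributional Laplacian one derivative is moved onto v through the weak
  gradient, with \<open>pd i \<phi>\<close> as test function.\<close>

lemma weak_poisson_of_laplacian:
  assumes vs: "square_integrable M v" and wg: "is_weak_gradient E v H" and lap: "has_distributional_laplacian E v p"
  shows "weak_poisson E H p"
  unfolding weak_poisson_def
proof (intro allI impI)
  fix \<phi> assume t: "test_function E \<phi>"
  have s: "smooth \<phi>" by (rule test_function_smooth[OF t])
  have Hs: "square_integrable M H" using wg by (simp add: is_weak_gradient_def)
  have Hm: "H \<in> borel_measurable M" and Hi: "integrable M (\<lambda>x. (norm (H x))\<^sup>2)"
    using Hs by (auto simp: square_integrable_def)
  have i: "integrable M (\<lambda>x. H x $ i * pd i \<phi> x)" for i
  proof -
    have "integrable M (\<lambda>x. H x \<bullet> axis i (pd i \<phi> x))"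
    proof (rule integrable_inner_of_squares[OF Hm _ Hi])
      have c: "continuous_on UNIV (\<lambda>x. axis i (pd i \<phi> x) :: real^2)"
      proof -
        have "continuous_on UNIV (\<lambda>x. if j = i then pd i \<phi> x else 0)" for j
          using smooth_continuous[OF smooth_pd[OF s]] by (cases "j = i") auto
        then show ?thesis unfolding axis_def by (intro continuous_on_vec_lambda)
      qed
      show "(\<lambda>x. axis i (pd i \<phi> x)) \<in> borel_measurable M" by (rule borel_measurable_continuous_M[OF c])
      show "integrable M (\<lambda>x. (norm (axis i (pd i \<phi> x) :: real^2))\<^sup>2)"
        by (intro continuous_integrable continuous_intros c)
    qed
    then show ?thesis by (simp add: inner_axis)
  qed
  have j: "integrable M (\<lambda>x. v x * pd i (pd i \<phi>) x)" for i
    using vs square_integrable_continuous[OF smooth_continuous[OF smooth_pd[OF smooth_pd[OF s]]]]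
      integrable_inner_of_squares[of v M "pd i (pd i \<phi>)"] by (simp add: square_integrable_def)
  have w: "(LINT x|M. v x * pd i (pd i \<phi>) x) = - (LINT x|M. H x $ i * pd i \<phi> x)" for i
    using wg test_function_pd[OF t] unfolding is_weak_gradient_def by blast
  show "(LINT x|M. H x \<bullet> grad \<phi> x) = - (LINT x|M. p x * \<phi> x)"
  proof -
    have "(LINT x|M. H x \<bullet> grad \<phi> x) = (LINT x|M. (\<Sum>i\<in>UNIV. H x $ i * pd i \<phi> x))"
      by (simp add: grad_def inner_vec_def)
    also have "\<dots> = (\<Sum>i\<in>UNIV. LINT x|M. H x $ i * pd i \<phi> x)"
      by (rule Bochner_Integration.integral_sum) (rule i)
    also have "\<dots> = - (\<Sum>i\<in>UNIV. LINT x|M. v x * pd i (pd i \<phi>) x)"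
      unfolding w by (simp add: sum_negf)
    also have "(\<Sum>i\<in>UNIV. LINT x|M. v x * pd i (pd i \<phi>) x) = (LINT x|M. (\<Sum>i\<in>UNIV. v x * pd i (pd i \<phi>) x))"
      by (rule Bochner_Integration.integral_sum[symmetric]) (rule j)
    also have "\<dots> = (LINT x|M. v x * laplacian \<phi> x)" by (simp add: laplacian_def sum_distrib_left)
    also have "\<dots> = (LINT x|M. p x * \<phi> x)" using lap t by (simp add: has_distributional_laplacian_def)
    finally show ?thesis .
  qed
qed

end

section \<open>The projection\<close>

context star_polygon
begin

lemma measure_E_pos: "0 < measure lborel E"
proof -
  have "E \<notin> null_sets lborel"
  proof
    assume "E \<in> null_sets lborel"
    then have "negligible E" by (simp add: null_sets_completionI negligible_iff_null_sets)
    then show False using open_not_negligible[OF op] nonempty by simp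
  qed
  then have "emeasure lborel E \<noteq> 0" by (auto simp: null_sets_def)
  then show ?thesis using emeasure_E_finite by (simp add: measure_def enn2real_positive_iff zero_less_iff_neq_zero)
qed

lemma measure_M: "measure M E = measure lborel E"
proof -
  have "measure M E = measure lebesgue E" using E_lebesgue by (simp add: measure_restrict_space)
  then show ?thesis by (simp add: measure_completion)
qed

lemma integral_const_M: "(LINT x|M. (k::real)) = k * measure lborel E"
  using measure_M by simp

text \<open>The outer ball is put into a square of side 2 \<rho>'.\<close>

lemma measure_E_le: "measure lborel E \<le> 4 * \<rho>'\<^sup>2"
proof -
  let ?o = "(\<chi> i. \<rho>') :: real^2"
  have sub: "E \<subseteq> cbox (c' - ?o) (c' + ?o)"
  proof
    fix x assume "x \<in> E"
    then have "norm (x - c') < \<rho>'" using outer by (auto simp: dist_norm norm_minus_commute)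
    then have "\<bar>(x - c') $ i\<bar> \<le> \<rho>'" for i using component_le_norm_cart[of "x - c'" i] by linarith
    then have "c' $ i - \<rho>' \<le> x $ i \<and> x $ i \<le> c' $ i + \<rho>'" for i
      unfolding abs_le_iff vector_minus_component by (metis add.commute diff_le_eq le_diff_eq minus_diff_eq neg_le_iff_le add_uminus_conv_diff)
    then show "x \<in> cbox (c' - ?o) (c' + ?o)" by (simp add: mem_box_cart)
  qed
  have "measure lborel E \<le> measure lborel (cbox (c' - ?o) (c' + ?o))"
    using sub by (intro measure_mono_fmeasurable) auto
  also have "\<dots> = (2 * \<rho>') * (2 * \<rho>')"
  proof -
    have "\<forall>b\<in>Basis. (c' - ?o) \<bullet> b \<le> (c' + ?o) \<bullet> b"
      using rho'_pos by (auto simp: Basis_real2 inner_axis)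
    then show ?thesis
      by (simp add: content_cbox Basis_real2 inner_axis axis_eq_axis)
  qed
  finally show ?thesis by (simp add: power2_eq_square)
qed

lemma boundary_measure_pos: "0 < measure (boundary_measure vs) (polygon_boundary vs)"
proof -
  interpret finite_measure "boundary_measure vs" by (rule finite_measure_boundary)
  have n: "0 < length vs" using sp by (auto simp: simple_polygon_def)
  have "emeasure (boundary_measure vs) (polygon_boundary vs) = (\<integral>\<^sup>+x. 1 \<partial>boundary_measure vs)"
    using space_boundary_measure[of vs] by simp
  also have "\<dots> = (\<Sum>i<length vs. ennreal (dist (vs ! i) (next_vertex vs i)) * (\<integral>\<^sup>+t\<in>{0..1::real}. 1 \<partial>lborel))"
    by (rule nn_integral_boundary_measure) simp
  also have "\<dots> = ennreal (\<Sum>i<length vs. dist (vs ! i) (next_vertex vs i))" by simp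
  finally have "measure (boundary_measure vs) (polygon_boundary vs) = (\<Sum>i<length vs. dist (vs ! i) (next_vertex vs i))"
    by (simp add: measure_def sum_nonneg)
  also have "0 < \<dots>"
    using n next_vertex_neq[OF sp] by (intro sum_pos) auto
  finally show ?thesis .
qed

lemma square_integrable_integrable:
  assumes "finite_measure N" "square_integrable N (g :: _ \<Rightarrow> real)"
  shows "integrable N g"
proof -
  interpret finite_measure N by (rule assms(1))
  have "integrable N (\<lambda>x. g x \<bullet> 1)"
    using assms(2) by (intro integrable_inner_of_squares) (auto simp: square_integrable_def)
  then show ?thesis by simp
qed

lemma component_square_integrable:
  assumes "square_integrable N (H :: 'a \<Rightarrow> real^2)"
  shows "square_integrable N (\<lambda>x. H x $ i)"
proof -
  have m: "H \<in> borel_measurable N" and i: "integrable N (\<lambda>x. (norm (H x))\<^sup>2)"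
    using assms by (auto simp: square_integrable_def)
  have m': "(\<lambda>x. H x $ i) \<in> borel_measurable N"
    by (rule measurable_compose[OF m]) (intro borel_measurable_continuous_onI continuous_intros)
  have "integrable N (\<lambda>x. (H x $ i)\<^sup>2)"
  proof (rule Bochner_Integration.integrable_bound[OF i])
    show "AE x in N. norm ((H x $ i)\<^sup>2) \<le> norm ((norm (H x))\<^sup>2)"
    proof (rule AE_I2)
      fix x
      have "\<bar>H x $ i\<bar>\<^sup>2 \<le> (norm (H x))\<^sup>2" by (intro power_mono component_le_norm_cart) simp
      then show "norm ((H x $ i)\<^sup>2) \<le> norm ((norm (H x))\<^sup>2)" by simp
    qed
  qed (use m' in measurable)
  then show ?thesis using m' by (simp add: square_integrable_def)
qed

text \<open>The gradient bound of the strip cutoff multiplied by the relative width of the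
  strip.\<close>

definition kappa :: real where "kappa = 4 * cutoff_const / \<rho>"

lemma kappa_pos: "0 < kappa" using cutoff_const(1) rho_pos by (simp add: kappa_def)

text \<open>\<open>strip_estimate_real\<close> for the approximants, whose boundary squares are at
  most 2 (\<phi> n - T)^2 + 2 K^2, followed by the limit in n. The term with K is of first order in
  \<delta>, like the area of the strip.\<close>

lemma strip_trace_estimate:
  assumes phi: "\<And>n. smooth (\<phi> n)" and v: "square_integrable M v" and H: "square_integrable M H"
    and T: "square_integrable (boundary_measure vs) T"
    and lims: "(\<lambda>n. LINT x|M. (\<phi> n x - v x)\<^sup>2) \<longlonglongrightarrow> 0"
      "(\<lambda>n. LINT x|M. (norm (grad (\<phi> n) x - H x))\<^sup>2) \<longlonglongrightarrow> 0"
      "(\<lambda>n. LINT x|boundary_measure vs. (\<phi> n x - T x)\<^sup>2) \<longlonglongrightarrow> 0"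
    and TK: "AE x in boundary_measure vs. \<bar>T x\<bar> \<le> K" and d: "0 < \<delta>" "\<delta> < 1"
  shows "(LINT x|M. (indicator (strip (1 - \<delta>)) x * v x)\<^sup>2) \<le> 8 * \<delta> * K\<^sup>2 * measure lborel E
    + 16 * \<rho>'\<^sup>2 * \<delta>\<^sup>2 * (LINT x|M. indicator (strip (1 - \<delta>)) x * (norm (H x))\<^sup>2)"
proof -
  let ?S = "strip (1 - \<delta>)"
  let ?A = "\<lambda>n. LINT x|M. (norm (grad (\<phi> n) x - H x))\<^sup>2"
  let ?t = "\<lambda>n. LINT x|boundary_measure vs. (\<phi> n x - T x)\<^sup>2"
  let ?h = "LINT x|M. indicator ?S x * (norm (H x))\<^sup>2"
  have i2: "(indicator ?S x * (a::real))\<^sup>2 = indicator ?S x * a\<^sup>2" for x a by (simp add: indicator_def)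
  have sq: "square_integrable M (\<lambda>x. indicator ?S x * g x)" if "square_integrable M g" for g :: "real^2 \<Rightarrow> real"
  proof -
    have "(\<lambda>x. indicator ?S x * g x) \<in> borel_measurable M"
      using that by (intro borel_measurable_times borel_measurable_indicator strip_M) (simp add: square_integrable_def)
    then show ?thesis using that integrable_strip by (simp add: square_integrable_def i2)
  qed
  have pL: "square_integrable M (\<phi> n)" for n by (intro square_integrable_continuous smooth_continuous phi)
  have Hm: "H \<in> borel_measurable M" and Hi: "integrable M (\<lambda>x. (norm (H x))\<^sup>2)"
    using H by (auto simp: square_integrable_def)
  have dM: "integrable M (\<lambda>x. (\<phi> n x - v x)\<^sup>2)" for n
    using integrable_norm_diff_square[of "\<phi> n" M v] pL[of n] v by (simp add: square_integrable_def)
  have l: "(\<lambda>n. LINT x|M. (indicator ?S x * \<phi> n x - indicator ?S x * v x)\<^sup>2) \<longlonglongrightarrow> 0"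
  proof (rule Lim_null_comparison[OF _ lims(1)], rule always_eventually, rule allI)
    fix n
    have "(LINT x|M. (indicator ?S x * \<phi> n x - indicator ?S x * v x)\<^sup>2) = (LINT x|M. indicator ?S x * (\<phi> n x - v x)\<^sup>2)"
      by (simp add: right_diff_distrib[symmetric] i2)
    also have "\<dots> \<le> (LINT x|M. (\<phi> n x - v x)\<^sup>2)"
      by (intro integral_mono integrable_strip dM) (simp add: indicator_def)
    finally show "norm (LINT x|M. (indicator ?S x * \<phi> n x - indicator ?S x * v x)\<^sup>2) \<le> (LINT x|M. (\<phi> n x - v x)\<^sup>2)"
      by simp
  qed
  have step: "(LINT x|M. (indicator ?S x * \<phi> n x)\<^sup>2) \<le> 4 * \<rho>' * \<delta> * (2 * ?t n) + 4 * \<delta> * (2 * K\<^sup>2) * measure lborel E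
      + 8 * \<rho>'\<^sup>2 * \<delta>\<^sup>2 * (2 * ?A n + 2 * ?h)" for n
  proof -
    have bi: "integrable (boundary_measure vs) (\<lambda>x. 2 * (\<phi> n x - T x)\<^sup>2)"
    proof -
      have "integrable (boundary_measure vs) (\<lambda>x. (norm (\<phi> n x - T x))\<^sup>2)"
      proof (rule integrable_norm_diff_square)
        show "\<phi> n \<in> borel_measurable (boundary_measure vs)"
          by (intro borel_measurable_integrable continuous_boundary_integrable smooth_continuous phi)
        show "integrable (boundary_measure vs) (\<lambda>x. (norm (\<phi> n x))\<^sup>2)"
          by (intro continuous_boundary_integrable continuous_intros smooth_continuous phi)
      qed (use T in \<open>auto simp: square_integrable_def\<close>)
      then show ?thesis by simp
    qed
    have ub: "AE x in boundary_measure vs. (\<phi> n x)\<^sup>2 \<le> 2 * (\<phi> n x - T x)\<^sup>2 + 2 * K\<^sup>2"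
      using TK
    proof eventually_elim
      case (elim x)
      have "\<bar>T x\<bar>\<^sup>2 \<le> K\<^sup>2" using elim by (intro power_mono) auto
      moreover have "(\<phi> n x)\<^sup>2 \<le> 2 * (\<phi> n x - T x)\<^sup>2 + 2 * (T x)\<^sup>2"
        using zero_le_power2[of "\<phi> n x - 2 * T x"] by (simp add: power2_eq_square algebra_simps)
      ultimately show ?case by simp
    qed
    have Ai: "integrable M (\<lambda>x. (norm (grad (\<phi> n) x - H x))\<^sup>2)"
      by (intro integrable_norm_diff_square Hm Hi borel_measurable_continuous_M continuous_integrable
          continuous_intros continuous_grad phi)
    have "(LINT x|M. indicator ?S x * (norm (grad (\<phi> n) x))\<^sup>2)
       \<le> (LINT x|M. 2 * (norm (grad (\<phi> n) x - H x))\<^sup>2 + 2 * (indicator ?S x * (norm (H x))\<^sup>2))"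
    proof (intro integral_mono integrable_strip Bochner_Integration.integrable_add integrable_mult_right Ai Hi
        continuous_integrable continuous_intros continuous_grad phi)
      fix x
      have "(norm (grad (\<phi> n) x))\<^sup>2 \<le> 2 * (norm (grad (\<phi> n) x - H x))\<^sup>2 + 2 * (norm (H x))\<^sup>2"
        using norm_diff_square_le[of "grad (\<phi> n) x - H x" "- H x"] by simp
      then show "indicator ?S x * (norm (grad (\<phi> n) x))\<^sup>2 \<le> 2 * (norm (grad (\<phi> n) x - H x))\<^sup>2 + 2 * (indicator ?S x * (norm (H x))\<^sup>2)"
        by (cases "x \<in> ?S") simp_all
    qed
    also have "\<dots> = 2 * ?A n + 2 * ?h" using Ai integrable_strip[OF Hi] by simp
    finally have "8 * \<rho>'\<^sup>2 * \<delta>\<^sup>2 * (LINT x|M. indicator ?S x * (norm (grad (\<phi> n) x))\<^sup>2) \<le> 8 * \<rho>'\<^sup>2 * \<delta>\<^sup>2 * (2 * ?A n + 2 * ?h)"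
      by (intro mult_left_mono) auto
    then show ?thesis
      using strip_estimate_real[OF phi _ _ bi _ _ ub, of "1 - \<delta>"] d by (simp add: i2)
  qed
  have "(LINT x|M. (indicator ?S x * v x)\<^sup>2) \<le> 4 * \<rho>' * \<delta> * (2 * 0) + 4 * \<delta> * (2 * K\<^sup>2) * measure lborel E
      + 8 * \<rho>'\<^sup>2 * \<delta>\<^sup>2 * (2 * 0 + 2 * ?h)"
  proof (rule LIMSEQ_le)
    show "(\<lambda>n. LINT x|M. (indicator ?S x * \<phi> n x)\<^sup>2) \<longlonglongrightarrow> (LINT x|M. (indicator ?S x * v x)\<^sup>2)"
      by (rule L2_tendsto_square[OF sq[OF v] sq[OF pL] l])
    show "(\<lambda>n. 4 * \<rho>' * \<delta> * (2 * ?t n) + 4 * \<delta> * (2 * K\<^sup>2) * measure lborel E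
      + 8 * \<rho>'\<^sup>2 * \<delta>\<^sup>2 * (2 * ?A n + 2 * ?h)) \<longlonglongrightarrow> 4 * \<rho>' * \<delta> * (2 * 0) + 4 * \<delta> * (2 * K\<^sup>2) * measure lborel E
      + 8 * \<rho>'\<^sup>2 * \<delta>\<^sup>2 * (2 * 0 + 2 * ?h)"
      by (intro tendsto_intros lims)
  qed (use step in blast)
  then show ?thesis by (simp add: algebra_simps)
qed

text \<open>A substitute for the boundary integral of v times the normal: the weak gradient tested
  with a cutoff puts the derivative on \<psi>, which varies only in the strip. There v^2 integrates
  to order \<delta> K^2, up to the vanishing energy term, and |grad \<psi>|^2 to order 1/\<delta>,
  so Cauchy-Schwarz gives a bound free of \<delta>.\<close>

lemma integral_gradient_bound:
  assumes phi: "\<And>n. smooth (\<phi> n)" and v: "square_integrable M v" and wg: "is_weak_gradient E v H"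
    and T: "square_integrable (boundary_measure vs) T"
    and lims: "(\<lambda>n. LINT x|M. (\<phi> n x - v x)\<^sup>2) \<longlonglongrightarrow> 0"
      "(\<lambda>n. LINT x|M. (norm (grad (\<phi> n) x - H x))\<^sup>2) \<longlonglongrightarrow> 0"
      "(\<lambda>n. LINT x|boundary_measure vs. (\<phi> n x - T x)\<^sup>2) \<longlonglongrightarrow> 0"
    and TK: "AE x in boundary_measure vs. \<bar>T x\<bar> \<le> K" and K: "0 \<le> K"
  shows "\<bar>LINT x|M. H x $ i\<bar> \<le> 6 * kappa * K * measure lborel E"
proof -
  have H: "square_integrable M H" using wg by (simp add: is_weak_gradient_def)
  have Hi: "integrable M (\<lambda>x. (norm (H x))\<^sup>2)" using H by (simp add: square_integrable_def)
  have Hc: "integrable M (\<lambda>x. H x $ i)"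
    by (intro square_integrable_integrable finite_measure_M component_square_integrable H)
  let ?V = "measure lborel E"
  define \<delta> where "\<delta> m = inverse (real (Suc (Suc m)))" for m
  define h where "h m = (LINT x|M. indicator (strip (1 - \<delta> m)) x * (norm (H x))\<^sup>2)" for m
  have d: "0 < \<delta> m" "\<delta> m < 1" for m by (auto simp: \<delta>_def field_simps)
  have "\<exists>\<psi>. test_function E \<psi> \<and> (\<forall>x. 0 \<le> \<psi> x \<and> \<psi> x \<le> 1) \<and> (\<forall>x. norm (grad \<psi> x) \<le> 4 * cutoff_const / (\<delta> m * \<rho>)) \<and>
      (\<forall>x. x \<in> E \<longrightarrow> x \<notin> strip (1 - \<delta> m) \<longrightarrow> \<psi> x = 1 \<and> grad \<psi> x = 0)" for m
    by (rule ex_strip_cutoff[OF d[of m]]) blast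
  then obtain \<psi> where psi: "\<And>m. test_function E (\<psi> m)" "\<And>m x. 0 \<le> \<psi> m x \<and> \<psi> m x \<le> 1"
      "\<And>m x. norm (grad (\<psi> m) x) \<le> 4 * cutoff_const / (\<delta> m * \<rho>)"
      "\<And>m x. x \<in> E \<Longrightarrow> x \<notin> strip (1 - \<delta> m) \<Longrightarrow> \<psi> m x = 1 \<and> grad (\<psi> m) x = 0"
    by metis
  have step: "(LINT x|M. \<psi> m x * H x $ i)\<^sup>2 \<le> 32 * kappa\<^sup>2 * K\<^sup>2 * ?V\<^sup>2 + 64 * kappa\<^sup>2 * \<rho>'\<^sup>2 * ?V * h m" for m
  proof -
    let ?S = "strip (1 - \<delta> m)"
    let ?k = "4 * cutoff_const / (\<delta> m * \<rho>)"
    have pd_le: "\<bar>pd i (\<psi> m) x\<bar> \<le> ?k" for x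
      using component_le_norm_cart[of "grad (\<psi> m) x" i] psi(3)[of m x] by (simp add: grad_def)
    have pd_0: "pd i (\<psi> m) x = 0" if "x \<in> E" "x \<notin> ?S" for x
    proof -
      have "grad (\<psi> m) x $ i = 0" using psi(4)[OF that] by simp
      then show ?thesis by (simp add: grad_def)
    qed
    have i2: "(indicator ?S x * (a::real))\<^sup>2 = indicator ?S x * a\<^sup>2" for x a by (simp add: indicator_def)
    have cp: "continuous_on UNIV (pd i (\<psi> m))" by (intro smooth_continuous smooth_pd test_function_smooth[OF psi(1)])
    have vm: "v \<in> borel_measurable M" and vi: "integrable M (\<lambda>x. (v x)\<^sup>2)" using v by (auto simp: square_integrable_def)
    have Sv: "integrable M (\<lambda>x. (indicator ?S x * v x)\<^sup>2)" unfolding i2 by (intro integrable_strip vi)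
    have pi: "integrable M (\<lambda>x. (pd i (\<psi> m) x)\<^sup>2)" by (intro continuous_integrable continuous_intros cp)
    have Sm: "(\<lambda>x. indicator ?S x * v x) \<in> borel_measurable M"
      by (rule borel_measurable_times[OF borel_measurable_indicator[OF strip_M] vm])
    have Svp: "integrable M (\<lambda>x. (indicator ?S x * v x) * pd i (\<psi> m) x)"
      using integrable_inner_of_squares[OF Sm borel_measurable_continuous_M[OF cp]] Sv pi by simp
    have "(LINT x|M. \<psi> m x * H x $ i) = (LINT x|M. H x $ i * \<psi> m x)" by (simp only: mult.commute)
    also have "\<dots> = - (LINT x|M. v x * pd i (\<psi> m) x)"
      using wg psi(1)[of m] unfolding is_weak_gradient_def by fastforce
    also have "(LINT x|M. v x * pd i (\<psi> m) x) = (LINT x|M. (indicator ?S x * v x) * pd i (\<psi> m) x)"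
    proof (rule Bochner_Integration.integral_cong[OF refl])
      fix x assume "x \<in> space M"
      then have "x \<in> E" by simp
      then show "v x * pd i (\<psi> m) x = (indicator ?S x * v x) * pd i (\<psi> m) x"
        using pd_0[of x] by (cases "x \<in> ?S") auto
    qed
    finally have "(LINT x|M. \<psi> m x * H x $ i)\<^sup>2 = (LINT x|M. (indicator ?S x * v x) * pd i (\<psi> m) x)\<^sup>2" by simp
    also have "\<dots> \<le> (LINT x|M. (indicator ?S x * v x)\<^sup>2) * (LINT x|M. (pd i (\<psi> m) x)\<^sup>2)"
      by (rule integral_Cauchy_Schwarz[OF Sv pi Svp])
    also have "\<dots> \<le> (8 * \<delta> m * K\<^sup>2 * ?V + 16 * \<rho>'\<^sup>2 * (\<delta> m)\<^sup>2 * h m) * (?k\<^sup>2 * (4 * \<delta> m * ?V))"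
    proof (rule mult_mono)
      show "(LINT x|M. (indicator ?S x * v x)\<^sup>2) \<le> 8 * \<delta> m * K\<^sup>2 * ?V + 16 * \<rho>'\<^sup>2 * (\<delta> m)\<^sup>2 * h m"
        unfolding h_def by (rule strip_trace_estimate[OF phi v H T lims TK d])
      have "(LINT x|M. (pd i (\<psi> m) x)\<^sup>2) \<le> (LINT x|M. ?k\<^sup>2 * (indicator ?S x * 1\<^sup>2))"
      proof (intro integral_mono pi integrable_mult_right integrable_strip)
        fix x assume "x \<in> space M"
        then have x: "x \<in> E" by simp
        have "\<bar>pd i (\<psi> m) x\<bar>\<^sup>2 \<le> ?k\<^sup>2" using pd_le[of x] by (intro power_mono) auto
        then show "(pd i (\<psi> m) x)\<^sup>2 \<le> ?k\<^sup>2 * (indicator ?S x * 1\<^sup>2)"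
          using pd_0[OF x] by (cases "x \<in> ?S") auto
      qed (intro continuous_integrable continuous_intros)
      also have "\<dots> = ?k\<^sup>2 * (LINT x|M. indicator ?S x * 1\<^sup>2)" by simp
      also have "\<dots> \<le> ?k\<^sup>2 * (4 * \<delta> m * ?V)"
      proof (rule mult_left_mono)
        \<comment> \<open>The area of the strip is bounded by the strip inequality for the constant
          function 1, with b = 0 and K = 1.\<close>
        have g1: "grad (\<lambda>x::real^2. 1::real) x = 0" for x by (rule grad_eqI) simp
        show "(LINT x|M. indicator ?S x * 1\<^sup>2) \<le> 4 * \<delta> m * ?V"
          using strip_estimate_real[OF smooth_const[of 1], of "1 - \<delta> m" "\<lambda>_. 0" 1] d[of m] by (simp add: g1)
      qed simp
      finally show "(LINT x|M. (pd i (\<psi> m) x)\<^sup>2) \<le> ?k\<^sup>2 * (4 * \<delta> m * ?V)" .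
      have "0 \<le> h m" unfolding h_def by (intro Bochner_Integration.integral_nonneg) auto
      then show "0 \<le> 8 * \<delta> m * K\<^sup>2 * ?V + 16 * \<rho>'\<^sup>2 * (\<delta> m)\<^sup>2 * h m" using d[of m] by simp
    qed simp
    \<comment> \<open>Only the product of cutoff gradient and width remains; the surplus factor
      \<open>\<delta> m\<close> is then bounded by 1.\<close>
    also have "\<dots> = (?k * \<delta> m)\<^sup>2 * (32 * K\<^sup>2 * ?V\<^sup>2) + (?k * \<delta> m)\<^sup>2 * (64 * \<rho>'\<^sup>2 * ?V * h m) * \<delta> m"
      by (simp add: power2_eq_square algebra_simps)
    also have "?k * \<delta> m = kappa" using d[of m] by (simp add: kappa_def)
    also have "kappa\<^sup>2 * (32 * K\<^sup>2 * ?V\<^sup>2) + kappa\<^sup>2 * (64 * \<rho>'\<^sup>2 * ?V * h m) * \<delta> m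
        \<le> kappa\<^sup>2 * (32 * K\<^sup>2 * ?V\<^sup>2) + kappa\<^sup>2 * (64 * \<rho>'\<^sup>2 * ?V * h m) * 1"
    proof (intro add_left_mono mult_left_mono)
      have "0 \<le> h m" unfolding h_def by (intro Bochner_Integration.integral_nonneg) auto
      then show "0 \<le> kappa\<^sup>2 * (64 * \<rho>'\<^sup>2 * ?V * h m)" by simp
    qed (use d[of m] in simp)
    finally show ?thesis by (simp add: mult_ac)
  qed
  have "(LINT x|M. H x $ i)\<^sup>2 \<le> 32 * kappa\<^sup>2 * K\<^sup>2 * ?V\<^sup>2 + 64 * kappa\<^sup>2 * \<rho>'\<^sup>2 * ?V * 0"
  proof (rule LIMSEQ_le)
    show "(\<lambda>m. (LINT x|M. \<psi> m x * H x $ i)\<^sup>2) \<longlonglongrightarrow> (LINT x|M. H x $ i)\<^sup>2"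
      by (intro tendsto_power cutoff_integral_tendsto[OF Hc psi(1,2)]) (use psi(4) in \<open>auto simp: \<delta>_def\<close>)
    have "h \<longlonglongrightarrow> 0" unfolding h_def \<delta>_def by (rule strip_integral_tendsto[OF Hi])
    then show "(\<lambda>m. 32 * kappa\<^sup>2 * K\<^sup>2 * ?V\<^sup>2 + 64 * kappa\<^sup>2 * \<rho>'\<^sup>2 * ?V * h m) \<longlonglongrightarrow>
        32 * kappa\<^sup>2 * K\<^sup>2 * ?V\<^sup>2 + 64 * kappa\<^sup>2 * \<rho>'\<^sup>2 * ?V * 0"
      by (intro tendsto_intros)
  qed (use step in blast)
  \<comment> \<open>32 is enlarged to a perfect square.\<close>
  also have "\<dots> \<le> 36 * kappa\<^sup>2 * K\<^sup>2 * ?V\<^sup>2" by simp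
  also have "\<dots> = (6 * kappa * K * ?V)\<^sup>2" by (simp add: power_mult_distrib)
  finally have "\<bar>LINT x|M. H x $ i\<bar> \<le> \<bar>6 * kappa * K * ?V\<bar>" unfolding abs_le_square_iff .
  moreover have "0 \<le> 6 * kappa * K * ?V" using kappa_pos K by simp
  ultimately show ?thesis by linarith
qed

text \<open>For affine functions centred at c the defining conditions decouple: the gradient
  condition fixes the slope as the mean of the weak gradient, and then the boundary mean fixes the
  constant. This gives the unique existence that \<open>THE\<close> requires.\<close>

lemma Pi_nabla_properties:
  assumes H: "square_integrable M (weak_grad E v)" and T: "square_integrable (boundary_measure vs) (boundary_trace vs v)"
  obtains a b where "Pi_nabla vs v = (\<lambda>x. a + b \<bullet> (x - c))"
    "\<And>i. b $ i * measure lborel E = (LINT x|M. weak_grad E v x $ i)"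
    "(LINT x|boundary_measure vs. boundary_trace vs v x - (a + b \<bullet> (x - c))) = 0"
proof -
  let ?H = "weak_grad E v" and ?T = "boundary_trace vs v" and ?V = "measure lborel E"
  let ?L = "measure (boundary_measure vs) (polygon_boundary vs)"
  let ?p = "\<lambda>a b x. a + b \<bullet> (x - c)"
  have Hc: "integrable M (\<lambda>x. ?H x $ i)" for i
    by (intro square_integrable_integrable finite_measure_M component_square_integrable H)
  interpret B: finite_measure "boundary_measure vs" by (rule finite_measure_boundary)
  have Ti: "integrable (boundary_measure vs) ?T" by (intro square_integrable_integrable finite_measure_boundary T)
  have li: "integrable (boundary_measure vs) (\<lambda>x. b \<bullet> (x - c))" for b
    by (intro continuous_boundary_integrable continuous_intros)
  have key1: "(LINT x|M. (?H x - b) \<bullet> d) = (\<Sum>i\<in>UNIV. ((LINT x|M. ?H x $ i) - b $ i * ?V) * d $ i)" for b d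
  proof -
    interpret finite_measure M by (rule finite_measure_M)
    have "(LINT x|M. (?H x - b) \<bullet> d) = (LINT x|M. (\<Sum>i\<in>UNIV. (?H x $ i - b $ i) * d $ i))"
      by (simp add: inner_vec_def)
    also have "\<dots> = (\<Sum>i\<in>UNIV. LINT x|M. (?H x $ i - b $ i) * d $ i)"
      by (rule Bochner_Integration.integral_sum) (intro integrable_mult_left Bochner_Integration.integrable_diff Hc, simp)
    also have "\<dots> = (\<Sum>i\<in>UNIV. ((LINT x|M. ?H x $ i) - b $ i * ?V) * d $ i)"
      using Hc by (intro sum.cong refl) (simp add: integral_const_M[simplified] measure_M mult.commute)
    finally show ?thesis .
  qed
  have key2: "(LINT x|boundary_measure vs. ?T x - ?p a b x) =
      (LINT x|boundary_measure vs. ?T x) - a * ?L - (LINT x|boundary_measure vs. b \<bullet> (x - c))" for a b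
    using Ti li[of b] by (simp add: mult.commute)
  define Q where "Q p \<longleftrightarrow> p \<in> P1 \<and>
     (\<forall>q\<in>P1. (LINT x|M. (?H x - grad p x) \<bullet> grad q x) = 0) \<and>
     (LINT x|boundary_measure vs. ?T x - p x) = 0" for p
  have Q_iff: "Q (?p a b) \<longleftrightarrow> (\<forall>i. b $ i * ?V = (LINT x|M. ?H x $ i)) \<and>
      a * ?L = (LINT x|boundary_measure vs. ?T x) - (LINT x|boundary_measure vs. b \<bullet> (x - c))" for a b
  proof -
    have "(\<forall>q\<in>P1. (LINT x|M. (?H x - grad (?p a b) x) \<bullet> grad q x) = 0) \<longleftrightarrow> (\<forall>i. b $ i * ?V = (LINT x|M. ?H x $ i))"
    proof
      assume L: "\<forall>q\<in>P1. (LINT x|M. (?H x - grad (?p a b) x) \<bullet> grad q x) = 0"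
      show "\<forall>i. b $ i * ?V = (LINT x|M. ?H x $ i)"
      proof
        fix i :: 2
        have "(LINT x|M. (?H x - grad (?p a b) x) \<bullet> grad (?p 0 (axis i 1)) x) = 0"
          using L affine_P1 by blast
        then have "(\<Sum>j\<in>UNIV. ((LINT x|M. ?H x $ j) - b $ j * ?V) * axis i 1 $ j) = 0"
          unfolding grad_affine_fun key1 .
        then show "b $ i * ?V = (LINT x|M. ?H x $ i)" unfolding sum_mult_axis by simp
      qed
    next
      assume R: "\<forall>i. b $ i * ?V = (LINT x|M. ?H x $ i)"
      show "\<forall>q\<in>P1. (LINT x|M. (?H x - grad (?p a b) x) \<bullet> grad q x) = 0"
      proof
        fix q assume "q \<in> P1"
        then obtain a' b' where q: "q = ?p a' b'" using P1_affine[of q c] by (auto simp: fun_eq_iff)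
        show "(LINT x|M. (?H x - grad (?p a b) x) \<bullet> grad q x) = 0"
          unfolding q grad_affine_fun key1 using R by simp
      qed
    qed
    then show ?thesis unfolding Q_def key2 using affine_P1[of a b c] by auto
  qed
  define b0 where "b0 = (\<chi> i. (LINT x|M. ?H x $ i) / ?V)"
  define a0 where "a0 = ((LINT x|boundary_measure vs. ?T x) - (LINT x|boundary_measure vs. b0 \<bullet> (x - c))) / ?L"
  have V: "0 < ?V" and L: "0 < ?L" by (rule measure_E_pos boundary_measure_pos)+
  have Q0: "Q (?p a0 b0)" unfolding Q_iff using V L by (simp add: a0_def b0_def)
  have "p = ?p a0 b0" if "Q p" for p
  proof -
    have "p \<in> P1" using that by (simp add: Q_def)
    then obtain a b where p: "p = ?p a b" using P1_affine[of p c] by (auto simp: fun_eq_iff)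
    have ab: "\<forall>i. b $ i * ?V = (LINT x|M. ?H x $ i)"
      "a * ?L = (LINT x|boundary_measure vs. ?T x) - (LINT x|boundary_measure vs. b \<bullet> (x - c))"
      using that unfolding p Q_iff by blast+
    have "b = b0" using ab(1) V by (simp add: vec_eq_iff b0_def field_simps)
    moreover have "a = a0" using ab(2) L unfolding a0_def \<open>b = b0\<close> by (simp add: field_simps)
    ultimately show ?thesis using p by simp
  qed
  then have "(THE p. Q p) = ?p a0 b0" using Q0 by blast
  then have "Pi_nabla vs v = ?p a0 b0" unfolding Pi_nabla_def Q_def .
  moreover have "\<forall>i. b0 $ i * ?V = (LINT x|M. ?H x $ i)" using Q0 unfolding Q_iff by blast
  moreover have "(LINT x|boundary_measure vs. ?T x - ?p a0 b0 x) = 0" using Q0 unfolding Q_def by blast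
  ultimately show ?thesis using that by blast
qed

end

section \<open>The Laplacian\<close>

lemma ex_bound_compact_support:
  fixes f :: "real^2 \<Rightarrow> real"
  assumes "continuous_on UNIV f" "\<And>x. R \<le> norm x \<Longrightarrow> f x = 0"
  shows "\<exists>s. \<forall>x. \<bar>f x\<bar> \<le> s"
proof -
  have "bounded (f ` cball 0 R)"
    by (intro compact_imp_bounded compact_continuous_image continuous_on_subset[OF assms(1)]) auto
  then have "\<exists>s. \<forall>x\<in>cball 0 R. \<bar>f x\<bar> \<le> s" by (simp add: bounded_iff)
  then obtain s where "\<forall>x\<in>cball 0 R. \<bar>f x\<bar> \<le> s" by blast
  then have s: "\<bar>f x\<bar> \<le> s" if "norm x \<le> R" for x using that by simp
  have "\<bar>f x\<bar> \<le> max s 0" for x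
    using s[of x] assms(2)[of x] by (cases "norm x \<le> R") auto
  then show ?thesis by blast
qed

lemma laplacian_eq_0_of_open:
  assumes "open S" "x \<in> S" "\<And>y. y \<in> S \<Longrightarrow> f y = 0"
  shows "laplacian f x = 0"
proof -
  have "pd i f y = 0" if "y \<in> S" for y i using pd_eq_0_of_open[OF assms(1) that assms(3)] .
  then have "pd i (pd i f) x = 0" for i using pd_eq_0_of_open[OF assms(1,2)] by blast
  then show ?thesis by (simp add: laplacian_def)
qed

lemma ex_lap_const: "\<exists>s>0. \<forall>x. \<bar>laplacian bump x\<bar> \<le> s \<and> (\<forall>i. \<bar>laplacian (pd i bump) x\<bar> \<le> s)"
proof -
  have S: "open (- cball (0::real^2) (1/2))" by auto
  have b: "bump y = 0" "pd i bump y = 0" if "y \<in> - cball (0::real^2) (1/2)" for y i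
    using that by (auto intro!: bump_eq_0 pd_bump_eq_0)
  have "\<exists>s. \<forall>x. \<bar>laplacian bump x\<bar> \<le> s"
    by (rule ex_bound_compact_support[where R=1])
      (auto intro!: continuous_laplacian smooth_bump laplacian_eq_0_of_open[OF S] b)
  then obtain s where s: "\<And>x. \<bar>laplacian bump x\<bar> \<le> s" by blast
  have "\<exists>s. \<forall>x. \<bar>laplacian (pd i bump) x\<bar> \<le> s" for i
    by (rule ex_bound_compact_support[where R=1])
      (auto intro!: continuous_laplacian smooth_pd smooth_bump laplacian_eq_0_of_open[OF S] b)
  then obtain t where t: "\<And>i x. \<bar>laplacian (pd i bump) x\<bar> \<le> t i" by metis
  define u where "u = max 1 (max s (max (t 1) (t 2)))"
  have "\<bar>laplacian (pd i bump) x\<bar> \<le> u" for i x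
    using t[of i x] exhaust_2[of i] by (auto simp: u_def le_max_iff_disj)
  moreover have "\<bar>laplacian bump x\<bar> \<le> u" for x using s[of x] by (simp add: u_def le_max_iff_disj)
  moreover have "0 < u" by (simp add: u_def less_max_iff_disj)
  ultimately show ?thesis by blast
qed

text \<open>The derivatives of \<open>bump\<close> are included because they test for the slope of
  the affine Laplacian, while \<open>bump\<close> itself tests for its value at the centre.\<close>

definition lap_const :: real where
  "lap_const = (SOME s. 0 < s \<and> (\<forall>x. \<bar>laplacian bump x\<bar> \<le> s \<and> (\<forall>i. \<bar>laplacian (pd i bump) x\<bar> \<le> s)))"

lemma lap_const:
  "0 < lap_const" "\<bar>laplacian bump x\<bar> \<le> lap_const" "\<bar>laplacian (pd i bump) x\<bar> \<le> lap_const"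
proof -
  have "\<exists>s. 0 < s \<and> (\<forall>x. \<bar>laplacian bump x\<bar> \<le> s \<and> (\<forall>i. \<bar>laplacian (pd i bump) x\<bar> \<le> s))"
    using ex_lap_const by blast
  from someI_ex[OF this]
  have *: "0 < lap_const \<and> (\<forall>x. \<bar>laplacian bump x\<bar> \<le> lap_const \<and> (\<forall>i. \<bar>laplacian (pd i bump) x\<bar> \<le> lap_const))"
    unfolding lap_const_def .
  show "0 < lap_const" using * by simp
  show "\<bar>laplacian bump x\<bar> \<le> lap_const" using * by simp
  show "\<bar>laplacian (pd i bump) x\<bar> \<le> lap_const" using * by simp
qed

definition bump_mass :: real where "bump_mass = (LINT x|lborel. bump x)"

lemma lborel_integral_affine:
  fixes f :: "real^2 \<Rightarrow> real"
  assumes [measurable]: "f \<in> borel_measurable borel" and s: "s \<noteq> 0"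
  shows "(LINT x|lborel. f x) = s\<^sup>2 * (LINT x|lborel. f (s *\<^sub>R x + t))"
proof -
  have "(LINT x|lborel. f x) = (LINT x|density (distr lborel borel (\<lambda>x. t + s *\<^sub>R x)) (\<lambda>_. ennreal (\<bar>s\<bar> ^ DIM(real^2))). f x)"
    using lborel_affine[OF s, of t] by simp
  also have "\<dots> = s\<^sup>2 * (LINT x|lborel. f (t + s *\<^sub>R x))"
    by (subst integral_density) (auto simp: integral_distr)
  finally show ?thesis by (simp add: add.commute)
qed

lemma (in finite_measure) abs_integral_le_AE:
  fixes f :: "'a \<Rightarrow> real"
  assumes "integrable M f" "AE x in M. \<bar>f x\<bar> \<le> k"
  shows "\<bar>LINT x|M. f x\<bar> \<le> k * measure M (space M)"
proof -
  have "\<bar>LINT x|M. f x\<bar> \<le> (LINT x|M. \<bar>f x\<bar>)" by (rule integral_abs_bound)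
  also have "\<dots> \<le> (LINT x|M. k)"
    by (rule integral_mono_AE) (use assms in auto)
  finally show ?thesis by (simp add: mult.commute)
qed

context star_polygon
begin

text \<open>Write the affine projection at x as its value at y plus the slope applied to x - y, and
  average over boundary points y: its boundary mean is that of the trace. The slope is at most 12
  kappa K and |x - y| \<le> 4 \<rho>', which gives the 48.\<close>

lemma Pi_nabla_bound:
  assumes phi: "\<And>n. smooth (\<phi> n)" and v: "square_integrable M v" and wg: "is_weak_gradient E v (weak_grad E v)"
    and T: "square_integrable (boundary_measure vs) (boundary_trace vs v)"
    and lims: "(\<lambda>n. LINT x|M. (\<phi> n x - v x)\<^sup>2) \<longlonglongrightarrow> 0"
      "(\<lambda>n. LINT x|M. (norm (grad (\<phi> n) x - weak_grad E v x))\<^sup>2) \<longlonglongrightarrow> 0"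
      "(\<lambda>n. LINT x|boundary_measure vs. (\<phi> n x - boundary_trace vs v x)\<^sup>2) \<longlonglongrightarrow> 0"
    and TK: "AE x in boundary_measure vs. \<bar>boundary_trace vs v x\<bar> \<le> K" and K: "0 \<le> K"
  shows "continuous_on UNIV (Pi_nabla vs v)" "x \<in> E \<Longrightarrow> \<bar>Pi_nabla vs v x\<bar> \<le> (1 + 48 * \<rho>' * kappa) * K"
proof -
  let ?T = "boundary_trace vs v" and ?H = "weak_grad E v" and ?B = "boundary_measure vs"
  have H: "square_integrable M ?H" using wg by (simp add: is_weak_gradient_def)
  obtain a b where p: "Pi_nabla vs v = (\<lambda>x. a + b \<bullet> (x - c))"
    and b: "\<And>i. b $ i * measure lborel E = (LINT x|M. ?H x $ i)"
    and m: "(LINT x|?B. ?T x - (a + b \<bullet> (x - c))) = 0"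
    using Pi_nabla_properties[OF H T] by blast
  show "continuous_on UNIV (Pi_nabla vs v)" unfolding p by (intro continuous_intros)
  have V: "0 < measure lborel E" by (rule measure_E_pos)
  have bi: "\<bar>b $ i\<bar> \<le> 6 * kappa * K" for i
  proof -
    have "\<bar>b $ i\<bar> * measure lborel E = \<bar>LINT x|M. ?H x $ i\<bar>" using V by (simp add: abs_mult flip: b)
    also have "\<dots> \<le> (6 * kappa * K) * measure lborel E"
      by (rule integral_gradient_bound[OF phi v wg T lims TK K])
    finally show ?thesis using V by simp
  qed
  have nb: "norm b \<le> 12 * kappa * K"
  proof -
    have "norm b \<le> (\<Sum>i\<in>UNIV. \<bar>b $ i\<bar>)" by (rule norm_le_l1_cart)
    also have "\<dots> \<le> 6 * kappa * K + 6 * kappa * K" unfolding sum_2 by (intro add_mono bi)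
    finally show ?thesis by (simp add: mult_ac)
  qed
  show "\<bar>Pi_nabla vs v x\<bar> \<le> (1 + 48 * \<rho>' * kappa) * K" if x: "x \<in> E"
  proof -
    interpret B: finite_measure ?B by (rule finite_measure_boundary)
    let ?L = "measure ?B (polygon_boundary vs)"
    have L: "0 < ?L" by (rule boundary_measure_pos)
    have Ti: "integrable ?B ?T" by (intro square_integrable_integrable finite_measure_boundary T)
    have li: "integrable ?B (\<lambda>y. b \<bullet> (x - y))" by (intro continuous_boundary_integrable continuous_intros)
    have li': "integrable ?B (\<lambda>y. a + b \<bullet> (y - c))" by (intro continuous_boundary_integrable continuous_intros)
    have "(a + b \<bullet> (x - c)) * ?L = (LINT y|?B. (a + b \<bullet> (y - c)) + b \<bullet> (x - y))"
    proof -
      have "(LINT y|?B. (a + b \<bullet> (y - c)) + b \<bullet> (x - y)) = (LINT y|?B. a + b \<bullet> (x - c))"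
        by (intro Bochner_Integration.integral_cong) (auto simp: inner_diff_right)
      then show ?thesis by simp
    qed
    also have "\<dots> = (LINT y|?B. a + b \<bullet> (y - c)) + (LINT y|?B. b \<bullet> (x - y))"
      by (rule Bochner_Integration.integral_add[OF li' li])
    also have "(LINT y|?B. a + b \<bullet> (y - c)) = (LINT y|?B. ?T y)"
      using m Bochner_Integration.integral_diff[OF Ti li'] by simp
    also have "(LINT y|?B. ?T y) + (LINT y|?B. b \<bullet> (x - y)) = (LINT y|?B. ?T y + b \<bullet> (x - y))"
      by (rule Bochner_Integration.integral_add[OF Ti li, symmetric])
    finally have eq: "(a + b \<bullet> (x - c)) * ?L = (LINT y|?B. ?T y + b \<bullet> (x - y))" .
    have "\<bar>LINT y|?B. ?T y + b \<bullet> (x - y)\<bar> \<le> ((1 + 48 * \<rho>' * kappa) * K) * measure ?B (space ?B)"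
    proof (rule B.abs_integral_le_AE)
      show "integrable ?B (\<lambda>y. ?T y + b \<bullet> (x - y))" using Ti li by simp
      have "AE y in ?B. y \<in> polygon_boundary vs" using AE_space[of ?B] by simp
      with TK show "AE y in ?B. \<bar>?T y + b \<bullet> (x - y)\<bar> \<le> (1 + 48 * \<rho>' * kappa) * K"
      proof eventually_elim
        case (elim y)
        have "y \<in> closure E" "x \<in> closure E"
          using elim(2) x closure_subset unfolding frontier_E[symmetric] by (auto simp: frontier_def)
        then have "norm (x - c) \<le> 2 * \<rho>'" "norm (y - c) \<le> 2 * \<rho>'" by (auto intro: dist_centre)
        then have d: "norm (x - y) \<le> 4 * \<rho>'" using norm_triangle_ineq4[of "x - c" "y - c"] by simp
        have "\<bar>b \<bullet> (x - y)\<bar> \<le> norm b * norm (x - y)" by (rule Cauchy_Schwarz_ineq2)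
        also have "\<dots> \<le> (12 * kappa * K) * (4 * \<rho>')"
          using nb d K kappa_pos by (intro mult_mono) auto
        finally have "\<bar>?T y + b \<bullet> (x - y)\<bar> \<le> K + (12 * kappa * K) * (4 * \<rho>')"
          using elim(1) by linarith
        then show ?case by (simp add: algebra_simps)
      qed
    qed
    then have "\<bar>a + b \<bullet> (x - c)\<bar> * ?L \<le> ((1 + 48 * \<rho>' * kappa) * K) * ?L"
      using L unfolding eq[symmetric] by (simp add: abs_mult)
    then show ?thesis using L unfolding p by simp
  qed
qed

lemma norm_rescale: "norm (inverse \<rho> *\<^sub>R x + - (inverse \<rho> *\<^sub>R c)) = norm (x - c) / \<rho>"
proof -
  have "inverse \<rho> *\<^sub>R x + - (inverse \<rho> *\<^sub>R c) = inverse \<rho> *\<^sub>R (x - c)" by (simp add: scaleR_diff_right)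
  then show ?thesis using rho_pos by (simp add: divide_inverse mult.commute)
qed

lemma bump_test_function:
  "test_function E (\<lambda>x. bump (inverse \<rho> *\<^sub>R x + - (inverse \<rho> *\<^sub>R c)))" (is "test_function E ?\<psi>")
  "test_function E (\<lambda>x. pd i bump (inverse \<rho> *\<^sub>R x + - (inverse \<rho> *\<^sub>R c)))"
proof -
  have sub: "cball c (\<rho> / 2) \<subseteq> E" using ball_subset rho_pos by (auto simp: subset_iff)
  have mem: "x \<in> cball c (\<rho> / 2)" if "\<not> 1 / 2 \<le> norm (inverse \<rho> *\<^sub>R x + - (inverse \<rho> *\<^sub>R c))" for x
    using that rho_pos unfolding norm_rescale by (simp add: dist_norm norm_minus_commute field_simps)
  show "test_function E ?\<psi>"
    by (rule test_functionI[OF _ compact_cball sub])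
      (intro smooth_affine smooth_bump, rule mem, use bump_eq_0 in blast)
  show "test_function E (\<lambda>x. pd i bump (inverse \<rho> *\<^sub>R x + - (inverse \<rho> *\<^sub>R c)))"
    by (rule test_functionI[OF _ compact_cball sub])
      (intro smooth_affine smooth_pd smooth_bump, rule mem, use pd_bump_eq_0 in blast)
qed

text \<open>An inverse estimate. An affine function is determined by its moments on the inner ball,
  and its moments against rescaled bumps are those of v against their Laplacians, which are of size
  1/\<rho>^2. The area \<rho>^2 of the bump supplies the other half of \<rho>^4.\<close>

lemma coefficient_bound:
  assumes v: "square_integrable M v" and lap: "has_distributional_laplacian E v (\<lambda>x. a + b \<bullet> (x - c))"
  defines "N \<equiv> LINT x|M. \<bar>v x\<bar>"
  shows "x \<in> E \<Longrightarrow> \<bar>a + b \<bullet> (x - c)\<bar> \<le> N / \<rho> ^ 4 * (lap_const / bump_mass * (3 + 4 * (\<rho>' / \<rho>)))"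
proof -
  let ?y = "\<lambda>x. inverse \<rho> *\<^sub>R x + - (inverse \<rho> *\<^sub>R c)"
  let ?\<psi> = "\<lambda>x. bump (?y x)"
  let ?p = "\<lambda>x. a + b \<bullet> (x - c)"
  have Z: "0 < bump_mass" unfolding bump_mass_def by (rule integral_bump_pos)
  have r: "0 < \<rho>" by (rule rho_pos)
  have pos: "0 < \<rho>\<^sup>2 * bump_mass" using r Z by simp
  have vi: "integrable M (\<lambda>x. \<bar>v x\<bar>)"
    by (intro integrable_abs square_integrable_integrable finite_measure_M v)
  have N: "0 \<le> N" unfolding N_def by simp
  have test: "\<bar>LINT x|M. ?p x * g (?y x)\<bar> \<le> lap_const / \<rho>\<^sup>2 * N"
    if g: "smooth g" "test_function E (\<lambda>x. g (?y x))" "\<And>x. \<bar>laplacian g x\<bar> \<le> lap_const" for g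
  proof -
    have le: "\<bar>laplacian (\<lambda>x. g (?y x)) x\<bar> \<le> lap_const / \<rho>\<^sup>2" for x
    proof -
      have "\<bar>laplacian (\<lambda>x. g (?y x)) x\<bar> = (inverse \<rho>)\<^sup>2 * \<bar>laplacian g (?y x)\<bar>"
        unfolding laplacian_affine[OF g(1)] by (simp add: abs_mult)
      also have "\<dots> \<le> (inverse \<rho>)\<^sup>2 * lap_const" by (intro mult_left_mono g(3)) simp
      finally show ?thesis by (simp add: divide_inverse power_inverse mult.commute)
    qed
    have lc: "continuous_on UNIV (laplacian (\<lambda>x. g (?y x)))"
      by (rule continuous_laplacian[OF test_function_smooth[OF g(2)]])
    have "(LINT x|M. ?p x * g (?y x)) = (LINT x|M. v x * laplacian (\<lambda>x. g (?y x)) x)"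
      using lap g(2) by (simp add: has_distributional_laplacian_def)
    also have "\<bar>\<dots>\<bar> \<le> (LINT x|M. \<bar>v x * laplacian (\<lambda>x. g (?y x)) x\<bar>)" by (rule integral_abs_bound)
    also have "\<dots> \<le> (LINT x|M. lap_const / \<rho>\<^sup>2 * \<bar>v x\<bar>)"
    proof (rule integral_mono)
      have "integrable M (\<lambda>x. v x * laplacian (\<lambda>x. g (?y x)) x)"
        using integrable_inner_of_squares[of v M "laplacian (\<lambda>x. g (?y x))"] v square_integrable_continuous[OF lc]
        by (simp add: square_integrable_def)
      then show "integrable M (\<lambda>x. \<bar>v x * laplacian (\<lambda>x. g (?y x)) x\<bar>)" by simp
      show "integrable M (\<lambda>x. lap_const / \<rho>\<^sup>2 * \<bar>v x\<bar>)" using vi by simp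
      show "\<bar>v x * laplacian (\<lambda>x. g (?y x)) x\<bar> \<le> lap_const / \<rho>\<^sup>2 * \<bar>v x\<bar>" for x
        using mult_right_mono[OF le[of x] abs_ge_zero[of "v x"]] by (simp add: abs_mult mult.commute)
    qed
    also have "\<dots> = lap_const / \<rho>\<^sup>2 * N" unfolding N_def by simp
    finally show ?thesis .
  qed
  have mass: "(LINT x|M. ?\<psi> x) = \<rho>\<^sup>2 * bump_mass"
  proof -
    have "(LINT x|M. ?\<psi> x) = (LINT x|lborel. ?\<psi> x)"
      by (intro integral_M_lborel smooth_continuous test_function_smooth[OF bump_test_function(1)]
          test_function_mem[OF bump_test_function(1)])
    moreover have "bump_mass = (inverse \<rho>)\<^sup>2 * (LINT x|lborel. ?\<psi> x)"
      unfolding bump_mass_def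
      using r by (intro lborel_integral_affine borel_measurable_continuous_onI smooth_continuous smooth_bump) simp
    ultimately show ?thesis using r by (simp add: field_simps)
  qed
  have psi_c: "continuous_on UNIV ?\<psi>"
    by (rule smooth_continuous[OF test_function_smooth[OF bump_test_function(1)]])
  have bi: "\<bar>b $ i\<bar> \<le> lap_const * N / (bump_mass * \<rho> ^ 5)" for i
  proof -
    have "smooth ?p" by (rule smooth_P1[OF affine_P1])
    \<comment> \<open>Moving the derivative from the bump to the affine function isolates the slope,
      which is constant.\<close>
    from integral_by_parts[OF this bump_test_function(1), of i]
    have "(LINT x|M. ?p x * pd i ?\<psi> x) = - (LINT x|M. pd i ?p x * ?\<psi> x)" .
    also have "pd i ?p = (\<lambda>x. b $ i)"
      using grad_affine_fun[of a b c] by (auto simp: grad_def fun_eq_iff vec_eq_iff)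
    also have "pd i ?\<psi> = (\<lambda>x. inverse \<rho> * pd i bump (?y x))"
      by (intro ext pd_affine smooth_differentiable smooth_bump)
    finally have "inverse \<rho> * (LINT x|M. ?p x * pd i bump (?y x)) = - (b $ i * (\<rho>\<^sup>2 * bump_mass))"
      using mass by (simp add: mult.left_commute)
    then have "\<bar>b $ i * (\<rho>\<^sup>2 * bump_mass)\<bar> = \<bar>inverse \<rho> * (LINT x|M. ?p x * pd i bump (?y x))\<bar>"
      by simp
    then have "\<bar>b $ i\<bar> * (\<rho>\<^sup>2 * bump_mass) = inverse \<rho> * \<bar>LINT x|M. ?p x * pd i bump (?y x)\<bar>"
      unfolding abs_mult using r Z by simp
    also have "\<dots> \<le> inverse \<rho> * (lap_const / \<rho>\<^sup>2 * N)"
      using r by (intro mult_left_mono test smooth_pd smooth_bump bump_test_function lap_const) auto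
    finally have "\<bar>b $ i\<bar> \<le> inverse \<rho> * (lap_const / \<rho>\<^sup>2 * N) / (\<rho>\<^sup>2 * bump_mass)"
      using pos by (simp only: pos_le_divide_eq)
    also have "\<dots> = lap_const * N / (bump_mass * \<rho> ^ 5)"
      using r Z by (simp add: field_simps power_numeral_reduce power2_eq_square)
    finally show ?thesis .
  qed
  define nb where "nb = 2 * (lap_const * N / (bump_mass * \<rho> ^ 5))"
  have nb: "norm b \<le> nb"
  proof -
    have "norm b \<le> (\<Sum>i\<in>UNIV. \<bar>b $ i\<bar>)" by (rule norm_le_l1_cart)
    also have "\<dots> \<le> lap_const * N / (bump_mass * \<rho> ^ 5) + lap_const * N / (bump_mass * \<rho> ^ 5)"
      unfolding sum_2 by (intro add_mono bi)
    also have "\<dots> = nb" unfolding nb_def by (rule mult_2[symmetric])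
    finally show ?thesis .
  qed
  have nb0: "0 \<le> nb" using nb norm_ge_zero[of b] by linarith
  have a: "\<bar>a\<bar> \<le> lap_const * N / (bump_mass * \<rho> ^ 4) + \<rho> * nb"
  proof -
    have i1: "integrable M (\<lambda>x. a * ?\<psi> x)" and i2: "integrable M (\<lambda>x. b \<bullet> (x - c) * ?\<psi> x)"
      and i3: "integrable M ?\<psi>"
      by (intro continuous_integrable continuous_intros psi_c)+
    have "(LINT x|M. ?p x * ?\<psi> x) = (LINT x|M. a * ?\<psi> x + b \<bullet> (x - c) * ?\<psi> x)"
      by (simp add: distrib_right)
    also have "\<dots> = a * (\<rho>\<^sup>2 * bump_mass) + (LINT x|M. b \<bullet> (x - c) * ?\<psi> x)"
      using Bochner_Integration.integral_add[OF i1 i2] mass by simp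
    finally have eq: "a * (\<rho>\<^sup>2 * bump_mass) = (LINT x|M. ?p x * ?\<psi> x) - (LINT x|M. b \<bullet> (x - c) * ?\<psi> x)" by simp
    have "\<bar>LINT x|M. b \<bullet> (x - c) * ?\<psi> x\<bar> \<le> (LINT x|M. \<bar>b \<bullet> (x - c) * ?\<psi> x\<bar>)" by (rule integral_abs_bound)
    also have "\<dots> \<le> (LINT x|M. (nb * \<rho>) * ?\<psi> x)"
    proof (rule integral_mono)
      show "integrable M (\<lambda>x. \<bar>b \<bullet> (x - c) * ?\<psi> x\<bar>)" using i2 by simp
      show "integrable M (\<lambda>x. (nb * \<rho>) * ?\<psi> x)" using i3 by simp
      fix x
      show "\<bar>b \<bullet> (x - c) * ?\<psi> x\<bar> \<le> (nb * \<rho>) * ?\<psi> x"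
      proof (cases "?\<psi> x = 0")
        case False
        then have "\<not> 1 / 2 \<le> norm (?y x)" using bump_eq_0 by blast
        then have "norm (x - c) \<le> \<rho>" using r unfolding norm_rescale by (simp add: field_simps)
        have "\<bar>b \<bullet> (x - c)\<bar> \<le> norm b * norm (x - c)" by (rule Cauchy_Schwarz_ineq2)
        also have "\<dots> \<le> nb * \<rho>" using nb nb0 \<open>norm (x - c) \<le> \<rho>\<close> by (intro mult_mono) auto
        finally have "\<bar>b \<bullet> (x - c)\<bar> * ?\<psi> x \<le> (nb * \<rho>) * ?\<psi> x" by (intro mult_right_mono bump_nonneg)
        then show ?thesis using bump_nonneg[of "?y x"] by (simp add: abs_mult)
      qed simp
    qed
    also have "\<dots> = nb * \<rho> * (\<rho>\<^sup>2 * bump_mass)" using mass by simp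
    finally have "\<bar>a * (\<rho>\<^sup>2 * bump_mass)\<bar> \<le> lap_const / \<rho>\<^sup>2 * N + nb * \<rho> * (\<rho>\<^sup>2 * bump_mass)"
      using test[OF smooth_bump bump_test_function(1) lap_const(2)] unfolding eq by linarith
    moreover have "\<bar>a * (\<rho>\<^sup>2 * bump_mass)\<bar> = \<bar>a\<bar> * (\<rho>\<^sup>2 * bump_mass)" using Z by (simp add: abs_mult)
    ultimately have "\<bar>a\<bar> \<le> (lap_const / \<rho>\<^sup>2 * N + nb * \<rho> * (\<rho>\<^sup>2 * bump_mass)) / (\<rho>\<^sup>2 * bump_mass)"
      using pos by (simp only: pos_le_divide_eq)
    also have "\<dots> = lap_const * N / (bump_mass * \<rho> ^ 4) + \<rho> * nb"
    proof -
      have "nb * \<rho> * (\<rho>\<^sup>2 * bump_mass) / (\<rho>\<^sup>2 * bump_mass) = \<rho> * nb" using r Z by simp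
      moreover have "lap_const / \<rho>\<^sup>2 * N / (\<rho>\<^sup>2 * bump_mass) = lap_const * N / (bump_mass * \<rho> ^ 4)"
      proof -
        have "\<rho> ^ 4 = \<rho>\<^sup>2 * \<rho>\<^sup>2" by (simp flip: power_add)
        then show ?thesis by (simp add: mult_ac)
      qed
      ultimately show ?thesis by (simp only: add_divide_distrib)
    qed
    finally show ?thesis .
  qed
  show "\<bar>a + b \<bullet> (x - c)\<bar> \<le> N / \<rho> ^ 4 * (lap_const / bump_mass * (3 + 4 * (\<rho>' / \<rho>)))" if x: "x \<in> E"
  proof -
    have "norm (x - c) \<le> 2 * \<rho>'" using x closure_subset by (intro dist_centre) auto
    have "\<bar>b \<bullet> (x - c)\<bar> \<le> norm b * norm (x - c)" by (rule Cauchy_Schwarz_ineq2)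
    also have "\<dots> \<le> nb * (2 * \<rho>')" using nb nb0 \<open>norm (x - c) \<le> 2 * \<rho>'\<close> by (intro mult_mono) auto
    finally have "\<bar>a + b \<bullet> (x - c)\<bar> \<le> lap_const * N / (bump_mass * \<rho> ^ 4) + \<rho> * nb + nb * (2 * \<rho>')"
      using a by linarith
    \<comment> \<open>The 3 is 1 from the bump moment plus 2 from \<open>\<rho> * nb\<close>; the 4
      comes from \<open>nb * (2 * \<rho>')\<close>.\<close>
    also have "\<dots> = N / \<rho> ^ 4 * (lap_const / bump_mass * (3 + 4 * (\<rho>' / \<rho>)))"
    proof -
      define t where "t = lap_const * N / (bump_mass * \<rho> ^ 5)"
      have \<rho>5: "\<rho> ^ 5 = \<rho> * \<rho> ^ 4" by (simp flip: power_Suc)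
      have t: "lap_const * N / (bump_mass * \<rho> ^ 4) = t * \<rho>" using r unfolding t_def \<rho>5 by simp
      have "N / \<rho> ^ 4 * (lap_const / bump_mass * (3 + 4 * (\<rho>' / \<rho>)))
          = lap_const * N / (bump_mass * \<rho> ^ 4) * (3 + 4 * (\<rho>' / \<rho>))" by (simp add: mult_ac)
      also have "\<dots> = 3 * (t * \<rho>) + 4 * (t * \<rho>')" unfolding t using r by (simp add: algebra_simps)
      finally show ?thesis unfolding nb_def t t_def[symmetric] by (simp add: algebra_simps)
    qed
    finally show ?thesis .
  qed
qed

end

section \<open>The maximum principle and the final estimate\<close>

text \<open>The factor \<open>1 + 48 * \<rho>' * kappa\<close> of the projection, written in the
  ratio of the radii.\<close>

definition grad_const :: "real \<Rightarrow> real" where "grad_const r = 1 + 192 * cutoff_const * r"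
definition coeff_const :: "real \<Rightarrow> real" where "coeff_const r = lap_const / bump_mass * (3 + 4 * r)"
text \<open>The G for which Y = X / \<rho>' satisfies Y^2 \<le> G K (Y + 4 K); the 128 is 64 times
  the factor 2 taken out of 2 Y + 8 K.\<close>

definition gap_const :: "real \<Rightarrow> real" where
  "gap_const r = 128 * (2 + grad_const r) * coeff_const r * r ^ 4"
text \<open>The 1 stands for the boundary bound K itself. The rest is the bound q r^4 (2 Y + 8 K)
  for the barrier term, with q = \<open>coeff_const r\<close> and Y \<le> (G + 4) K
  inserted.\<close>

definition sup_const :: "real \<Rightarrow> real" where
  "sup_const r = 1 + coeff_const r * r ^ 4 * (2 * gap_const r + 16)"

lemma bump_mass_pos: "0 < bump_mass"
  unfolding bump_mass_def by (rule integral_bump_pos)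

lemma const_nonneg:
  assumes "0 \<le> r"
  shows "0 \<le> grad_const r" "0 \<le> coeff_const r" "0 \<le> gap_const r" "0 < sup_const r"
proof -
  show 1: "0 \<le> grad_const r" using assms cutoff_const(1) by (simp add: grad_const_def)
  show 2: "0 \<le> coeff_const r" using assms lap_const(1) bump_mass_pos by (simp add: coeff_const_def)
  show 3: "0 \<le> gap_const r" using 1 2 by (simp add: gap_const_def)
  show "0 < sup_const r" using 2 3 by (simp add: sup_const_def add_pos_nonneg)
qed

text \<open>The self-consistency argument: \<open>X\<close> is the norm of the truncated function and \<open>L\<close> the
  supremum of the Laplacian, each bounded in terms of the other.\<close>

lemma closing_estimate:
  fixes X L K \<rho> \<rho>' :: real
  assumes pos: "0 < \<rho>" "0 < \<rho>'" "0 < K" and X: "0 \<le> X"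
    and X2: "X\<^sup>2 \<le> 64 * \<rho>' ^ 4 * (2 + grad_const (\<rho>' / \<rho>)) * K * L"
    and L: "L \<le> (2 * \<rho>' * X + 8 * K * \<rho>'\<^sup>2) / \<rho> ^ 4 * coeff_const (\<rho>' / \<rho>)"
  shows "K + L * \<rho>'\<^sup>2 \<le> sup_const (\<rho>' / \<rho>) * K"
proof -
  define r where "r = \<rho>' / \<rho>"
  \<comment> \<open>Dividing the L2 norm by \<rho>' makes it comparable with K, so that only the
    ratio r remains in the constants.\<close>
  define Y where "Y = X / \<rho>'"
  define q B G where "q = coeff_const r" and "B = 2 + grad_const r" and "G = gap_const r"
  have r: "0 \<le> r" using pos by (simp add: r_def)
  have q: "0 \<le> q" and B: "0 \<le> B" and G: "0 \<le> G"
    using const_nonneg[OF r] by (auto simp: q_def B_def G_def)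
  have XY: "X = \<rho>' * Y" and Y: "0 \<le> Y" using pos X by (auto simp: Y_def)
  have r4: "\<rho>' ^ 4 / \<rho> ^ 4 = r ^ 4" by (simp add: r_def power_divide)
  have p4: "\<rho>' ^ 4 = \<rho>'\<^sup>2 * \<rho>'\<^sup>2" by (simp flip: power_add)
  have L': "L * \<rho>'\<^sup>2 \<le> q * r ^ 4 * (2 * Y + 8 * K)"
  proof -
    have "L * \<rho>'\<^sup>2 \<le> (2 * \<rho>' * X + 8 * K * \<rho>'\<^sup>2) / \<rho> ^ 4 * q * \<rho>'\<^sup>2"
      using L unfolding q_def r_def by (intro mult_right_mono) auto
    also have "2 * \<rho>' * X + 8 * K * \<rho>'\<^sup>2 = \<rho>'\<^sup>2 * (2 * Y + 8 * K)"
      unfolding XY by (simp add: power2_eq_square algebra_simps)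
    also have "\<rho>'\<^sup>2 * (2 * Y + 8 * K) / \<rho> ^ 4 * q * \<rho>'\<^sup>2 = q * (\<rho>' ^ 4 / \<rho> ^ 4) * (2 * Y + 8 * K)"
      unfolding p4 by simp
    finally show ?thesis unfolding r4 .
  qed
  have "Y\<^sup>2 * \<rho>'\<^sup>2 \<le> 64 * B * K * (L * \<rho>'\<^sup>2) * \<rho>'\<^sup>2"
    using X2 unfolding XY r_def[symmetric] B_def[symmetric] p4 by (simp add: power_mult_distrib mult_ac)
  then have "Y\<^sup>2 \<le> 64 * B * K * (L * \<rho>'\<^sup>2)" using pos by simp
  also have "\<dots> \<le> 64 * B * K * (q * r ^ 4 * (2 * Y + 8 * K))"
    using B pos by (intro mult_left_mono L') auto
  also have "\<dots> = G * K * (Y + 4 * K)" by (simp add: G_def gap_const_def B_def q_def algebra_simps)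
  finally have Y2: "Y\<^sup>2 \<le> G * K * (Y + 4 * K)" .
  \<comment> \<open>If Y exceeded (G + 4) K, then G K < Y would make the right-hand side of the
    quadratic inequality smaller than Y^2.\<close>
  have YG: "Y \<le> (G + 4) * K"
  proof (rule ccontr)
    assume "\<not> Y \<le> (G + 4) * K"
    then have gt: "(G + 4) * K < Y" by simp
    have GK: "G * K < Y" using gt pos by (simp add: algebra_simps)
    have "G * K * (Y + 4 * K) = G * K * Y + (G * K) * (4 * K)" by (simp add: algebra_simps)
    also have "\<dots> \<le> G * K * Y + Y * (4 * K)" using GK pos by (intro add_left_mono mult_right_mono) auto
    also have "\<dots> = (G + 4) * K * Y" by (simp add: algebra_simps)
    also have "\<dots> < Y * Y"
    proof (rule mult_strict_right_mono[OF gt])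
      have "0 \<le> (G + 4) * K" using G pos by simp
      then show "0 < Y" using gt by linarith
    qed
    finally show False using Y2 by (simp add: power2_eq_square)
  qed
  have "L * \<rho>'\<^sup>2 \<le> q * r ^ 4 * (2 * ((G + 4) * K) + 8 * K)"
    using L' YG q r by (intro order_trans[OF L'] mult_left_mono) auto
  also have "\<dots> = q * r ^ 4 * (2 * G + 16) * K" by (simp add: algebra_simps)
  finally show ?thesis
    unfolding sup_const_def r_def[symmetric] q_def[symmetric] G_def[symmetric] by (simp add: algebra_simps)
qed

lemma grad_add:
  assumes "f differentiable at x" "g differentiable at x"
  shows "grad (\<lambda>x. f x + g x) x = grad f x + grad g x"
  using pd_add[OF assms] by (simp add: grad_def vec_eq_iff)

context star_polygon
begin

text \<open>The barrier L/4 |x - c|^2 has Laplacian L in the plane, so v + R is weakly subharmonic.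
  On the boundary it is at most k, because |x - c| \<le> 2 \<rho>'. For the ramp above k the energy
  estimate then has a nonpositive right-hand side, which forces v + R \<le> k.\<close>

lemma upper_bound:
  assumes phi: "\<And>n. smooth (\<phi> n)" and v: "square_integrable M v" and H: "square_integrable M H"
    and T: "square_integrable (boundary_measure vs) T"
    and lims: "(\<lambda>n. LINT x|M. (\<phi> n x - v x)\<^sup>2) \<longlonglongrightarrow> 0"
      "(\<lambda>n. LINT x|M. (norm (grad (\<phi> n) x - H x))\<^sup>2) \<longlonglongrightarrow> 0"
      "(\<lambda>n. LINT x|boundary_measure vs. (\<phi> n x - T x)\<^sup>2) \<longlonglongrightarrow> 0"
    and wp: "weak_poisson E H p" and p: "continuous_on UNIV p" "\<And>x. x \<in> E \<Longrightarrow> - L \<le> p x" and L: "0 \<le> L"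
    and TK: "AE x in boundary_measure vs. T x \<le> K"
  shows "AE x in M. v x \<le> K + L * \<rho>'\<^sup>2"
proof -
  define k where "k = K + L * \<rho>'\<^sup>2"
  \<comment> \<open>The form \<open>1 *\<^sub>R x + - c\<close> lets \<open>smooth_affine\<close>
    apply literally.\<close>
  define R where "R x = L / 4 * ((1 *\<^sub>R x + - c) \<bullet> (1 *\<^sub>R x + - c))" for x :: "real^2"
  have R: "smooth R" unfolding R_def[abs_def] by (rule smooth_cmult[OF smooth_affine[OF smooth_inner_self]])
  have Rc: "continuous_on S R" for S by (rule smooth_continuous[OF R])
  have gR: "grad R x = (L / 2) *\<^sub>R (x - c)" for x
  proof (rule grad_eqI)
    have "(R has_derivative (\<lambda>h. L / 4 * ((x - c) \<bullet> h + h \<bullet> (x - c)))) (at x)"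
      unfolding R_def[abs_def] by (auto intro!: derivative_eq_intros)
    then show "(R has_derivative (\<lambda>h. (L / 2) *\<^sub>R (x - c) \<bullet> h)) (at x)"
      by (simp add: inner_commute algebra_simps)
  qed
  have R_le: "0 \<le> R x" "x \<in> closure E \<Longrightarrow> R x \<le> L * \<rho>'\<^sup>2" for x
  proof -
    have eq: "R x = L / 4 * (norm (x - c))\<^sup>2" by (simp add: R_def power2_norm_eq_inner)
    show "0 \<le> R x" unfolding eq using L by simp
    assume "x \<in> closure E"
    then have "(norm (x - c))\<^sup>2 \<le> (2 * \<rho>')\<^sup>2" by (intro power_mono dist_centre) auto
    then have "L / 4 * (norm (x - c))\<^sup>2 \<le> L / 4 * (2 * \<rho>')\<^sup>2" using L by (intro mult_left_mono) auto
    then show "R x \<le> L * \<rho>'\<^sup>2" unfolding eq by (simp add: power_mult_distrib)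
  qed
  have sq_add: "square_integrable N (\<lambda>x. g x + h x)"
    if "square_integrable N g" "square_integrable N h" for N :: "(real^2) measure" and g h :: "real^2 \<Rightarrow> 'b::euclidean_space"
  proof -
    have "integrable N (\<lambda>x. (norm (g x - - h x))\<^sup>2)"
      using that by (intro integrable_norm_diff_square) (auto simp: square_integrable_def)
    then show ?thesis using that by (auto simp: square_integrable_def)
  qed
  let ?w = "\<lambda>x. v x + R x" and ?H = "\<lambda>x. H x + grad R x" and ?T = "\<lambda>x. T x + R x"
  let ?wn = "\<lambda>n x. \<phi> n x + R x" and ?f = "\<lambda>x. p x + L"
  let ?F = "ramp k 1"
  have w: "square_integrable M ?w" by (intro sq_add v square_integrable_continuous Rc)
  have H': "square_integrable M ?H" by (intro sq_add H square_integrable_continuous continuous_grad R)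
  have RB: "square_integrable (boundary_measure vs) R"
    unfolding square_integrable_def
    by (intro conjI borel_measurable_integrable continuous_boundary_integrable continuous_intros Rc)
  have T': "square_integrable (boundary_measure vs) ?T" by (rule sq_add[OF T RB])
  have gw: "grad (?wn n) x = grad (\<phi> n) x + grad R x" for n x
    by (intro grad_add smooth_differentiable phi R)
  have wp': "weak_poisson E ?H ?f"
    unfolding weak_poisson_def
  proof (intro allI impI)
    fix \<psi> assume t: "test_function E \<psi>"
    have s: "smooth \<psi>" by (rule test_function_smooth[OF t])
    have Hm: "H \<in> borel_measurable M" and Hi: "integrable M (\<lambda>x. (norm (H x))\<^sup>2)"
      using H by (auto simp: square_integrable_def)
    have i1: "integrable M (\<lambda>x. H x \<bullet> grad \<psi> x)"
      by (intro integrable_inner_of_squares Hm Hi borel_measurable_continuous_M continuous_integrable continuous_intros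
          continuous_grad s)
    have i2: "integrable M (\<lambda>x. grad R x \<bullet> grad \<psi> x)"
      by (intro continuous_integrable continuous_intros continuous_grad s R)
    have i3: "integrable M (\<lambda>x. p x * \<psi> x)" and i4: "integrable M (\<lambda>x. L * \<psi> x)"
      by (intro continuous_integrable continuous_intros smooth_continuous s p(1))+
    have pdR: "pd i R = (\<lambda>x. L / 2 * (x $ i - c $ i))" for i
      using gR by (auto simp: grad_def vec_eq_iff fun_eq_iff)
    have pdpdR: "pd i (pd i R) x = L / 2" for i x
    proof -
      have "((\<lambda>x. L / 2 * (x $ i - c $ i)) has_derivative (\<lambda>h. L / 2 * h $ i)) (at x)"
        by (auto intro!: derivative_eq_intros bounded_linear_imp_has_derivative[OF bounded_linear_vec_nth])
      then show ?thesis unfolding pdR by (subst pd_eqI) (auto simp: axis_def)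
    qed
    have "(LINT x|M. grad R x \<bullet> grad \<psi> x) = (LINT x|M. (\<Sum>i\<in>UNIV. pd i R x * pd i \<psi> x))"
      by (simp add: grad_def inner_vec_def)
    also have "\<dots> = (\<Sum>i\<in>UNIV. LINT x|M. pd i R x * pd i \<psi> x)"
      by (intro Bochner_Integration.integral_sum continuous_integrable continuous_intros smooth_continuous smooth_pd R s)
    also have "\<dots> = (\<Sum>i\<in>(UNIV::2 set). - (LINT x|M. L / 2 * \<psi> x))"
      by (intro sum.cong refl, subst integral_by_parts[OF smooth_pd[OF R] t]) (simp add: pdpdR)
    also have "\<dots> = - (LINT x|M. L * \<psi> x)" by (simp add: sum_2)
    finally have "(LINT x|M. grad R x \<bullet> grad \<psi> x) = - (LINT x|M. L * \<psi> x)" .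
    moreover have "(LINT x|M. H x \<bullet> grad \<psi> x) = - (LINT x|M. p x * \<psi> x)"
      using wp t by (simp add: weak_poisson_def)
    moreover have "(LINT x|M. ?H x \<bullet> grad \<psi> x) = (LINT x|M. H x \<bullet> grad \<psi> x) + (LINT x|M. grad R x \<bullet> grad \<psi> x)"
      using Bochner_Integration.integral_add[OF i1 i2] by (simp add: inner_add_left)
    moreover have "(LINT x|M. ?f x * \<psi> x) = (LINT x|M. p x * \<psi> x) + (LINT x|M. L * \<psi> x)"
      using Bochner_Integration.integral_add[OF i3 i4] by (simp add: distrib_right)
    ultimately show "(LINT x|M. ?H x \<bullet> grad \<psi> x) = - (LINT x|M. ?f x * \<psi> x)" by linarith
  qed
  have F: "truncation ?F (ramp' k 1)" by (rule truncation_ramp) simp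
  have FT: "AE x in boundary_measure vs. ?F (?T x) = 0"
  proof -
    have "AE x in boundary_measure vs. x \<in> polygon_boundary vs" using AE_space[of "boundary_measure vs"] by simp
    with TK show ?thesis
    proof eventually_elim
      case (elim x)
      have "x \<in> closure E" using elim(2) unfolding frontier_E[symmetric] by (simp add: frontier_def)
      then have "?T x \<le> k" using R_le(2)[of x] elim(1) by (simp add: k_def)
      then show ?case by (simp add: ramp_eq_0)
    qed
  qed
  have E: "(LINT x|M. (?F (?w x))\<^sup>2) \<le> 16 * \<rho>'\<^sup>2 * - (LINT x|M. ?f x * ?F (?w x))"
  proof (rule energy_estimate[where wn = ?wn and w = ?w and H = ?H and T = ?T and f = ?f and F = ?F and F' = "ramp' k 1"])
    show "smooth (?wn n)" for n by (intro smooth_add phi R)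
    show "(\<lambda>n. LINT x|M. (?wn n x - ?w x)\<^sup>2) \<longlonglongrightarrow> 0" using lims(1) by simp
    show "(\<lambda>n. LINT x|M. (norm (grad (?wn n) x - ?H x))\<^sup>2) \<longlonglongrightarrow> 0" unfolding gw using lims(2) by simp
    show "(\<lambda>n. LINT x|boundary_measure vs. (?wn n x - ?T x)\<^sup>2) \<longlonglongrightarrow> 0" using lims(3) by simp
    show "continuous_on UNIV ?f" by (intro continuous_intros p(1))
  qed (rule w H' T' wp' F FT)+
  have "0 \<le> (LINT x|M. ?f x * ?F (?w x))"
  proof (rule integral_nonneg_AE, rule AE_I2)
    fix x assume "x \<in> space M"
    then have "0 \<le> ?f x" using p(2)[of x] by simp
    then show "0 \<le> ?f x * ?F (?w x)" by (intro mult_nonneg_nonneg ramp_nonneg) simp_all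
  qed
  then have "16 * \<rho>'\<^sup>2 * - (LINT x|M. ?f x * ?F (?w x)) \<le> 0"
    by (intro mult_nonneg_nonpos) auto
  then have "(LINT x|M. (?F (?w x))\<^sup>2) = 0" using E by (intro antisym) auto
  moreover have "integrable M (\<lambda>x. (?F (?w x))\<^sup>2)"
    using truncation_square_integrable[OF F finite_measure_M w] by (simp add: square_integrable_def)
  ultimately have "AE x in M. (?F (?w x))\<^sup>2 = 0"
    by (subst (asm) integral_nonneg_eq_0_iff_AE) auto
  then show ?thesis
  proof eventually_elim
    case (elim x)
    then have "\<not> k < ?w x" using ramp_pos[of 1 k "?w x"] by auto
    then show ?case using R_le(1)[of x] by (simp add: k_def)
  qed
qed

end

lemma grad_uminus: "f differentiable at x \<Longrightarrow> grad (\<lambda>x. - f x) x = - grad f x"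
  using pd_cmult[of f x _ "- 1"] by (simp add: grad_def vec_eq_iff)

context star_polygon
begin

text \<open>K is any positive bound of the trace, since it serves as threshold and also as smoothing
  width of the truncation, which has to be positive.\<close>

lemma VE_bound:
  assumes v: "v \<in> VE vs" and K: "0 < K" and TK: "AE x in boundary_measure vs. \<bar>boundary_trace vs v x\<bar> \<le> K"
  shows "AE x in M. \<bar>v x\<bar> \<le> sup_const (\<rho>' / \<rho>) * K"
proof -
  let ?T = "boundary_trace vs v" and ?H = "weak_grad E v" and ?V = "measure lborel E"
  have vH1: "v \<in> H1 E" and tr: "\<exists>g\<in>boundary_space vs. is_boundary_trace vs v g"
    and lp: "\<exists>p\<in>P1. has_distributional_laplacian E v p"
    and orth: "\<And>q. q \<in> P1 \<Longrightarrow> (LINT x|M. (v x - Pi_nabla vs v x) * q x) = 0"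
    using v by (auto simp: VE_def)
  have vL: "square_integrable M v" and "\<exists>g. is_weak_gradient E v g" using vH1 by (auto simp: H1_def)
  from someI_ex[OF this(2)] have wg: "is_weak_gradient E v ?H" unfolding weak_grad_def .
  have H: "square_integrable M ?H" using wg by (simp add: is_weak_gradient_def)
  have "\<exists>g. is_boundary_trace vs v g" using tr by blast
  from someI_ex[OF this] have "is_boundary_trace vs v ?T" unfolding boundary_trace_def .
  then obtain \<phi> where T: "square_integrable (boundary_measure vs) ?T" and phi: "\<And>n. smooth (\<phi> n)"
    and lims: "(\<lambda>n. LINT x|M. (\<phi> n x - v x)\<^sup>2) \<longlonglongrightarrow> 0"
      "(\<lambda>n. LINT x|M. (norm (grad (\<phi> n) x - ?H x))\<^sup>2) \<longlonglongrightarrow> 0"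
      "(\<lambda>n. LINT x|boundary_measure vs. (\<phi> n x - ?T x)\<^sup>2) \<longlonglongrightarrow> 0"
    unfolding is_boundary_trace_def by blast
  obtain p0 where p0: "p0 \<in> P1" "has_distributional_laplacian E v p0" using lp by blast
  obtain a b where "\<forall>x. p0 x = a + b \<bullet> (x - c)" using P1_affine[OF p0(1)] by blast
  then have "p0 = (\<lambda>x. a + b \<bullet> (x - c))" by (simp add: fun_eq_iff)
  with p0 obtain lap: "has_distributional_laplacian E v (\<lambda>x. a + b \<bullet> (x - c))" by simp
  define p where "p = (\<lambda>x. a + b \<bullet> (x - c))"
  have lap: "has_distributional_laplacian E v p" using lap by (simp add: p_def)
  have pP: "p \<in> P1" unfolding p_def by (rule affine_P1)
  have pc: "continuous_on S p" for S by (rule P1_continuous[OF pP])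
  have wp: "weak_poisson E ?H p" by (rule weak_poisson_of_laplacian[OF vL wg lap])
  define r where "r = \<rho>' / \<rho>"
  define N where "N = (LINT x|M. \<bar>v x\<bar>)"
  define L where "L = N / \<rho> ^ 4 * coeff_const r"
  have r: "0 \<le> r" using rho_pos rho'_pos by (simp add: r_def)
  have N0: "0 \<le> N" unfolding N_def by simp
  have L0: "0 \<le> L" unfolding L_def using N0 const_nonneg(2)[OF r] rho_pos by simp
  have pL: "\<bar>p x\<bar> \<le> L" if "x \<in> E" for x
    using coefficient_bound[OF vL lap[unfolded p_def] that] unfolding p_def L_def N_def coeff_const_def r_def .
  interpret fM: finite_measure M by (rule finite_measure_M)
  have mM: "measure M (space M) = ?V" using measure_M by simp
  let ?F = "soft_threshold K"
  have F: "truncation ?F (\<lambda>t. ramp' K K t + ramp' K K (- t))" by (rule truncation_soft_threshold[OF K])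
  have FT: "AE x in boundary_measure vs. ?F (?T x) = 0"
    using TK by eventually_elim (rule soft_threshold_eq_0[OF K])
  define X2 where "X2 = (LINT x|M. (?F (v x))\<^sup>2)"
  have E: "X2 \<le> 16 * \<rho>'\<^sup>2 * - (LINT x|M. p x * ?F (v x))"
    unfolding X2_def by (rule energy_estimate[OF phi vL H T lims wp pc F FT])
  have FL: "square_integrable M (\<lambda>x. ?F (v x))" by (rule truncation_square_integrable[OF F finite_measure_M vL])
  have prod: "integrable M (\<lambda>x. p x * g x)" if "square_integrable M g" for g :: "real^2 \<Rightarrow> real"
    using integrable_inner_of_squares[of p M g] that square_integrable_continuous[OF pc] by (simp add: square_integrable_def)
  have Pi_c: "continuous_on UNIV (Pi_nabla vs v)"
    and Pi_b: "\<And>x. x \<in> E \<Longrightarrow> \<bar>Pi_nabla vs v x\<bar> \<le> grad_const r * K"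
  proof -
    show "continuous_on UNIV (Pi_nabla vs v)" by (rule Pi_nabla_bound(1)[OF phi vL wg T lims TK less_imp_le[OF K]])
    have "1 + 48 * \<rho>' * kappa = grad_const r" by (simp add: kappa_def grad_const_def r_def)
    then show "\<And>x. x \<in> E \<Longrightarrow> \<bar>Pi_nabla vs v x\<bar> \<le> grad_const r * K"
      using Pi_nabla_bound(2)[OF phi vL wg T lims TK less_imp_le[OF K]] by simp
  qed
  have Pi_L: "square_integrable M (Pi_nabla vs v)" by (rule square_integrable_continuous[OF Pi_c])
  \<comment> \<open>The Laplacian p is itself an admissible q in the enhancement condition, both
    being affine.\<close>
  have orth': "(LINT x|M. p x * v x) = (LINT x|M. p x * Pi_nabla vs v x)"
  proof -
    have "(LINT x|M. (v x - Pi_nabla vs v x) * p x) = (LINT x|M. p x * v x - p x * Pi_nabla vs v x)"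
      by (intro Bochner_Integration.integral_cong refl) (simp add: algebra_simps)
    also have "\<dots> = (LINT x|M. p x * v x) - (LINT x|M. p x * Pi_nabla vs v x)"
      by (rule Bochner_Integration.integral_diff[OF prod[OF vL] prod[OF Pi_L]])
    finally show ?thesis using orth[OF pP] by simp
  qed
  have "- (LINT x|M. p x * ?F (v x)) \<le> (L * ((2 + grad_const r) * K)) * ?V"
  proof -
    have i: "integrable M (\<lambda>x. p x * v x - p x * ?F (v x) - p x * Pi_nabla vs v x)"
      by (intro Bochner_Integration.integrable_diff prod vL FL Pi_L)
    \<comment> \<open>Adding the vanishing moment of v minus its projection replaces F(v) by v -
      F(v) minus the projection. Both remaining terms are bounded by multiples of K.\<close>
    have "- (LINT x|M. p x * ?F (v x)) = (LINT x|M. p x * v x - p x * ?F (v x) - p x * Pi_nabla vs v x)"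
      using prod[OF vL] prod[OF FL] prod[OF Pi_L] orth' by simp
    also have "\<dots> \<le> \<bar>\<dots>\<bar>" by (rule abs_ge_self)
    also have "\<dots> \<le> (L * ((2 + grad_const r) * K)) * measure M (space M)"
    proof (rule fM.abs_integral_le_AE[OF i], rule AE_I2)
      fix x assume "x \<in> space M"
      then have x: "x \<in> E" by simp
      have "\<bar>v x - ?F (v x) - Pi_nabla vs v x\<bar> \<le> (2 + grad_const r) * K"
        using soft_threshold_diff[OF K, of "v x"] Pi_b[OF x] by (simp add: distrib_right)
      then have "\<bar>p x\<bar> * \<bar>v x - ?F (v x) - Pi_nabla vs v x\<bar> \<le> L * ((2 + grad_const r) * K)"
        using pL[OF x] L0 by (intro mult_mono) auto
      then show "\<bar>p x * v x - p x * ?F (v x) - p x * Pi_nabla vs v x\<bar> \<le> L * ((2 + grad_const r) * K)"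
        by (simp add: abs_mult[symmetric] algebra_simps)
    qed
    finally show ?thesis unfolding mM .
  qed
  also have "\<dots> \<le> (L * ((2 + grad_const r) * K)) * (4 * \<rho>'\<^sup>2)"
    using L0 const_nonneg(1)[OF r] K by (intro mult_left_mono measure_E_le) simp
  finally have "16 * \<rho>'\<^sup>2 * - (LINT x|M. p x * ?F (v x)) \<le> 16 * \<rho>'\<^sup>2 * ((L * ((2 + grad_const r) * K)) * (4 * \<rho>'\<^sup>2))"
    by (intro mult_left_mono) auto
  then have X2_le: "X2 \<le> 64 * \<rho>' ^ 4 * (2 + grad_const r) * K * L"
  proof -
    assume le: "16 * \<rho>'\<^sup>2 * - (LINT x|M. p x * ?F (v x)) \<le> 16 * \<rho>'\<^sup>2 * ((L * ((2 + grad_const r) * K)) * (4 * \<rho>'\<^sup>2))"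
    have "16 * \<rho>'\<^sup>2 * ((L * ((2 + grad_const r) * K)) * (4 * \<rho>'\<^sup>2)) = 64 * (\<rho>'\<^sup>2 * \<rho>'\<^sup>2) * (2 + grad_const r) * K * L"
      by (simp add: mult_ac)
    also have "\<rho>'\<^sup>2 * \<rho>'\<^sup>2 = \<rho>' ^ 4" by (simp flip: power_add)
    finally show ?thesis using E le by linarith
  qed
  define X where "X = sqrt X2"
  have X20: "0 \<le> X2" unfolding X2_def by simp
  have X0: "0 \<le> X" and XX: "X\<^sup>2 = X2" using X20 by (auto simp: X_def)
  \<comment> \<open>Here |v| \<le> |F(v)| + 2 K; Cauchy-Schwarz and the area bound 4 \<rho>'^2
    produce the factors 2 \<rho>' and 8 \<rho>'^2.\<close>
  have N_le: "N \<le> 2 * \<rho>' * X + 8 * K * \<rho>'\<^sup>2"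
  proof -
    have Fi: "integrable M (\<lambda>x. \<bar>?F (v x)\<bar>)"
      by (intro integrable_abs square_integrable_integrable finite_measure_M FL)
    have vi: "integrable M (\<lambda>x. \<bar>v x\<bar>)"
      by (intro integrable_abs square_integrable_integrable finite_measure_M vL)
    have "N \<le> (LINT x|M. \<bar>?F (v x)\<bar> + 2 * K)"
      unfolding N_def
    proof (rule integral_mono[OF vi])
      show "integrable M (\<lambda>x. \<bar>?F (v x)\<bar> + 2 * K)" using Fi by simp
      show "\<bar>v x\<bar> \<le> \<bar>?F (v x)\<bar> + 2 * K" for x using soft_threshold_diff[OF K, of "v x"] by linarith
    qed
    also have "\<dots> = (LINT x|M. \<bar>?F (v x)\<bar>) + 2 * K * ?V"
      using Fi integral_const_M[of "2 * K"] by (simp add: measure_M)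
    finally have 1: "N \<le> (LINT x|M. \<bar>?F (v x)\<bar>) + 2 * K * ?V" .
    have "(LINT x|M. \<bar>?F (v x)\<bar> * 1)\<^sup>2 \<le> (LINT x|M. \<bar>?F (v x)\<bar>\<^sup>2) * (LINT x|M. 1\<^sup>2)"
      using Fi FL by (intro integral_Cauchy_Schwarz) (auto simp: square_integrable_def)
    also have "\<dots> = X\<^sup>2 * ?V" unfolding XX X2_def power2_abs using integral_const_M[of 1] by simp
    also have "\<dots> \<le> X\<^sup>2 * (4 * \<rho>'\<^sup>2)" by (intro mult_left_mono measure_E_le) simp
    also have "\<dots> = (2 * \<rho>' * X)\<^sup>2" by (simp add: power_mult_distrib)
    finally have "(LINT x|M. \<bar>?F (v x)\<bar>)\<^sup>2 \<le> (2 * \<rho>' * X)\<^sup>2" by simp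
    then have "(LINT x|M. \<bar>?F (v x)\<bar>) \<le> 2 * \<rho>' * X"
      by (rule power2_le_imp_le) (use rho'_pos X0 in simp)
    moreover have "2 * K * ?V \<le> 2 * K * (4 * \<rho>'\<^sup>2)" using K by (intro mult_left_mono measure_E_le) simp
    ultimately show ?thesis using 1 by simp
  qed
  have L_le: "L \<le> (2 * \<rho>' * X + 8 * K * \<rho>'\<^sup>2) / \<rho> ^ 4 * coeff_const (\<rho>' / \<rho>)"
    unfolding L_def r_def[symmetric]
    using N_le const_nonneg(2)[OF r] rho_pos by (intro mult_right_mono divide_right_mono) auto
  have fin: "K + L * \<rho>'\<^sup>2 \<le> sup_const (\<rho>' / \<rho>) * K"
    by (rule closing_estimate[OF rho_pos rho'_pos K X0 _ L_le]) (use X2_le in \<open>simp add: XX r_def\<close>)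
  have up: "AE x in M. v x \<le> K + L * \<rho>'\<^sup>2"
  proof (rule upper_bound[OF phi vL H T lims wp pc _ L0])
    show "AE x in boundary_measure vs. ?T x \<le> K" using TK by eventually_elim simp
    show "- L \<le> p x" if "x \<in> E" for x using pL[OF that] by linarith
  qed
  \<comment> \<open>The equation is linear and all bounds are symmetric, so the upper bound applies
    to - v with the signs of gradient, trace and Laplacian reversed.\<close>
  have lo: "AE x in M. - v x \<le> K + L * \<rho>'\<^sup>2"
  proof (rule upper_bound[where \<phi> = "\<lambda>n x. - \<phi> n x" and H = "\<lambda>x. - ?H x" and T = "\<lambda>x. - ?T x" and p = "\<lambda>x. - p x"])
    show "smooth (\<lambda>x. - \<phi> n x)" for n by (rule smooth_uminus[OF phi])
    show "square_integrable M (\<lambda>x. - v x)" "square_integrable M (\<lambda>x. - ?H x)"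
      "square_integrable (boundary_measure vs) (\<lambda>x. - ?T x)"
      using vL H T by (auto simp: square_integrable_def)
    have c: "(- y - - z)\<^sup>2 = (y - z)\<^sup>2" for y z :: real by (simp add: power2_commute)
    show "(\<lambda>n. LINT x|M. (- \<phi> n x - - v x)\<^sup>2) \<longlonglongrightarrow> 0" unfolding c by (rule lims(1))
    show "(\<lambda>n. LINT x|boundary_measure vs. (- \<phi> n x - - ?T x)\<^sup>2) \<longlonglongrightarrow> 0" unfolding c by (rule lims(3))
    have g: "norm (grad (\<lambda>x. - \<phi> n x) x - - ?H x) = norm (grad (\<phi> n) x - ?H x)" for n x
      unfolding grad_uminus[OF smooth_differentiable[OF phi]] by (simp add: norm_minus_commute)
    show "(\<lambda>n. LINT x|M. (norm (grad (\<lambda>x. - \<phi> n x) x - - ?H x))\<^sup>2) \<longlonglongrightarrow> 0" unfolding g by (rule lims(2))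
    show "weak_poisson E (\<lambda>x. - ?H x) (\<lambda>x. - p x)" using wp by (simp add: weak_poisson_def)
    show "continuous_on UNIV (\<lambda>x. - p x)" by (intro continuous_intros pc)
    show "- L \<le> - p x" if "x \<in> E" for x using pL[OF that] by linarith
    show "AE x in boundary_measure vs. - ?T x \<le> K" using TK by eventually_elim simp
  qed (rule L0)
  show ?thesis using up lo
  proof eventually_elim
    case (elim x)
    then show ?case using fin by linarith
  qed
qed

text \<open>\<open>VE_bound\<close> asks for a positive K, so k is enlarged by e / C and e tends to
  0; this also covers a vanishing trace.\<close>

lemma VE_Linf_bound:
  assumes v: "v \<in> VE vs"
  shows "Linf_norm M v \<le> ennreal (sup_const (\<rho>' / \<rho>)) * Linf_norm (boundary_measure vs) (boundary_trace vs v)"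
proof (cases "Linf_norm (boundary_measure vs) (boundary_trace vs v)")
  case (real k)
  let ?C = "sup_const (\<rho>' / \<rho>)"
  have C: "0 < ?C" using const_nonneg(4)[of "\<rho>' / \<rho>"] rho_pos rho'_pos by simp
  have TK: "AE x in boundary_measure vs. \<bar>boundary_trace vs v x\<bar> \<le> k"
  proof -
    have "AE x in boundary_measure vs. ennreal \<bar>boundary_trace vs v x\<bar> \<le> ennreal k"
      using esssup_AE[of "\<lambda>x. ennreal \<bar>boundary_trace vs v x\<bar>" "boundary_measure vs"]
      unfolding real(2)[unfolded Linf_norm_def] .
    then show ?thesis by eventually_elim (use real(1) in simp)
  qed
  have "v \<in> borel_measurable M" using v by (simp add: VE_def H1_def square_integrable_def)
  then have vm: "(\<lambda>x. ennreal \<bar>v x\<bar>) \<in> borel_measurable M" by measurable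
  have le: "Linf_norm M v \<le> ennreal (?C * (k + e))" if "0 < e" for e
  proof -
    have "AE x in M. \<bar>v x\<bar> \<le> ?C * (k + e)"
    proof (rule VE_bound[OF v])
      show "0 < k + e" using that real(1) by simp
      show "AE x in boundary_measure vs. \<bar>boundary_trace vs v x\<bar> \<le> k + e"
        using TK by eventually_elim (use that in simp)
    qed
    then show ?thesis unfolding Linf_norm_def
      by (intro esssup_I vm) (auto elim!: eventually_mono intro: ennreal_leI)
  qed
  have "Linf_norm M v \<le> ennreal (?C * k)"
  proof (rule ennreal_le_epsilon)
    fix e :: real assume e: "0 < e"
    have "Linf_norm M v \<le> ennreal (?C * (k + e / ?C))" using e C by (intro le) simp
    also have "?C * (k + e / ?C) = ?C * k + e" using C by (simp add: distrib_left)
    also have "ennreal (?C * k + e) = ennreal (?C * k) + ennreal e"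
      using e C real(1) by (intro ennreal_plus) auto
    finally show "Linf_norm M v \<le> ennreal (?C * k) + ennreal e" .
  qed
  then show ?thesis using C real by (simp add: ennreal_mult)
next
  case top
  \<comment> \<open>Positivity of the constant keeps the right-hand side infinite.\<close>
  have "0 < sup_const (\<rho>' / \<rho>)" using const_nonneg(4)[of "\<rho>' / \<rho>"] rho_pos rho'_pos by simp
  then show ?thesis unfolding top by (simp add: ennreal_mult_top)
qed

end

theorem proposition5p1:
  shows "\<exists>C :: real \<Rightarrow> real. (\<forall>r. 0 < C r) \<and>
    (\<forall>(vs :: (real^2) list) (c1 :: real^2) (\<rho>1 :: real) (c2 :: real^2) (\<rho>2 :: real).
       simple_polygon vs \<and> 0 < \<rho>1 \<and>
       star_shaped_wrt (polygon_domain vs) (ball c1 \<rho>1) \<and>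
       polygon_domain vs \<subseteq> ball c2 \<rho>2 \<longrightarrow>
       (\<forall>v\<in>VE vs.
          Linf_norm (lebesgue_on (polygon_domain vs)) v
          \<le> ennreal (C (\<rho>2 / \<rho>1)) * Linf_norm (boundary_measure vs) (boundary_trace vs v)))"
proof (intro exI conjI allI impI ballI)
  \<comment> \<open>The absolute value secures positivity for every real r; for the radii of a
    nonempty domain the ratio is positive and unchanged by it.\<close>
  show "0 < sup_const \<bar>r\<bar>" for r by (rule const_nonneg(4)) simp
  fix vs c1 \<rho>1 c2 \<rho>2 v
  assume a: "simple_polygon vs \<and> 0 < \<rho>1 \<and> star_shaped_wrt (polygon_domain vs) (ball c1 \<rho>1) \<and>
       polygon_domain vs \<subseteq> ball c2 \<rho>2" and v: "v \<in> VE vs"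
  show "Linf_norm (lebesgue_on (polygon_domain vs)) v
      \<le> ennreal (sup_const \<bar>\<rho>2 / \<rho>1\<bar>) * Linf_norm (boundary_measure vs) (boundary_trace vs v)"
  proof (cases "polygon_domain vs = {}")
    \<comment> \<open>Star-shapedness is vacuous for the empty set, so this case is settled
      directly: the norm over the empty space is at most 0.\<close>
    case True
    have "(\<lambda>x. ennreal \<bar>v x\<bar>) \<in> borel_measurable (lebesgue_on {})"
      by (rule measurableI) (auto simp: sets_restrict_space)
    then have "Linf_norm (lebesgue_on {}) v \<le> 0"
      unfolding Linf_norm_def by (intro esssup_I) (auto intro: AE_I2)
    then show ?thesis unfolding True by (rule order_trans) simp
  next
    case False
    then interpret star_polygon vs c1 \<rho>1 c2 \<rho>2 using a by unfold_locales auto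
    have "\<bar>\<rho>2 / \<rho>1\<bar> = \<rho>2 / \<rho>1" using rho_pos rho'_pos by simp
    then show ?thesis using VE_Linf_bound[OF v] by (simp only:)
  qed
qed

end
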